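(* Let $1\le r\le s$ be integers and let $V=GSV(r,s)$ be the affine algebraic variety $$V=\{(X,Y): X\in \mathrm{Mat}_{r\times s}(\mathbb{C}),\ Y\in \mathrm{Mat}_{s\times r}(\mathbb{C}),\ XY=I_{r\times r}\}\subset \mathbb{C}^{2rs}.$$ Then the canonical divisor $K_V$ of $V$ is Cartier.
   Context: The variety $GSV(r,s)$ is called the generalised affine Stiefel algebraic variety. It has dimension $n=rs+r(s-r)$, and its canonical divisor $K_V$ is the divisor (class) determined by the sheaf of canonical differentials $\mathcal{O}(K_V)=\bigwedge^{n}\Omega^1_V$, i.e. the divisor of a nonzero rational section of this sheaf. *)

theory Defs
  imports "Jordan_Normal_Form.Matrix" "HOL-Algebra.QuotRing"
begin

section \<open>Fields of fractions\<close>

definition frac :: "('a, 'm) ring_scheme \<Rightarrow> 'a \<Rightarrow> 'a \<Rightarrow> ('a \<times> 'a) set" where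
  "frac R a b = {(c, d). c \<in> carrier R \<and> d \<in> carrier R - {\<zero>\<^bsub>R\<^esub>} \<and> a \<otimes>\<^bsub>R\<^esub> d = c \<otimes>\<^bsub>R\<^esub> b}"

text \<open>The elements are the classes \<open>a/b\<close> of pairs; the operations are given on
  representatives and do not depend on them when \<open>R\<close> is a domain.\<close>

definition fraction_field :: "('a, 'm) ring_scheme \<Rightarrow> ('a \<times> 'a) set ring" where
  "fraction_field R =
    \<lparr>carrier = {frac R a b | a b. a \<in> carrier R \<and> b \<in> carrier R - {\<zero>\<^bsub>R\<^esub>}},
     mult = (\<lambda>P Q. \<Union>(a, b)\<in>P. \<Union>(c, d)\<in>Q. frac R (a \<otimes>\<^bsub>R\<^esub> c) (b \<otimes>\<^bsub>R\<^esub> d)),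
     one = frac R \<one>\<^bsub>R\<^esub> \<one>\<^bsub>R\<^esub>,
     zero = frac R \<zero>\<^bsub>R\<^esub> \<one>\<^bsub>R\<^esub>,
     add = (\<lambda>P Q. \<Union>(a, b)\<in>P. \<Union>(c, d)\<in>Q.
              frac R (a \<otimes>\<^bsub>R\<^esub> d \<oplus>\<^bsub>R\<^esub> c \<otimes>\<^bsub>R\<^esub> b) (b \<otimes>\<^bsub>R\<^esub> d))\<rparr>"

section \<open>Modules by generators and relations\<close>

text \<open>The record type of modules extends that of rings, so the fields \<open>mult\<close> and \<open>one\<close>
  of the modules below carry no meaning.\<close>

definition free_module :: "('a, 'm) ring_scheme \<Rightarrow> 'b set \<Rightarrow> ('a, 'b \<Rightarrow> 'a) module" where
  "free_module R S =
    \<lparr>carrier = {f. (\<forall>x. f x \<in> carrier R) \<and> (\<forall>x. x \<notin> S \<longrightarrow> f x = \<zero>\<^bsub>R\<^esub>) \<and>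
                   finite {x. f x \<noteq> \<zero>\<^bsub>R\<^esub>}},
     mult = undefined, one = undefined,
     zero = (\<lambda>_. \<zero>\<^bsub>R\<^esub>), add = (\<lambda>f g x. f x \<oplus>\<^bsub>R\<^esub> g x),
     smult = (\<lambda>a f x. a \<otimes>\<^bsub>R\<^esub> f x)\<rparr>"

definition free_gen :: "('a, 'm) ring_scheme \<Rightarrow> 'b \<Rightarrow> 'b \<Rightarrow> 'a" where
  "free_gen R x = (\<lambda>y. if y = x then \<one>\<^bsub>R\<^esub> else \<zero>\<^bsub>R\<^esub>)"

definition module_span ::
  "('a, 'm) ring_scheme \<Rightarrow> ('a, 'b, 'n) module_scheme \<Rightarrow> 'b set \<Rightarrow> 'b set" where
  "module_span R M A = \<Inter>{N. submodule N R M \<and> A \<subseteq> N}"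

definition quotient_module :: "('a, 'b, 'n) module_scheme \<Rightarrow> 'b set \<Rightarrow> ('a, 'b set) module" where
  "quotient_module M N =
    \<lparr>carrier = a_rcosets\<^bsub>M\<^esub> N,
     mult = undefined, one = undefined,
     zero = N, add = set_add M,
     smult = (\<lambda>a C. \<Union>x\<in>C. N +>\<^bsub>M\<^esub> (a \<odot>\<^bsub>M\<^esub> x))\<rparr>"

definition presented_module ::
  "('a, 'm) ring_scheme \<Rightarrow> 'b set \<Rightarrow> ('b \<Rightarrow> 'a) set \<Rightarrow> ('a, ('b \<Rightarrow> 'a) set) module" where
  "presented_module R S Rel =
    quotient_module (free_module R S) (module_span R (free_module R S) Rel)"

definition presented_gen ::
  "('a, 'm) ring_scheme \<Rightarrow> 'b set \<Rightarrow> ('b \<Rightarrow> 'a) set \<Rightarrow> 'b \<Rightarrow> ('b \<Rightarrow> 'a) set" where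
  "presented_gen R S Rel x =
    module_span R (free_module R S) Rel +>\<^bsub>free_module R S\<^esub> free_gen R x"

section \<open>Kaehler differentials and exterior powers\<close>

text \<open>\<open>kaehler R k\<close> is the module of Kaehler differentials of \<open>R\<close> over its subring \<open>k\<close>.\<close>

definition kaehler_relations :: "('a, 'm) ring_scheme \<Rightarrow> 'a set \<Rightarrow> ('a \<Rightarrow> 'a) set" where
  "kaehler_relations R k =
    (let F = free_module R (carrier R); \<delta> = free_gen R in
      {\<delta> (a \<oplus>\<^bsub>R\<^esub> b) \<ominus>\<^bsub>F\<^esub> (\<delta> a \<oplus>\<^bsub>F\<^esub> \<delta> b) | a b. a \<in> carrier R \<and> b \<in> carrier R} \<union>
      {\<delta> (a \<otimes>\<^bsub>R\<^esub> b) \<ominus>\<^bsub>F\<^esub> (a \<odot>\<^bsub>F\<^esub> \<delta> b \<oplus>\<^bsub>F\<^esub> b \<odot>\<^bsub>F\<^esub> \<delta> a) | a b.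
          a \<in> carrier R \<and> b \<in> carrier R} \<union>
      {\<delta> c | c. c \<in> k})"

definition kaehler :: "('a, 'm) ring_scheme \<Rightarrow> 'a set \<Rightarrow> ('a, ('a \<Rightarrow> 'a) set) module" where
  "kaehler R k = presented_module R (carrier R) (kaehler_relations R k)"

definition kaehler_d :: "('a, 'm) ring_scheme \<Rightarrow> 'a set \<Rightarrow> 'a \<Rightarrow> ('a \<Rightarrow> 'a) set" where
  "kaehler_d R k a = presented_gen R (carrier R) (kaehler_relations R k) a"

definition tuples :: "nat \<Rightarrow> 'a set \<Rightarrow> 'a list set" where
  "tuples n A = {xs. length xs = n \<and> set xs \<subseteq> A}"

definition exterior_relations ::
  "('a, 'm) ring_scheme \<Rightarrow> nat \<Rightarrow> ('a, 'b, 'n) module_scheme \<Rightarrow> ('b list \<Rightarrow> 'a) set" where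
  "exterior_relations R n M =
    (let F = free_module R (tuples n (carrier M)); \<delta> = free_gen R in
      {\<delta> (xs[i := x \<oplus>\<^bsub>M\<^esub> y]) \<ominus>\<^bsub>F\<^esub> (\<delta> (xs[i := x]) \<oplus>\<^bsub>F\<^esub> \<delta> (xs[i := y])) | xs i x y.
          xs \<in> tuples n (carrier M) \<and> i < n \<and> x \<in> carrier M \<and> y \<in> carrier M} \<union>
      {\<delta> (xs[i := a \<odot>\<^bsub>M\<^esub> x]) \<ominus>\<^bsub>F\<^esub> (a \<odot>\<^bsub>F\<^esub> \<delta> (xs[i := x])) | xs i a x.
          xs \<in> tuples n (carrier M) \<and> i < n \<and> a \<in> carrier R \<and> x \<in> carrier M} \<union>
      {\<delta> xs | xs. xs \<in> tuples n (carrier M) \<and> (\<exists>i j. i < j \<and> j < n \<and> xs ! i = xs ! j)})"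

definition exterior_power ::
  "('a, 'm) ring_scheme \<Rightarrow> nat \<Rightarrow> ('a, 'b, 'n) module_scheme \<Rightarrow> ('a, ('b list \<Rightarrow> 'a) set) module"
where
  "exterior_power R n M =
    presented_module R (tuples n (carrier M)) (exterior_relations R n M)"

definition wedge ::
  "('a, 'm) ring_scheme \<Rightarrow> nat \<Rightarrow> ('a, 'b, 'n) module_scheme \<Rightarrow> 'b list \<Rightarrow> ('b list \<Rightarrow> 'a) set" where
  "wedge R n M xs = presented_gen R (tuples n (carrier M)) (exterior_relations R n M) xs"

section \<open>Affine varieties\<close>

text \<open>An affine variety is given by its set \<open>V\<close> of points, in an affine space whose
  coordinate functions form the set \<open>X\<close>. This lets pairs of matrices serve as points.\<close>

inductive_set poly_functions :: "('p \<Rightarrow> complex) set \<Rightarrow> ('p \<Rightarrow> complex) set"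
  for X :: "('p \<Rightarrow> complex) set" where
  const: "(\<lambda>_. c) \<in> poly_functions X"
| coord: "x \<in> X \<Longrightarrow> x \<in> poly_functions X"
| add: "f \<in> poly_functions X \<Longrightarrow> g \<in> poly_functions X \<Longrightarrow> (\<lambda>p. f p + g p) \<in> poly_functions X"
| mult: "f \<in> poly_functions X \<Longrightarrow> g \<in> poly_functions X \<Longrightarrow> (\<lambda>p. f p * g p) \<in> poly_functions X"

definition coordinate_ring :: "'p set \<Rightarrow> ('p \<Rightarrow> complex) set \<Rightarrow> ('p \<Rightarrow> complex) ring" where
  "coordinate_ring V X =
    \<lparr>carrier = (\<lambda>f. restrict f V) ` poly_functions X,
     mult = (\<lambda>f g. \<lambda>p\<in>V. f p * g p), one = (\<lambda>p\<in>V. 1),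
     zero = (\<lambda>p\<in>V. 0), add = (\<lambda>f g. \<lambda>p\<in>V. f p + g p)\<rparr>"

definition zariski_closed :: "'p set \<Rightarrow> ('p \<Rightarrow> complex) set \<Rightarrow> 'p set \<Rightarrow> bool" where
  "zariski_closed V X Z \<longleftrightarrow> (\<exists>S \<subseteq> poly_functions X. Z = {p \<in> V. \<forall>f\<in>S. f p = 0})"

definition zariski_open :: "'p set \<Rightarrow> ('p \<Rightarrow> complex) set \<Rightarrow> 'p set \<Rightarrow> bool" where
  "zariski_open V X U \<longleftrightarrow> U \<subseteq> V \<and> zariski_closed V X (V - U)"

definition irreducible_closed :: "'p set \<Rightarrow> ('p \<Rightarrow> complex) set \<Rightarrow> 'p set \<Rightarrow> bool" where
  "irreducible_closed V X Z \<longleftrightarrow> zariski_closed V X Z \<and> Z \<noteq> {} \<and>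
    (\<forall>Z1 Z2. zariski_closed V X Z1 \<and> zariski_closed V X Z2 \<and> Z = Z1 \<union> Z2 \<longrightarrow> Z = Z1 \<or> Z = Z2)"

text \<open>Prime divisors of an irreducible \<open>V\<close>: irreducible closed subsets of codimension one.\<close>

definition prime_divisor :: "'p set \<Rightarrow> ('p \<Rightarrow> complex) set \<Rightarrow> 'p set \<Rightarrow> bool" where
  "prime_divisor V X D \<longleftrightarrow> irreducible_closed V X D \<and> D \<noteq> V \<and>
    (\<forall>Z. irreducible_closed V X Z \<and> D \<subseteq> Z \<longrightarrow> Z = D \<or> Z = V)"

definition function_field ::
  "'p set \<Rightarrow> ('p \<Rightarrow> complex) set \<Rightarrow> (('p \<Rightarrow> complex) \<times> ('p \<Rightarrow> complex)) set ring" where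
  "function_field V X = fraction_field (coordinate_ring V X)"

definition constants ::
  "'p set \<Rightarrow> ('p \<Rightarrow> complex) set \<Rightarrow> (('p \<Rightarrow> complex) \<times> ('p \<Rightarrow> complex)) set set" where
  "constants V X = {frac (coordinate_ring V X) (\<lambda>p\<in>V. c) (\<lambda>p\<in>V. 1) | c. True}"

text \<open>The local ring of \<open>V\<close> at the generic point of \<open>D\<close>, as a subring of the function field,
  and its maximal ideal.\<close>

definition local_ring_at ::
  "'p set \<Rightarrow> ('p \<Rightarrow> complex) set \<Rightarrow> 'p set \<Rightarrow> (('p \<Rightarrow> complex) \<times> ('p \<Rightarrow> complex)) set set" where
  "local_ring_at V X D =
    {frac (coordinate_ring V X) f g | f g.
      f \<in> carrier (coordinate_ring V X) \<and> g \<in> carrier (coordinate_ring V X) \<and> (\<exists>p\<in>D. g p \<noteq> 0)}"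

definition maximal_ideal_at ::
  "'p set \<Rightarrow> ('p \<Rightarrow> complex) set \<Rightarrow> 'p set \<Rightarrow> (('p \<Rightarrow> complex) \<times> ('p \<Rightarrow> complex)) set set" where
  "maximal_ideal_at V X D =
    {frac (coordinate_ring V X) f g | f g.
      f \<in> carrier (coordinate_ring V X) \<and> g \<in> carrier (coordinate_ring V X) \<and>
      (\<forall>p\<in>D. f p = 0) \<and> (\<exists>p\<in>D. g p \<noteq> 0)}"

definition uniformizer ::
  "'p set \<Rightarrow> ('p \<Rightarrow> complex) set \<Rightarrow> 'p set \<Rightarrow> (('p \<Rightarrow> complex) \<times> ('p \<Rightarrow> complex)) set \<Rightarrow> bool" where
  "uniformizer V X D t \<longleftrightarrow> t \<in> local_ring_at V X D \<and>
    maximal_ideal_at V X D = {t \<otimes>\<^bsub>function_field V X\<^esub> u | u. u \<in> local_ring_at V X D}"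

text \<open>The order of \<open>h\<close> along \<open>D\<close>, for \<open>h \<noteq> 0\<close>, when the local ring at \<open>D\<close> is a discrete
  valuation ring (as it is for every prime divisor of a normal variety).\<close>

definition order_along ::
  "'p set \<Rightarrow> ('p \<Rightarrow> complex) set \<Rightarrow> 'p set \<Rightarrow> (('p \<Rightarrow> complex) \<times> ('p \<Rightarrow> complex)) set \<Rightarrow> int" where
  "order_along V X D h =
    (THE k. \<exists>t u. uniformizer V X D t \<and> u \<in> local_ring_at V X D - maximal_ideal_at V X D \<and>
       h = u \<otimes>\<^bsub>function_field V X\<^esub> (t [^]\<^bsub>function_field V X\<^esub> k))"

section \<open>Weil and Cartier divisors\<close>

text \<open>A Weil divisor is represented by its coefficient function on prime divisors. It is Cartier
  if it is locally the divisor of a rational function. Local finiteness of the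
  divisor is then automatic.\<close>

definition cartier_divisor ::
  "'p set \<Rightarrow> ('p \<Rightarrow> complex) set \<Rightarrow> ('p set \<Rightarrow> int) \<Rightarrow> bool" where
  "cartier_divisor V X W \<longleftrightarrow>
    (\<forall>p\<in>V. \<exists>U h. zariski_open V X U \<and> p \<in> U \<and>
       h \<in> carrier (function_field V X) \<and> h \<noteq> \<zero>\<^bsub>function_field V X\<^esub> \<and>
       (\<forall>D. prime_divisor V X D \<and> D \<inter> U \<noteq> {} \<longrightarrow> W D = order_along V X D h))"

section \<open>The canonical divisor\<close>

text \<open>\<open>rational_forms n V X\<close> is the \<open>n\<close>-th exterior power of the differentials of the function
  field over the constants, that is, the stalk at the generic point of \<open>V\<close> of the
  \<open>n\<close>-th exterior power of the sheaf of differentials.\<close>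

definition rational_differentials where
  "rational_differentials V X = kaehler (function_field V X) (constants V X)"

definition rational_forms where
  "rational_forms n V X = exterior_power (function_field V X) n (rational_differentials V X)"

definition wedge_d where
  "wedge_d n V X fs =
    wedge (function_field V X) n (rational_differentials V X)
      (map (kaehler_d (function_field V X) (constants V X)) fs)"

text \<open>The rational forms that are regular at the generic point of \<open>D\<close>: the span over the local
  ring of all \<open>df1 \<and> \<dots> \<and> dfn\<close> with \<open>f1, \<dots>, fn\<close> in the local ring. This is the image in the
  rational forms of the stalk of the sheaf at that point, and is isomorphic to the stalk
  when \<open>V\<close> is smooth there, the stalk being free.\<close>

definition forms_at where
  "forms_at n V X D =
    module_span ((function_field V X)\<lparr>carrier := local_ring_at V X D\<rparr>) (rational_forms n V X)
      (wedge_d n V X ` tuples n (local_ring_at V X D))"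

definition local_generator where
  "local_generator n V X D e \<longleftrightarrow> e \<in> carrier (rational_forms n V X) \<and>
    forms_at n V X D = {a \<odot>\<^bsub>rational_forms n V X\<^esub> e | a. a \<in> local_ring_at V X D}"

text \<open>With \<open>n\<close> the dimension of \<open>V\<close>, the coefficient at \<open>D\<close> of the divisor of a nonzero rational
  \<open>n\<close>-form is the order of its coefficient with respect to a local generator.\<close>

definition divisor_of_form where
  "divisor_of_form n V X \<omega> D =
    (if prime_divisor V X D then
       (THE k. \<exists>e h. local_generator n V X D e \<and> h \<in> carrier (function_field V X) \<and>
          \<omega> = h \<odot>\<^bsub>rational_forms n V X\<^esub> e \<and> k = order_along V X D h)
     else 0)"

definition canonical_divisors :: "nat \<Rightarrow> 'p set \<Rightarrow> ('p \<Rightarrow> complex) set \<Rightarrow> ('p set \<Rightarrow> int) set" where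
  "canonical_divisors n V X =
    {divisor_of_form n V X \<omega> | \<omega>.
       \<omega> \<in> carrier (rational_forms n V X) \<and> \<omega> \<noteq> \<zero>\<^bsub>rational_forms n V X\<^esub>}"

section \<open>The generalised affine Stiefel variety\<close>

definition GSV :: "nat \<Rightarrow> nat \<Rightarrow> (complex mat \<times> complex mat) set" where
  "GSV r s = {(A, B). A \<in> carrier_mat r s \<and> B \<in> carrier_mat s r \<and> A * B = 1\<^sub>m r}"

definition GSV_coords :: "nat \<Rightarrow> nat \<Rightarrow> (complex mat \<times> complex mat \<Rightarrow> complex) set" where
  "GSV_coords r s =
    {(\<lambda>p. fst p $$ (i, j)) | i j. i < r \<and> j < s} \<union>
    {(\<lambda>p. snd p $$ (j, i)) | i j. i < r \<and> j < s}"

end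

theory Submission
  imports Defs "HOL-Algebra.Subrings" "Jordan_Normal_Form.Determinant"
begin

text \<open>Call \<open>x\<^sub>1, \<dots>, x\<^sub>n\<close> local coordinates at a point if near it every coordinate function is a
  polynomial in the \<open>x\<^sub>i\<close> divided by a fixed nonvanishing one. Then for every prime divisor \<open>D\<close>
  meeting this neighbourhood the differentials \<open>dx\<^sub>i\<close> span \<open>df\<close> for \<open>f\<close> in the local ring at \<open>D\<close>,
  so \<open>e = dx\<^sub>1 \<and> \<dots> \<and> dx\<^sub>n\<close> generates the forms regular at \<open>D\<close>, and a rational form \<open>h e\<close>
  has the divisor of \<open>h\<close> there. Two local generators differ by a unit of the local ring, and the
  definition of the order is invariant under such units, so no valuation theory is needed.

  That \<open>e \<noteq> 0\<close> is seen by differentiating rational functions along curves in the variety,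
  which yields an alternating functional with value 1 at \<open>e\<close>.

  On the Stiefel variety some \<open>r\<close> rows of \<open>B\<close> form an invertible matrix at every point
  \<open>(A, B)\<close>; Cramer's rule then expresses the corresponding columns of \<open>A\<close> by the other columns
  and \<open>B\<close>, which leaves \<open>rs + r(s - r)\<close> local coordinates. Irreducibility holds because any two
  points are joined by a rational curve.\<close>

section \<open>Modules given by generators and relations\<close>

text \<open>The order is a definite description that is never shown to denote; comparisons go
  through equality of the defining predicates. The real obstacle is that a local generator must be
  nonzero before coefficients can be compared, and that some nonzero form must exist at all. In a
  module given by generators and relations this is witnessed by a functional that respects the
  relations. Derivatives along curves attach a number to each point, with a separate curve through
  every point, and nothing says that these numbers vary rationally with the point. The functionals
  therefore take values in functions of the point, and every identity about them is claimed only on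
  some nonempty open set. Irreducibility makes finitely many such claims compatible.\<close>

lemma module_span_least: "submodule N R M \<Longrightarrow> A \<subseteq> N \<Longrightarrow> module_span R M A \<subseteq> N"
  by (auto simp: module_span_def)

lemma module_span_superset: "A \<subseteq> module_span R M A"
  by (auto simp: module_span_def)

text \<open>The span is an intersection, so closure holds without \<open>M\<close> being known to be
  a module over \<open>R\<close>. This matters later, when \<open>R\<close> is the record of the
  function field with its carrier cut down to a local ring.\<close>

lemma module_span_add:
  assumes "x \<in> module_span R M A" "y \<in> module_span R M A"
  shows "x \<oplus>\<^bsub>M\<^esub> y \<in> module_span R M A"
  unfolding module_span_def
proof safe
  fix N assume N: "submodule N R M" "A \<subseteq> N"
  then have "x \<in> N" "y \<in> N"
    using assms by (auto simp: module_span_def)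
  then show "x \<oplus>\<^bsub>M\<^esub> y \<in> N"
    using subgroup.m_closed[OF submodule.axioms(1)[OF N(1)]] by simp
qed

lemma module_span_zero: "\<zero>\<^bsub>M\<^esub> \<in> module_span R M A"
  unfolding module_span_def using subgroup.one_closed[OF submodule.axioms(1)] by fastforce

lemma module_span_smult:
  assumes "a \<in> carrier R" "x \<in> module_span R M A"
  shows "a \<odot>\<^bsub>M\<^esub> x \<in> module_span R M A"
  unfolding module_span_def
proof safe
  fix N assume N: "submodule N R M" "A \<subseteq> N"
  then have "x \<in> N"
    using assms(2) by (auto simp: module_span_def)
  then show "a \<odot>\<^bsub>M\<^esub> x \<in> N"
    using submodule.smult_closed[OF N(1) assms(1)] by simp
qed

section \<open>Submodules, spans and quotient modules\<close>

context module
begin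

lemma submodule_carrier: "submodule (carrier M) R M"
  by (rule submoduleI) auto

lemma submodule_zero_mem: "submodule N R M \<Longrightarrow> \<zero>\<^bsub>M\<^esub> \<in> N"
  using subgroup.one_closed submodule.axioms(1) by fastforce

lemma submodule_module_span:
  assumes "A \<subseteq> carrier M"
  shows "submodule (module_span R M A) R M"
proof (rule submoduleI)
  show "module_span R M A \<subseteq> carrier M"
    by (rule module_span_least[OF submodule_carrier assms])
  show "\<ominus>\<^bsub>M\<^esub> x \<in> module_span R M A" if "x \<in> module_span R M A" for x
    using that submoduleE(3) by (auto simp: module_span_def)
qed (simp_all add: module_span_zero module_span_add module_span_smult)

context
  fixes N
  assumes N: "submodule N R M"
begin

interpretation N: abelian_subgroup N M
  using N M.abelian_group_axioms
  by (intro abelian_subgroupI3 additive_subgroupI submodule.axioms(1))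

lemma coset_eq_iff:
  assumes "x \<in> carrier M" "y \<in> carrier M"
  shows "N +>\<^bsub>M\<^esub> x = N +>\<^bsub>M\<^esub> y \<longleftrightarrow> x \<ominus>\<^bsub>M\<^esub> y \<in> N"
proof
  assume "N +>\<^bsub>M\<^esub> x = N +>\<^bsub>M\<^esub> y"
  then have "x \<in> N +>\<^bsub>M\<^esub> y"
    using N.a_rcos_self[OF assms(1)] by simp
  then show "x \<ominus>\<^bsub>M\<^esub> y \<in> N"
    using N.a_rcos_module[OF assms(2,1)] by (simp add: M.minus_eq)
next
  assume "x \<ominus>\<^bsub>M\<^esub> y \<in> N"
  then have "x \<in> N +>\<^bsub>M\<^esub> y"
    using N.a_rcos_module[OF assms(2,1)] by (simp add: M.minus_eq)
  then show "N +>\<^bsub>M\<^esub> x = N +>\<^bsub>M\<^esub> y"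
    using M.a_repr_independence[OF _ assms(2) N.a_subgroup] by simp
qed

lemma coset_add:
  "x \<in> carrier M \<Longrightarrow> y \<in> carrier M \<Longrightarrow>
   (N +>\<^bsub>M\<^esub> x) \<oplus>\<^bsub>quotient_module M N\<^esub> (N +>\<^bsub>M\<^esub> y) = N +>\<^bsub>M\<^esub> (x \<oplus>\<^bsub>M\<^esub> y)"
  by (simp add: quotient_module_def N.a_rcos_sum)

text \<open>The scalar action on the quotient is a union over all representatives of the coset; the
  members of this union all coincide.\<close>

lemma coset_smult:
  assumes "a \<in> carrier R" "x \<in> carrier M"
  shows "a \<odot>\<^bsub>quotient_module M N\<^esub> (N +>\<^bsub>M\<^esub> x) = N +>\<^bsub>M\<^esub> (a \<odot>\<^bsub>M\<^esub> x)"
proof -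
  have "N +>\<^bsub>M\<^esub> (a \<odot>\<^bsub>M\<^esub> y) = N +>\<^bsub>M\<^esub> (a \<odot>\<^bsub>M\<^esub> x)" if y: "y \<in> N +>\<^bsub>M\<^esub> x" for y
  proof -
    have yc: "y \<in> carrier M"
      by (rule N.a_elemrcos_carrier[OF assms(2) y])
    have "N +>\<^bsub>M\<^esub> y = N +>\<^bsub>M\<^esub> x"
      by (rule M.a_repr_independence[OF y assms(2) N.a_subgroup, symmetric])
    then have "y \<ominus>\<^bsub>M\<^esub> x \<in> N"
      by (simp only: coset_eq_iff[OF yc assms(2)])
    then have "a \<odot>\<^bsub>M\<^esub> (y \<ominus>\<^bsub>M\<^esub> x) \<in> N"
      by (rule submoduleE(4)[OF N assms(1)])
    moreover have "a \<odot>\<^bsub>M\<^esub> (y \<ominus>\<^bsub>M\<^esub> x) = a \<odot>\<^bsub>M\<^esub> y \<ominus>\<^bsub>M\<^esub> a \<odot>\<^bsub>M\<^esub> x"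
      using assms yc by (simp add: M.minus_eq smult_r_distr smult_r_minus)
    ultimately show ?thesis
      using coset_eq_iff[of "a \<odot>\<^bsub>M\<^esub> y" "a \<odot>\<^bsub>M\<^esub> x"] assms yc by simp
  qed
  moreover have "x \<in> N +>\<^bsub>M\<^esub> x"
    by (rule N.a_rcos_self[OF assms(2)])
  ultimately have "(\<Union>y\<in>N +>\<^bsub>M\<^esub> x. N +>\<^bsub>M\<^esub> (a \<odot>\<^bsub>M\<^esub> y)) = N +>\<^bsub>M\<^esub> (a \<odot>\<^bsub>M\<^esub> x)"
    by blast
  then show ?thesis
    by (simp add: quotient_module_def)
qed

lemma carrier_quotient_module:
  "carrier (quotient_module M N) = (\<lambda>x. N +>\<^bsub>M\<^esub> x) ` carrier M"
  by (auto simp: quotient_module_def A_RCOSETS_def')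

lemma zero_quotient_module: "\<zero>\<^bsub>quotient_module M N\<^esub> = N +>\<^bsub>M\<^esub> \<zero>\<^bsub>M\<^esub>"
  using N.a_subset by (simp add: quotient_module_def)

lemma module_quotient_module: "module R (quotient_module M N)"
proof (rule moduleI)
  let ?Q = "quotient_module M N"
  show "cring R" ..
  show "abelian_group ?Q"
  proof (rule abelian_groupI)
    fix x y z assume "x \<in> carrier ?Q" "y \<in> carrier ?Q" "z \<in> carrier ?Q"
    then show "x \<oplus>\<^bsub>?Q\<^esub> y \<oplus>\<^bsub>?Q\<^esub> z = x \<oplus>\<^bsub>?Q\<^esub> (y \<oplus>\<^bsub>?Q\<^esub> z)"
      by (auto simp: carrier_quotient_module coset_add M.a_assoc)
  next
    fix x y assume "x \<in> carrier ?Q" "y \<in> carrier ?Q"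
    then show "x \<oplus>\<^bsub>?Q\<^esub> y = y \<oplus>\<^bsub>?Q\<^esub> x"
      by (auto simp: carrier_quotient_module coset_add M.a_comm)
  next
    fix x assume "x \<in> carrier ?Q"
    then obtain u where u: "u \<in> carrier M" "x = N +>\<^bsub>M\<^esub> u"
      by (auto simp: carrier_quotient_module)
    show "\<exists>y\<in>carrier ?Q. y \<oplus>\<^bsub>?Q\<^esub> x = \<zero>\<^bsub>?Q\<^esub>"
      by (rule bexI[of _ "N +>\<^bsub>M\<^esub> (\<ominus>\<^bsub>M\<^esub> u)"])
        (use u in \<open>auto simp: carrier_quotient_module coset_add zero_quotient_module M.l_neg\<close>)
  qed (auto simp: carrier_quotient_module coset_add zero_quotient_module)
qed (auto simp: carrier_quotient_module coset_add coset_smult smult_l_distr smult_r_distr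
    smult_assoc1)

end

end

section \<open>Free modules\<close>

lemma (in cring) module_free_module: "module R (free_module R S)"
proof (rule moduleI)
  let ?F = "free_module R S"
  have fin: "finite {x. f x \<oplus> g x \<noteq> \<zero>}"
    if "finite {x. f x \<noteq> \<zero>}" "finite {x. g x \<noteq> \<zero>}" for f g :: "'c \<Rightarrow> 'a"
    by (rule finite_subset[OF _ finite_UnI[OF that]]) auto
  show "cring R" ..
  show "abelian_group ?F"
  proof (rule abelian_groupI)
    fix f assume f: "f \<in> carrier ?F"
    have "{x. \<ominus> f x \<noteq> \<zero>} \<subseteq> {x. f x \<noteq> \<zero>}"
      by auto
    then have "(\<lambda>x. \<ominus> f x) \<in> carrier ?F"
      using f by (auto simp: free_module_def intro: finite_subset)
    moreover have "(\<lambda>x. \<ominus> f x) \<oplus>\<^bsub>?F\<^esub> f = \<zero>\<^bsub>?F\<^esub>"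
      using f by (auto simp: free_module_def l_neg)
    ultimately show "\<exists>g\<in>carrier ?F. g \<oplus>\<^bsub>?F\<^esub> f = \<zero>\<^bsub>?F\<^esub>"
      by blast
  next
    fix f g assume "f \<in> carrier ?F" "g \<in> carrier ?F"
    then show "f \<oplus>\<^bsub>?F\<^esub> g = g \<oplus>\<^bsub>?F\<^esub> f"
      by (auto simp: free_module_def a_comm)
  qed (auto simp: free_module_def fin a_assoc)
  fix a f assume a: "a \<in> carrier R" and f: "f \<in> carrier ?F"
  have "{x. a \<otimes> f x \<noteq> \<zero>} \<subseteq> {x. f x \<noteq> \<zero>}"
    using a by auto
  then show "a \<odot>\<^bsub>?F\<^esub> f \<in> carrier ?F"
    using a f by (auto simp: free_module_def intro: finite_subset)
qed (auto simp: free_module_def l_distr r_distr m_assoc)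

lemma (in cring) free_gen_closed: "x \<in> S \<Longrightarrow> free_gen R x \<in> carrier (free_module R S)"
  by (auto simp: free_module_def free_gen_def)

text \<open>Induction on a finite set \<open>A\<close> containing the support rather than on the
  support itself, so that points of \<open>A\<close> where \<open>f\<close> vanishes do no harm.
  Each step splits off a multiple of one generator.\<close>

lemma (in cring) free_module_span_gens:
  assumes N: "submodule N R (free_module R S)" and gens: "\<And>x. x \<in> S \<Longrightarrow> free_gen R x \<in> N"
  shows "carrier (free_module R S) \<subseteq> N"
proof
  let ?F = "free_module R S"
  interpret F: module R ?F by (rule module_free_module)
  fix f assume "f \<in> carrier ?F"
  moreover have "finite A \<Longrightarrow> f \<in> carrier ?F \<Longrightarrow> {x. f x \<noteq> \<zero>} \<subseteq> A \<Longrightarrow> f \<in> N" for A f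
  proof (induction A arbitrary: f rule: finite_induct)
    case empty
    then have "f = \<zero>\<^bsub>?F\<^esub>" by (auto simp: free_module_def)
    then show ?case using F.submodule_zero_mem[OF N] by simp
  next
    case (insert x A)
    show ?case
    proof (cases "x \<in> S")
      case False
      with insert.prems have "f x = \<zero>" by (auto simp: free_module_def)
      with insert show ?thesis by blast
    next
      case True
      define g where "g = f(x := \<zero>)"
      have "{y. g y \<noteq> \<zero>} \<subseteq> {y. f y \<noteq> \<zero>}" by (auto simp: g_def)
      then have g: "g \<in> carrier ?F"
        using insert.prems(1) by (auto simp: free_module_def g_def intro: finite_subset)
      have "g \<in> N"
        by (rule insert.IH[OF g]) (use insert.prems in \<open>auto simp: g_def split: if_splits\<close>)
      moreover have fx: "f x \<in> carrier R"
        using insert.prems(1) by (auto simp: free_module_def)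
      moreover have "f x \<odot>\<^bsub>?F\<^esub> free_gen R x \<in> N"
        using F.submoduleE(4)[OF N fx gens[OF True]] .
      moreover have "f = g \<oplus>\<^bsub>?F\<^esub> f x \<odot>\<^bsub>?F\<^esub> free_gen R x"
        using insert.prems(1) by (auto simp: free_module_def g_def free_gen_def)
      ultimately show ?thesis
        using F.submoduleE(5)[OF N] by metis
    qed
  qed
  ultimately show "f \<in> N"
    by (auto simp: free_module_def)
qed

section \<open>Modules presented by generators and relations\<close>

context cring
begin

context
  fixes S :: "'c set" and Rel :: "('c \<Rightarrow> 'a) set"
  assumes Rel: "Rel \<subseteq> carrier (free_module R S)"
begin

interpretation F: module R "free_module R S" by (rule module_free_module)

lemmas span = F.submodule_module_span[OF Rel]

definition presented_class :: "('c \<Rightarrow> 'a) \<Rightarrow> ('c \<Rightarrow> 'a) set" where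
  "presented_class f = module_span R (free_module R S) Rel +>\<^bsub>free_module R S\<^esub> f"

lemma module_presented_module: "module R (presented_module R S Rel)"
  unfolding presented_module_def by (rule F.module_quotient_module[OF span])

lemma carrier_presented_module:
  "carrier (presented_module R S Rel) = presented_class ` carrier (free_module R S)"
  unfolding presented_module_def presented_class_def by (rule F.carrier_quotient_module[OF span])

lemma presented_class_add:
  "f \<in> carrier (free_module R S) \<Longrightarrow> g \<in> carrier (free_module R S) \<Longrightarrow>
   presented_class (f \<oplus>\<^bsub>free_module R S\<^esub> g) =
   presented_class f \<oplus>\<^bsub>presented_module R S Rel\<^esub> presented_class g"
  unfolding presented_module_def presented_class_def by (simp add: F.coset_add[OF span])

lemma presented_class_smult:
  "a \<in> carrier R \<Longrightarrow> f \<in> carrier (free_module R S) \<Longrightarrow>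
   presented_class (a \<odot>\<^bsub>free_module R S\<^esub> f) = a \<odot>\<^bsub>presented_module R S Rel\<^esub> presented_class f"
  unfolding presented_module_def presented_class_def by (simp add: F.coset_smult[OF span])

lemma presented_class_zero:
  "presented_class \<zero>\<^bsub>free_module R S\<^esub> = \<zero>\<^bsub>presented_module R S Rel\<^esub>"
  unfolding presented_module_def presented_class_def by (simp add: F.zero_quotient_module[OF span])

lemma presented_class_eq_iff:
  "f \<in> carrier (free_module R S) \<Longrightarrow> g \<in> carrier (free_module R S) \<Longrightarrow>
   presented_class f = presented_class g \<longleftrightarrow>
   f \<ominus>\<^bsub>free_module R S\<^esub> g \<in> module_span R (free_module R S) Rel"
  unfolding presented_class_def by (rule F.coset_eq_iff[OF span])

lemma presented_gen_eq: "presented_gen R S Rel x = presented_class (free_gen R x)"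
  by (simp add: presented_gen_def presented_class_def)

lemma presented_class_rel:
  assumes "f \<in> Rel" shows "presented_class f = \<zero>\<^bsub>presented_module R S Rel\<^esub>"
proof -
  have f: "f \<in> carrier (free_module R S)"
    using assms Rel by blast
  then have "f \<ominus>\<^bsub>free_module R S\<^esub> \<zero>\<^bsub>free_module R S\<^esub> = f"
    by (simp add: F.minus_eq)
  then have "f \<ominus>\<^bsub>free_module R S\<^esub> \<zero>\<^bsub>free_module R S\<^esub> \<in> module_span R (free_module R S) Rel"
    using assms module_span_superset[of Rel R "free_module R S"] by auto
  then have "presented_class f = presented_class \<zero>\<^bsub>free_module R S\<^esub>"
    by (simp only: presented_class_eq_iff[OF f F.zero_closed])
  then show ?thesis
    by (simp only: presented_class_zero)
qed

lemma presented_class_rel_eq: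
  assumes "f \<ominus>\<^bsub>free_module R S\<^esub> g \<in> Rel"
    and "f \<in> carrier (free_module R S)" "g \<in> carrier (free_module R S)"
  shows "presented_class f = presented_class g"
  using presented_class_eq_iff[OF assms(2,3)] assms(1)
    module_span_superset[of Rel R "free_module R S"] by blast

text \<open>\<open>N\<close> is pulled back along the quotient map, which reduces the claim to the
  free module.\<close>

lemma presented_module_span_gens:
  assumes N: "submodule N R (presented_module R S Rel)"
    and gens: "\<And>x. x \<in> S \<Longrightarrow> presented_gen R S Rel x \<in> N"
  shows "carrier (presented_module R S Rel) \<subseteq> N"
proof -
  interpret P: module R "presented_module R S Rel" by (rule module_presented_module)
  let ?F = "free_module R S"
  let ?N = "{f \<in> carrier ?F. presented_class f \<in> N}"
  have "submodule ?N R ?F"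
  proof (rule F.submoduleI)
    fix f assume f: "f \<in> ?N"
    have "\<ominus>\<^bsub>?F\<^esub> f = (\<ominus> \<one>) \<odot>\<^bsub>?F\<^esub> f"
      using f F.smult_l_minus[of \<one> f] by simp
    then show "\<ominus>\<^bsub>?F\<^esub> f \<in> ?N"
      using f P.submoduleE(4)[OF N, of "\<ominus> \<one>"] by (simp add: presented_class_smult)
  qed (auto simp: presented_class_zero presented_class_add presented_class_smult
      P.submodule_zero_mem[OF N] P.submoduleE(4,5)[OF N])
  then have "carrier ?F \<subseteq> ?N"
    by (rule free_module_span_gens) (use gens free_gen_closed in \<open>auto simp: presented_gen_eq\<close>)
  then show ?thesis
    by (auto simp: carrier_presented_module)
qed

end

end

section \<open>Differentials and exterior powers\<close>

text \<open>A subring contains minus one, so closure under inverses follows from closure under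
  scalars. The ambient module stays over \<open>R\<close>; only the scalars of \<open>N\<close> are
  restricted.\<close>

lemma (in module) submodule_subringI:
  assumes "subring O' R" "N \<subseteq> carrier M" "\<zero>\<^bsub>M\<^esub> \<in> N"
    and "\<And>x y. x \<in> N \<Longrightarrow> y \<in> N \<Longrightarrow> x \<oplus>\<^bsub>M\<^esub> y \<in> N"
    and smult: "\<And>a x. a \<in> O' \<Longrightarrow> x \<in> N \<Longrightarrow> a \<odot>\<^bsub>M\<^esub> x \<in> N"
  shows "submodule N (R\<lparr>carrier := O'\<rparr>) M"
proof -
  have "\<ominus>\<^bsub>M\<^esub> x \<in> N" if x: "x \<in> N" for x
  proof -
    have "\<ominus>\<^bsub>M\<^esub> x = (\<ominus> \<one>) \<odot>\<^bsub>M\<^esub> x"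
      using x assms(2) smult_l_minus[of \<one> x] by auto
    also have "\<dots> \<in> N"
      using smult[OF _ x] subringE(3,5)[OF assms(1)] by simp
    finally show ?thesis .
  qed
  then have "subgroup N (add_monoid M)"
    using assms by (intro M.add.subgroupI) auto
  then show ?thesis
    using smult by (intro submodule.intro) (auto simp: submodule_axioms_def)
qed

lemma tuples_update: "xs \<in> tuples n A \<Longrightarrow> x \<in> A \<Longrightarrow> xs[i := x] \<in> tuples n A"
  using set_update_subset_insert[of xs i x] by (auto simp: tuples_def)

lemma tuples_nth: "xs \<in> tuples n A \<Longrightarrow> i < n \<Longrightarrow> xs ! i \<in> A"
  by (auto simp: tuples_def)

section \<open>Kaehler differentials\<close>

context cring
begin

context
  fixes k assumes k: "k \<subseteq> carrier R"
begin

interpretation F: module R "free_module R (carrier R)" by (rule module_free_module)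

lemma kaehler_relations_closed: "kaehler_relations R k \<subseteq> carrier (free_module R (carrier R))"
  using k free_gen_closed[where S = "carrier R"]
  by (auto simp: kaehler_relations_def Let_def intro!: F.minus_closed F.a_closed F.smult_closed)

lemmas rel = kaehler_relations_closed

lemma module_kaehler: "module R (kaehler R k)"
  unfolding kaehler_def by (rule module_presented_module[OF rel])

lemma kaehler_d_closed: "a \<in> carrier R \<Longrightarrow> kaehler_d R k a \<in> carrier (kaehler R k)"
  unfolding kaehler_def kaehler_d_def presented_gen_eq[OF rel] carrier_presented_module[OF rel]
  by (intro imageI free_gen_closed)

lemma kaehler_d_add:
  assumes "a \<in> carrier R" "b \<in> carrier R"
  shows "kaehler_d R k (a \<oplus> b) = kaehler_d R k a \<oplus>\<^bsub>kaehler R k\<^esub> kaehler_d R k b"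
proof -
  have "free_gen R (a \<oplus> b) \<ominus>\<^bsub>free_module R (carrier R)\<^esub>
    (free_gen R a \<oplus>\<^bsub>free_module R (carrier R)\<^esub> free_gen R b) \<in> kaehler_relations R k"
    using assms by (auto simp: kaehler_relations_def Let_def)
  from presented_class_rel_eq[OF rel this] show ?thesis
    using assms
    by (simp add: kaehler_def kaehler_d_def presented_gen_eq[OF rel] free_gen_closed
        presented_class_add[OF rel])
qed

lemma kaehler_d_mult:
  assumes "a \<in> carrier R" "b \<in> carrier R"
  shows "kaehler_d R k (a \<otimes> b) =
    a \<odot>\<^bsub>kaehler R k\<^esub> kaehler_d R k b \<oplus>\<^bsub>kaehler R k\<^esub> b \<odot>\<^bsub>kaehler R k\<^esub> kaehler_d R k a"
proof -
  have "free_gen R (a \<otimes> b) \<ominus>\<^bsub>free_module R (carrier R)\<^esub>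
    (a \<odot>\<^bsub>free_module R (carrier R)\<^esub> free_gen R b \<oplus>\<^bsub>free_module R (carrier R)\<^esub>
     b \<odot>\<^bsub>free_module R (carrier R)\<^esub> free_gen R a) \<in> kaehler_relations R k"
    using assms by (auto simp: kaehler_relations_def Let_def)
  from presented_class_rel_eq[OF rel this] show ?thesis
    using assms
    by (simp add: kaehler_def kaehler_d_def presented_gen_eq[OF rel] free_gen_closed
        presented_class_add[OF rel] presented_class_smult[OF rel])
qed

lemma kaehler_d_const:
  assumes "c \<in> k"
  shows "kaehler_d R k c = \<zero>\<^bsub>kaehler R k\<^esub>"
proof -
  have "free_gen R c \<in> kaehler_relations R k"
    using assms by (auto simp: kaehler_relations_def Let_def)
  from presented_class_rel[OF rel this] show ?thesis
    by (simp add: kaehler_def kaehler_d_def presented_gen_eq[OF rel])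
qed

lemma kaehler_span:
  assumes "submodule N R (kaehler R k)" "\<And>a. a \<in> carrier R \<Longrightarrow> kaehler_d R k a \<in> N"
  shows "carrier (kaehler R k) \<subseteq> N"
  using presented_module_span_gens[OF rel, of N] assms
  by (simp add: kaehler_def kaehler_d_def)

end

end

section \<open>Exterior powers\<close>

context module
begin

context
  fixes n :: nat
begin

abbreviation (input) "W \<equiv> exterior_power R n M"
abbreviation (input) "T \<equiv> tuples n (carrier M)"

interpretation F: module R "free_module R T" by (rule module_free_module)

lemma exterior_relations_closed:
  "exterior_relations R n M \<subseteq> carrier (free_module R T)"
  using free_gen_closed[where S = T]
  by (auto simp: exterior_relations_def Let_def tuples_update
      intro!: F.minus_closed F.a_closed F.smult_closed)

lemmas rel = exterior_relations_closed

lemma module_exterior_power: "module R W"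
  unfolding exterior_power_def by (rule module_presented_module[OF rel])

interpretation W: module R W by (rule module_exterior_power)

lemma wedge_closed: "xs \<in> T \<Longrightarrow> wedge R n M xs \<in> carrier W"
  unfolding exterior_power_def wedge_def presented_gen_eq[OF rel] carrier_presented_module[OF rel]
  by (intro imageI free_gen_closed)

lemma wedge_add:
  assumes "xs \<in> T" "i < n" "x \<in> carrier M" "y \<in> carrier M"
  shows "wedge R n M (xs[i := x \<oplus>\<^bsub>M\<^esub> y]) = wedge R n M (xs[i := x]) \<oplus>\<^bsub>W\<^esub> wedge R n M (xs[i := y])"
proof -
  have "free_gen R (xs[i := x \<oplus>\<^bsub>M\<^esub> y]) \<ominus>\<^bsub>free_module R T\<^esub>
    (free_gen R (xs[i := x]) \<oplus>\<^bsub>free_module R T\<^esub> free_gen R (xs[i := y])) \<in> exterior_relations R n M"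
    unfolding exterior_relations_def Let_def using assms by blast
  from presented_class_rel_eq[OF rel this] show ?thesis
    using assms
    by (simp add: exterior_power_def wedge_def presented_gen_eq[OF rel] free_gen_closed tuples_update
        presented_class_add[OF rel])
qed

lemma wedge_smult:
  assumes "xs \<in> T" "i < n" "a \<in> carrier R" "x \<in> carrier M"
  shows "wedge R n M (xs[i := a \<odot>\<^bsub>M\<^esub> x]) = a \<odot>\<^bsub>W\<^esub> wedge R n M (xs[i := x])"
proof -
  have "free_gen R (xs[i := a \<odot>\<^bsub>M\<^esub> x]) \<ominus>\<^bsub>free_module R T\<^esub>
    (a \<odot>\<^bsub>free_module R T\<^esub> free_gen R (xs[i := x])) \<in> exterior_relations R n M"
    unfolding exterior_relations_def Let_def using assms by blast
  from presented_class_rel_eq[OF rel this] show ?thesis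
    using assms
    by (simp add: exterior_power_def wedge_def presented_gen_eq[OF rel] free_gen_closed tuples_update
        presented_class_smult[OF rel])
qed

lemma wedge_eq_zero:
  assumes "xs \<in> T" "i < n" "j < n" "i \<noteq> j" "xs ! i = xs ! j"
  shows "wedge R n M xs = \<zero>\<^bsub>W\<^esub>"
proof -
  have "\<exists>i j. i < j \<and> j < n \<and> xs ! i = xs ! j"
    using assms by (metis linorder_neqE_nat)
  then have "free_gen R xs \<in> exterior_relations R n M"
    unfolding exterior_relations_def Let_def using assms(1) by blast
  from presented_class_rel[OF rel this] show ?thesis
    by (simp add: exterior_power_def wedge_def presented_gen_eq[OF rel])
qed

lemma exterior_power_span:
  assumes "submodule N R W" "\<And>xs. xs \<in> T \<Longrightarrow> wedge R n M xs \<in> N"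
  shows "carrier W \<subseteq> N"
  using presented_module_span_gens[OF rel, of N] assms
  by (simp add: exterior_power_def wedge_def)

text \<open>Polarisation: with \<open>x \<oplus> y\<close> in both positions the wedge vanishes, and
  of its four terms the two with equal entries vanish too.\<close>

lemma wedge_swap:
  assumes xs: "xs \<in> T" and ij: "i < n" "j < n" "i \<noteq> j"
  shows "wedge R n M (xs[i := xs ! j, j := xs ! i]) = \<ominus>\<^bsub>W\<^esub> wedge R n M xs"
proof -
  define B where "B x y = wedge R n M (xs[i := x, j := y])" for x y
  have len: "length xs = n" using xs by (simp add: tuples_def)
  let ?x = "xs ! i" and ?y = "xs ! j"
  have c: "?x \<in> carrier M" "?y \<in> carrier M"
    using xs ij by (auto intro: tuples_nth)
  have B: "B x y \<in> carrier W" if "x \<in> carrier M" "y \<in> carrier M" for x y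
    unfolding B_def using that by (intro wedge_closed tuples_update xs)
  have diag: "B x x = \<zero>\<^bsub>W\<^esub>" if "x \<in> carrier M" for x
    unfolding B_def using that ij len by (intro wedge_eq_zero[OF _ ij] tuples_update xs) auto
  have add_r: "B x (y \<oplus>\<^bsub>M\<^esub> y') = B x y \<oplus>\<^bsub>W\<^esub> B x y'"
    if "x \<in> carrier M" "y \<in> carrier M" "y' \<in> carrier M" for x y y'
    unfolding B_def using that ij by (intro wedge_add tuples_update xs) auto
  have add_l: "B (x \<oplus>\<^bsub>M\<^esub> x') y = B x y \<oplus>\<^bsub>W\<^esub> B x' y"
    if "x \<in> carrier M" "x' \<in> carrier M" "y \<in> carrier M" for x x' y
    unfolding B_def list_update_swap[OF ij(3)]
    using that ij by (intro wedge_add tuples_update xs) auto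
  have "\<zero>\<^bsub>W\<^esub> = B (?x \<oplus>\<^bsub>M\<^esub> ?y) (?x \<oplus>\<^bsub>M\<^esub> ?y)"
    using diag c by simp
  also have "\<dots> = (B ?x ?x \<oplus>\<^bsub>W\<^esub> B ?y ?x) \<oplus>\<^bsub>W\<^esub> (B ?x ?y \<oplus>\<^bsub>W\<^esub> B ?y ?y)"
    using c by (simp add: add_l add_r)
  also have "\<dots> = B ?y ?x \<oplus>\<^bsub>W\<^esub> B ?x ?y"
    using c B by (simp add: diag)
  finally have "B ?y ?x = \<ominus>\<^bsub>W\<^esub> B ?x ?y"
    using c B W.minus_equality by metis
  moreover have "B ?x ?y = wedge R n M xs"
    by (simp add: B_def)
  ultimately show ?thesis
    by (simp add: B_def)
qed

context
  fixes bs assumes bs: "bs \<in> T"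
begin

text \<open>The sign is not tracked: the only use is membership in a set of multiples by a subring,
  which contains minus one. The permutation is built from transpositions, each handled by
  \<open>wedge_swap\<close>.\<close>

lemma wedge_permuted:
  assumes "p permutes {..<n}"
  shows "wedge R n M (map (\<lambda>i. bs ! p i) [0..<n]) \<in> {wedge R n M bs, \<ominus>\<^bsub>W\<^esub> wedge R n M bs}"
  using finite_lessThan assms
proof (induction rule: permutes_rev_induct)
  case id
  have "map (\<lambda>i. bs ! i) [0..<n] = bs"
    using bs by (intro nth_equalityI) (auto simp: tuples_def)
  then show ?case by simp
next
  case (swap a b p)
  let ?l = "\<lambda>p. map (\<lambda>i. bs ! p i) [0..<n]"
  show ?case
  proof (cases "a = b")
    case False
    have "?l (p \<circ> Transposition.transpose a b) = (?l p)[a := ?l p ! b, b := ?l p ! a]"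
      using swap(1,2) by (intro nth_equalityI) (auto simp: nth_list_update Transposition.transpose_def)
    moreover have "?l p \<in> T"
      using bs permutes_in_image[OF swap.hyps(4)] tuples_nth[OF bs]
      by (auto simp: tuples_def)
    ultimately have "wedge R n M (?l (p \<circ> Transposition.transpose a b)) = \<ominus>\<^bsub>W\<^esub> wedge R n M (?l p)"
      using wedge_swap[of "?l p" a b] swap(1,2) False by simp
    then show ?thesis
      using swap.IH wedge_closed[OF bs] by auto
  qed (use swap in simp)
qed

text \<open>Multilinear expansion. As \<open>bs\<close> has exactly \<open>n\<close> entries, a
  wedge of \<open>n\<close> entries of \<open>bs\<close> is zero or, up to sign, the wedge of
  \<open>bs\<close>. Having the coefficient in \<open>O'\<close> and not merely in \<open>R\<close>
  is what later yields local generators.\<close>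

lemma wedge_span:
  assumes O: "subring O' R" and xs: "xs \<in> tuples n (module_span (R\<lparr>carrier := O'\<rparr>) M (set bs))"
  shows "\<exists>a\<in>O'. wedge R n M xs = a \<odot>\<^bsub>W\<^esub> wedge R n M bs"
proof -
  let ?S = "module_span (R\<lparr>carrier := O'\<rparr>) M (set bs)"
  let ?L = "{a \<odot>\<^bsub>W\<^esub> wedge R n M bs | a. a \<in> O'}"
  note Os = subringE[OF O]
  have L0: "\<zero>\<^bsub>W\<^esub> \<in> ?L"
    using Os(2) wedge_closed[OF bs] by (auto intro!: exI[of _ \<zero>])
  have L1: "wedge R n M bs \<in> ?L"
    using Os(3) wedge_closed[OF bs] by (auto intro!: exI[of _ \<one>])
  have Ladd: "x \<oplus>\<^bsub>W\<^esub> y \<in> ?L" if "x \<in> ?L" "y \<in> ?L" for x y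
  proof -
    obtain a b where ab: "a \<in> O'" "b \<in> O'" "x = a \<odot>\<^bsub>W\<^esub> wedge R n M bs" "y = b \<odot>\<^bsub>W\<^esub> wedge R n M bs"
      using \<open>x \<in> ?L\<close> \<open>y \<in> ?L\<close> by blast
    then have "x \<oplus>\<^bsub>W\<^esub> y = (a \<oplus> b) \<odot>\<^bsub>W\<^esub> wedge R n M bs"
      using W.smult_l_distr[of a b "wedge R n M bs"] subsetD[OF Os(1)] wedge_closed[OF bs] by simp
    then show ?thesis
      using Os(7)[OF ab(1,2)] by blast
  qed
  have Lsmult: "b \<odot>\<^bsub>W\<^esub> x \<in> ?L" if "b \<in> O'" "x \<in> ?L" for b x
  proof -
    obtain a where a: "a \<in> O'" "x = a \<odot>\<^bsub>W\<^esub> wedge R n M bs"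
      using \<open>x \<in> ?L\<close> by blast
    then have "b \<odot>\<^bsub>W\<^esub> x = (b \<otimes> a) \<odot>\<^bsub>W\<^esub> wedge R n M bs"
      using W.smult_assoc1[of b a "wedge R n M bs"] subsetD[OF Os(1)] wedge_closed[OF bs] that(1)
      by simp
    then show ?thesis
      using Os(6)[OF that(1) a(1)] by blast
  qed
  have S: "?S \<subseteq> carrier M"
    using bs by (intro module_span_least submodule_subringI[OF O])
      (auto simp: tuples_def subsetD[OF Os(1)])
  \<comment> \<open>Induction on the number \<open>m\<close> of leading entries that are arbitrary
    in the span; the others are already entries of \<open>bs\<close>.\<close>
  have "wedge R n M xs \<in> ?L"
    if "m \<le> n" "length xs = n" "\<And>i. i < m \<Longrightarrow> xs ! i \<in> ?S" "\<And>i. m \<le> i \<Longrightarrow> i < n \<Longrightarrow> xs ! i \<in> set bs"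
    for m xs
    using that
  proof (induction m arbitrary: xs)
    case 0
    then have "\<forall>i. \<exists>j. i < n \<longrightarrow> j < n \<and> xs ! i = bs ! j"
      using bs by (auto simp: tuples_def in_set_conv_nth) metis
    then obtain f where f: "\<And>i. i < n \<Longrightarrow> f i < n" "\<And>i. i < n \<Longrightarrow> xs ! i = bs ! f i"
      by metis
    have xsT: "xs \<in> T"
      using 0 bs by (auto simp: tuples_def in_set_conv_nth) (metis nth_mem subsetD)
    show ?case
    proof (cases "inj_on f {..<n}")
      case False
      then obtain i j where "i < n" "j < n" "i \<noteq> j" "f i = f j"
        by (auto simp: inj_on_def)
      then show ?thesis
        using wedge_eq_zero[OF xsT, of i j] f L0 by simp
    next
      case True
      \<comment> \<open>Extended by the identity, since a permutation of \<open>{..<n}\<close> is a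
        function on all naturals.\<close>
      define p where "p i = (if i < n then f i else i)" for i
      have inj: "inj_on p {..<n}"
        using True by (auto simp: inj_on_def p_def)
      moreover have "p ` {..<n} = {..<n}"
        by (rule endo_inj_surj[OF _ _ inj]) (auto simp: p_def f)
      ultimately have "p permutes {..<n}"
        by (intro bij_imp_permutes) (auto simp: bij_betw_def p_def)
      moreover have "xs = map (\<lambda>i. bs ! p i) [0..<n]"
        using 0 f by (intro nth_equalityI) (auto simp: p_def)
      ultimately have "wedge R n M xs \<in> {wedge R n M bs, \<ominus>\<^bsub>W\<^esub> wedge R n M bs}"
        using wedge_permuted by simp
      moreover have "\<ominus>\<^bsub>W\<^esub> wedge R n M bs \<in> ?L"
        using wedge_closed[OF bs] Os(3,5) W.smult_l_minus[of \<one> "wedge R n M bs"]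
        by (auto intro!: exI[of _ "\<ominus> \<one>"])
      ultimately show ?thesis
        using L1 by blast
    qed
  next
    case (Suc m)
    have m: "m < n" using Suc.prems by simp
    have "set xs \<subseteq> carrier M"
    proof
      fix x assume "x \<in> set xs"
      then obtain i where "i < n" "x = xs ! i"
        using Suc.prems(2) by (auto simp: in_set_conv_nth)
      then show "x \<in> carrier M"
        using Suc.prems(3,4)[of i] S bs by (cases "i < Suc m") (auto simp: tuples_def)
    qed
    then have xsT: "xs \<in> T"
      using Suc.prems(2) by (simp add: tuples_def)
    \<comment> \<open>The admissible values of entry \<open>m\<close> form a submodule over
      \<open>O'\<close>. It contains \<open>set bs\<close> by the induction hypothesis, hence the
      whole span.\<close>
    let ?N = "{x \<in> carrier M. wedge R n M (xs[m := x]) \<in> ?L}"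
    have N0: "wedge R n M (xs[m := \<zero>\<^bsub>M\<^esub>]) \<in> ?L"
      using wedge_smult[OF xsT m R.zero_closed M.zero_closed] L0
        wedge_closed[OF tuples_update[OF xsT M.zero_closed]] by simp
    have "submodule ?N (R\<lparr>carrier := O'\<rparr>) M"
    proof (rule submodule_subringI[OF O])
      show "x \<oplus>\<^bsub>M\<^esub> y \<in> ?N" if "x \<in> ?N" "y \<in> ?N" for x y
        using that wedge_add[OF xsT m, of x y] Ladd by simp
      show "a \<odot>\<^bsub>M\<^esub> x \<in> ?N" if "a \<in> O'" "x \<in> ?N" for a x
      proof -
        have "a \<in> carrier R" "x \<in> carrier M"
          using that Os(1) by auto
        then show ?thesis
          using wedge_smult[OF xsT m, of a x] Lsmult[OF that(1), of "wedge R n M (xs[m := x])"] that(2)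
          by simp
      qed
    qed (use N0 in auto)
    moreover have "set bs \<subseteq> ?N"
    proof
      fix b assume b: "b \<in> set bs"
      have "wedge R n M (xs[m := b]) \<in> ?L"
        by (rule Suc.IH) (use Suc.prems b in \<open>auto simp: nth_list_update\<close>)
      then show "b \<in> ?N"
        using b bs by (auto simp: tuples_def)
    qed
    ultimately have "?S \<subseteq> ?N"
      by (rule module_span_least)
    then have "wedge R n M (xs[m := xs ! m]) \<in> ?L"
      using Suc.prems(3)[of m] by blast
    then show ?case by simp
  qed
  from this[of n xs] have "wedge R n M xs \<in> ?L"
    using xs tuples_nth[OF xs] by (simp add: tuples_def)
  then show ?thesis by blast
qed

end

end

end

section \<open>The function field of a variety\<close>

context domain
begin

abbreviation (input) "Q \<equiv> fraction_field R"

text \<open>Transitivity of cross multiplication, obtained by cancelling \<open>b\<close>, puts each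
  of the two classes inside the other.\<close>

lemma frac_eq_iff:
  assumes "a \<in> carrier R" "b \<in> carrier R - {\<zero>}" "c \<in> carrier R" "d \<in> carrier R - {\<zero>}"
  shows "frac R a b = frac R c d \<longleftrightarrow> a \<otimes> d = c \<otimes> b"
proof
  assume "frac R a b = frac R c d"
  moreover have "(c, d) \<in> frac R c d"
    using assms by (auto simp: frac_def)
  ultimately show "a \<otimes> d = c \<otimes> b"
    by (auto simp: frac_def)
next
  have le: "frac R a b \<subseteq> frac R c d"
    if c: "a \<in> carrier R" "b \<in> carrier R - {\<zero>}" "c \<in> carrier R" "d \<in> carrier R - {\<zero>}"
      and eq: "a \<otimes> d = c \<otimes> b" for a b c d
  proof safe
    fix x y assume "(x, y) \<in> frac R a b"
    then have xy: "x \<in> carrier R" "y \<in> carrier R" "y \<noteq> \<zero>" "a \<otimes> y = x \<otimes> b"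
      by (auto simp: frac_def)
    have "b \<otimes> (c \<otimes> y) = (c \<otimes> b) \<otimes> y"
      using c xy by (simp add: m_ac)
    also have "\<dots> = (a \<otimes> y) \<otimes> d"
      unfolding eq[symmetric] using c xy(1-3) by (simp add: m_ac)
    also have "\<dots> = b \<otimes> (x \<otimes> d)"
      unfolding xy(4) using c xy(1-3) by (simp add: m_ac)
    finally have "c \<otimes> y = x \<otimes> d"
      using c xy m_lcancel[of b "c \<otimes> y" "x \<otimes> d"] by simp
    then show "(x, y) \<in> frac R c d"
      using xy by (simp add: frac_def)
  qed
  assume "a \<otimes> d = c \<otimes> b"
  then show "frac R a b = frac R c d"
    using le[of a b c d] le[of c d a b] assms by auto
qed

lemma frac_self_mem: "a \<in> carrier R \<Longrightarrow> b \<in> carrier R - {\<zero>} \<Longrightarrow> (a, b) \<in> frac R a b"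
  by (auto simp: frac_def)

lemma frac_memD:
  assumes "(c, d) \<in> frac R a b"
  shows "c \<in> carrier R" "d \<in> carrier R - {\<zero>}" "a \<otimes> d = c \<otimes> b"
  using assms by (auto simp: frac_def)

context
  fixes a b c d
  assumes carr: "a \<in> carrier R" "b \<in> carrier R - {\<zero>}" "c \<in> carrier R" "d \<in> carrier R - {\<zero>}"
begin

text \<open>The operation is a union over representatives; cross multiplication shows that all
  classes in this union are equal. Sums are treated in the same way below.\<close>

lemma frac_mult: "frac R a b \<otimes>\<^bsub>Q\<^esub> frac R c d = frac R (a \<otimes> c) (b \<otimes> d)"
proof -
  have "frac R (a' \<otimes> c') (b' \<otimes> d') = frac R (a \<otimes> c) (b \<otimes> d)"
    if m: "(a', b') \<in> frac R a b" "(c', d') \<in> frac R c d" for a' b' c' d'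
  proof -
    note ab = frac_memD[OF m(1)] and cd = frac_memD[OF m(2)]
    have "(a' \<otimes> c') \<otimes> (b \<otimes> d) = (a' \<otimes> b) \<otimes> (c' \<otimes> d)"
      using ab(1,2) cd(1,2) carr by (simp add: m_ac)
    also have "\<dots> = (a \<otimes> b') \<otimes> (c \<otimes> d')"
      using ab(3) cd(3) by simp
    also have "\<dots> = (a \<otimes> c) \<otimes> (b' \<otimes> d')"
      using ab(1,2) cd(1,2) carr by (simp add: m_ac)
    finally show ?thesis
      using ab(1,2) cd(1,2) carr by (subst frac_eq_iff) (auto simp: integral_iff)
  qed
  then have *: "\<And>p q. p \<in> frac R a b \<Longrightarrow> q \<in> frac R c d \<Longrightarrow>
    frac R (fst p \<otimes> fst q) (snd p \<otimes> snd q) = frac R (a \<otimes> c) (b \<otimes> d)"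
    by (metis prod.collapse)
  show ?thesis
    using frac_self_mem[OF carr(1,2)] frac_self_mem[OF carr(3,4)] *
    by (simp add: fraction_field_def case_prod_unfold) blast
qed

lemma frac_add: "frac R a b \<oplus>\<^bsub>Q\<^esub> frac R c d = frac R (a \<otimes> d \<oplus> c \<otimes> b) (b \<otimes> d)"
proof -
  have "frac R (a' \<otimes> d' \<oplus> c' \<otimes> b') (b' \<otimes> d') = frac R (a \<otimes> d \<oplus> c \<otimes> b) (b \<otimes> d)"
    if m: "(a', b') \<in> frac R a b" "(c', d') \<in> frac R c d" for a' b' c' d'
  proof -
    note ab = frac_memD[OF m(1)] and cd = frac_memD[OF m(2)]
    have "(a' \<otimes> d' \<oplus> c' \<otimes> b') \<otimes> (b \<otimes> d) = (a' \<otimes> b) \<otimes> (d' \<otimes> d) \<oplus> (c' \<otimes> d) \<otimes> (b' \<otimes> b)"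
      using ab(1,2) cd(1,2) carr by (simp add: m_ac l_distr r_distr)
    also have "\<dots> = (a \<otimes> b') \<otimes> (d' \<otimes> d) \<oplus> (c \<otimes> d') \<otimes> (b' \<otimes> b)"
      using ab(3) cd(3) by simp
    also have "\<dots> = (a \<otimes> d \<oplus> c \<otimes> b) \<otimes> (b' \<otimes> d')"
      using ab(1,2) cd(1,2) carr by (simp add: m_ac l_distr r_distr)
    finally show ?thesis
      using ab(1,2) cd(1,2) carr by (subst frac_eq_iff) (auto simp: integral_iff)
  qed
  then have *: "\<And>p q. p \<in> frac R a b \<Longrightarrow> q \<in> frac R c d \<Longrightarrow>
    frac R (fst p \<otimes> snd q \<oplus> fst q \<otimes> snd p) (snd p \<otimes> snd q) = frac R (a \<otimes> d \<oplus> c \<otimes> b) (b \<otimes> d)"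
    by (metis prod.collapse)
  show ?thesis
    using frac_self_mem[OF carr(1,2)] frac_self_mem[OF carr(3,4)] *
    by (simp add: fraction_field_def case_prod_unfold) blast
qed

end

lemma fraction_field_carrierI:
  "a \<in> carrier R \<Longrightarrow> b \<in> carrier R - {\<zero>} \<Longrightarrow> frac R a b \<in> carrier Q"
  by (auto simp: fraction_field_def)

lemma fraction_field_carrierE:
  assumes "x \<in> carrier Q"
  obtains a b where "a \<in> carrier R" "b \<in> carrier R - {\<zero>}" "x = frac R a b"
  using assms by (auto simp: fraction_field_def)

lemma fraction_field_one: "\<one>\<^bsub>Q\<^esub> = frac R \<one> \<one>"
  and fraction_field_zero: "\<zero>\<^bsub>Q\<^esub> = frac R \<zero> \<one>"
  by (simp_all add: fraction_field_def)

lemma frac_eq_zero_iff: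
  "a \<in> carrier R \<Longrightarrow> b \<in> carrier R - {\<zero>} \<Longrightarrow> frac R a b = \<zero>\<^bsub>Q\<^esub> \<longleftrightarrow> a = \<zero>"
  by (simp add: fraction_field_zero frac_eq_iff)

lemma field_fraction_field: "field Q"
proof (rule cring.cring_fieldI2)
  show "cring Q"
  proof (rule cringI)
    show "abelian_group Q"
    proof (rule abelian_groupI)
      fix x y z assume "x \<in> carrier Q" "y \<in> carrier Q" "z \<in> carrier Q"
      then show "x \<oplus>\<^bsub>Q\<^esub> y \<oplus>\<^bsub>Q\<^esub> z = x \<oplus>\<^bsub>Q\<^esub> (y \<oplus>\<^bsub>Q\<^esub> z)"
        by (elim fraction_field_carrierE) (simp add: frac_add integral_iff frac_eq_iff m_ac a_ac l_distr r_distr)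
    next
      fix x y assume "x \<in> carrier Q" "y \<in> carrier Q"
      then show "x \<oplus>\<^bsub>Q\<^esub> y = y \<oplus>\<^bsub>Q\<^esub> x"
        by (elim fraction_field_carrierE) (simp add: frac_add integral_iff frac_eq_iff m_ac a_ac)
    next
      fix x y assume "x \<in> carrier Q" "y \<in> carrier Q"
      then show "x \<oplus>\<^bsub>Q\<^esub> y \<in> carrier Q"
        by (elim fraction_field_carrierE) (simp add: frac_add integral_iff fraction_field_carrierI)
    next
      fix x assume "x \<in> carrier Q"
      then obtain a b where ab: "a \<in> carrier R" "b \<in> carrier R - {\<zero>}" "x = frac R a b"
        by (rule fraction_field_carrierE)
      then show "\<exists>y\<in>carrier Q. y \<oplus>\<^bsub>Q\<^esub> x = \<zero>\<^bsub>Q\<^esub>"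
        by (intro bexI[of _ "frac R (\<ominus> a) b"])
          (auto simp: frac_add frac_eq_zero_iff integral_iff l_minus l_neg fraction_field_carrierI)
    next
      fix x assume "x \<in> carrier Q"
      then show "\<zero>\<^bsub>Q\<^esub> \<oplus>\<^bsub>Q\<^esub> x = x"
        by (elim fraction_field_carrierE) (simp add: fraction_field_zero frac_add)
    qed (simp add: fraction_field_zero fraction_field_carrierI)
    show "comm_monoid Q"
    proof (rule comm_monoidI)
      fix x y z assume "x \<in> carrier Q" "y \<in> carrier Q" "z \<in> carrier Q"
      then show "x \<otimes>\<^bsub>Q\<^esub> y \<otimes>\<^bsub>Q\<^esub> z = x \<otimes>\<^bsub>Q\<^esub> (y \<otimes>\<^bsub>Q\<^esub> z)"
        by (elim fraction_field_carrierE) (simp add: frac_mult integral_iff m_ac)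
    next
      fix x y assume "x \<in> carrier Q" "y \<in> carrier Q"
      then show "x \<otimes>\<^bsub>Q\<^esub> y = y \<otimes>\<^bsub>Q\<^esub> x"
        by (elim fraction_field_carrierE) (simp add: frac_mult integral_iff m_ac)
    next
      fix x y assume "x \<in> carrier Q" "y \<in> carrier Q"
      then show "x \<otimes>\<^bsub>Q\<^esub> y \<in> carrier Q"
        by (elim fraction_field_carrierE) (simp add: frac_mult integral_iff fraction_field_carrierI)
    next
      fix x assume "x \<in> carrier Q"
      then show "\<one>\<^bsub>Q\<^esub> \<otimes>\<^bsub>Q\<^esub> x = x"
        by (elim fraction_field_carrierE) (simp add: fraction_field_one frac_mult)
    qed (simp add: fraction_field_one fraction_field_carrierI)
    fix x y z assume "x \<in> carrier Q" "y \<in> carrier Q" "z \<in> carrier Q"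
    then show "(x \<oplus>\<^bsub>Q\<^esub> y) \<otimes>\<^bsub>Q\<^esub> z = x \<otimes>\<^bsub>Q\<^esub> z \<oplus>\<^bsub>Q\<^esub> y \<otimes>\<^bsub>Q\<^esub> z"
      by (elim fraction_field_carrierE)
        (simp add: frac_add frac_mult integral_iff frac_eq_iff m_ac l_distr r_distr)
  qed
  have "\<one>\<^bsub>Q\<^esub> \<noteq> \<zero>\<^bsub>Q\<^esub>"
    by (simp add: fraction_field_one frac_eq_zero_iff)
  then show "\<zero>\<^bsub>Q\<^esub> \<noteq> \<one>\<^bsub>Q\<^esub>" ..
  show "\<exists>y\<in>carrier Q. x \<otimes>\<^bsub>Q\<^esub> y = \<one>\<^bsub>Q\<^esub>" if x: "x \<in> carrier Q" "x \<noteq> \<zero>\<^bsub>Q\<^esub>" for x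
  proof -
    from that obtain a b where ab: "a \<in> carrier R" "b \<in> carrier R - {\<zero>}" "x = frac R a b"
      using fraction_field_carrierE by blast
    moreover have "a \<noteq> \<zero>"
      using x(2) ab frac_eq_zero_iff by auto
    ultimately show ?thesis
      by (intro bexI[of _ "frac R b a"])
        (auto simp: fraction_field_one frac_mult frac_eq_iff integral_iff m_comm fraction_field_carrierI)
  qed
qed

end

section \<open>Polynomial functions and irreducible sets\<close>

lemma poly_functions_uminus: "f \<in> poly_functions X \<Longrightarrow> (\<lambda>p. - f p) \<in> poly_functions X"
  using poly_functions.mult[OF poly_functions.const[of "-1"], of f X] by simp

lemma poly_functions_diff:
  "f \<in> poly_functions X \<Longrightarrow> g \<in> poly_functions X \<Longrightarrow> (\<lambda>p. f p - g p) \<in> poly_functions X"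
  using poly_functions.add[OF _ poly_functions_uminus, of f X g] by simp

lemma poly_functions_sum:
  "(\<And>i. i \<in> A \<Longrightarrow> f i \<in> poly_functions X) \<Longrightarrow> (\<lambda>p. \<Sum>i\<in>A. f i p) \<in> poly_functions X"
  by (induction A rule: infinite_finite_induct) (auto intro: poly_functions.intros)

lemma poly_functions_prod:
  "(\<And>i. i \<in> A \<Longrightarrow> f i \<in> poly_functions X) \<Longrightarrow> (\<lambda>p. \<Prod>i\<in>A. f i p) \<in> poly_functions X"
  by (induction A rule: infinite_finite_induct) (auto intro: poly_functions.intros)

lemma poly_functions_trans:
  "f \<in> poly_functions Y \<Longrightarrow> Y \<subseteq> poly_functions X \<Longrightarrow> f \<in> poly_functions X"
  by (induction rule: poly_functions.induct) (auto intro: poly_functions.intros)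

text \<open>Not identically zero, as opposed to nowhere zero: a polynomial function \<open>f\<close>
  with this property lies outside the ideal of \<open>D\<close>.\<close>

definition nonvanishing :: "'p set \<Rightarrow> ('p \<Rightarrow> complex) \<Rightarrow> bool" where
  "nonvanishing D f \<longleftrightarrow> (\<exists>p\<in>D. f p \<noteq> 0)"

text \<open>On a Zariski closed set this is irreducibility.\<close>

definition integral_set :: "('p \<Rightarrow> complex) set \<Rightarrow> 'p set \<Rightarrow> bool" where
  "integral_set X D \<longleftrightarrow> D \<noteq> {} \<and> (\<forall>f\<in>poly_functions X. \<forall>g\<in>poly_functions X.
     nonvanishing D f \<longrightarrow> nonvanishing D g \<longrightarrow> nonvanishing D (\<lambda>p. f p * g p))"

lemma nonvanishing_mult:
  "integral_set X D \<Longrightarrow> f \<in> poly_functions X \<Longrightarrow> g \<in> poly_functions X \<Longrightarrow>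
   nonvanishing D (\<lambda>p. f p * g p) \<longleftrightarrow> nonvanishing D f \<and> nonvanishing D g"
  by (auto simp: integral_set_def nonvanishing_def)

lemma nonvanishing_mono: "nonvanishing D f \<Longrightarrow> D \<subseteq> E \<Longrightarrow> nonvanishing E f"
  by (auto simp: nonvanishing_def)

lemma zariski_closed_Int_zeros:
  assumes "zariski_closed V X Z" "f \<in> poly_functions X"
  shows "zariski_closed V X {p \<in> Z. f p = 0}"
proof -
  from assms(1) obtain S where "S \<subseteq> poly_functions X" "Z = {p \<in> V. \<forall>f\<in>S. f p = 0}"
    by (auto simp: zariski_closed_def)
  then show ?thesis
    unfolding zariski_closed_def using assms(2) by (intro exI[of _ "insert f S"]) auto
qed

lemma irreducible_closed_subset: "irreducible_closed V X D \<Longrightarrow> D \<subseteq> V"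
  by (auto simp: irreducible_closed_def zariski_closed_def)

text \<open>If the product vanished on \<open>D\<close>, the zeros of \<open>f\<close> and those of
  \<open>g\<close> would be two closed sets covering \<open>D\<close>.\<close>

lemma irreducible_closed_integral_set:
  assumes D: "irreducible_closed V X D"
  shows "integral_set X D"
  unfolding integral_set_def
proof (intro conjI ballI impI)
  show "D \<noteq> {}" using D by (simp add: irreducible_closed_def)
  fix f g assume fg: "f \<in> poly_functions X" "g \<in> poly_functions X" "nonvanishing D f" "nonvanishing D g"
  show "nonvanishing D (\<lambda>p. f p * g p)"
  proof (rule ccontr)
    assume "\<not> nonvanishing D (\<lambda>p. f p * g p)"
    then have "D = {p \<in> D. f p = 0} \<union> {p \<in> D. g p = 0}"
      by (auto simp: nonvanishing_def)
    moreover have "zariski_closed V X D"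
      using D by (simp add: irreducible_closed_def)
    ultimately have "D = {p \<in> D. f p = 0} \<or> D = {p \<in> D. g p = 0}"
      using D fg(1,2) zariski_closed_Int_zeros unfolding irreducible_closed_def by metis
    then show False
      using fg(3,4) by (auto simp: nonvanishing_def)
  qed
qed

section \<open>Coordinate ring and function field of an irreducible variety\<close>

locale integral_variety =
  fixes V :: "'p set" and X :: "('p \<Rightarrow> complex) set"
  assumes integral: "integral_set X V"
begin

abbreviation "CR \<equiv> coordinate_ring V X"
abbreviation "K \<equiv> function_field V X"
abbreviation "PF \<equiv> poly_functions X"

lemma carrier_CR: "carrier CR = (\<lambda>f. restrict f V) ` PF"
  by (simp add: coordinate_ring_def)

lemma CR_ops:
  "restrict f V \<otimes>\<^bsub>CR\<^esub> restrict g V = restrict (\<lambda>p. f p * g p) V"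
  "restrict f V \<oplus>\<^bsub>CR\<^esub> restrict g V = restrict (\<lambda>p. f p + g p) V"
  "\<zero>\<^bsub>CR\<^esub> = restrict (\<lambda>_. 0) V" "\<one>\<^bsub>CR\<^esub> = restrict (\<lambda>_. 1) V"
  by (auto simp: coordinate_ring_def)

lemma restrict_closed: "f \<in> PF \<Longrightarrow> restrict f V \<in> carrier CR"
  by (simp add: carrier_CR)

lemma restrict_eq_iff: "restrict f V = restrict g V \<longleftrightarrow> (\<forall>p\<in>V. f p = g p)"
  by (metis restrict_apply' restrict_ext)

lemma restrict_eq_zero_iff: "restrict f V = \<zero>\<^bsub>CR\<^esub> \<longleftrightarrow> \<not> nonvanishing V f"
  by (auto simp: CR_ops restrict_eq_iff nonvanishing_def)

lemma domain_CR: "domain CR"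
proof (rule domainI)
  show "cring CR"
  proof (rule cringI)
    show "abelian_group CR"
    proof (rule abelian_groupI)
      fix x assume "x \<in> carrier CR"
      then obtain f where f: "f \<in> PF" "x = restrict f V" by (auto simp: carrier_CR)
      then show "\<exists>y\<in>carrier CR. y \<oplus>\<^bsub>CR\<^esub> x = \<zero>\<^bsub>CR\<^esub>"
        by (intro bexI[of _ "restrict (\<lambda>p. - f p) V"])
          (auto simp: CR_ops intro: restrict_closed poly_functions_uminus)
    qed (auto simp: carrier_CR CR_ops add.assoc add.commute intro!: poly_functions.const poly_functions.add imageI)
    show "comm_monoid CR"
      by (rule comm_monoidI)
        (auto simp: carrier_CR CR_ops mult.assoc mult.commute intro!: poly_functions.const poly_functions.mult imageI)
  qed (auto simp: carrier_CR CR_ops distrib_right)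
  show "\<one>\<^bsub>CR\<^esub> \<noteq> \<zero>\<^bsub>CR\<^esub>"
    using integral by (auto simp: CR_ops restrict_eq_iff integral_set_def)
  fix a b assume "a \<otimes>\<^bsub>CR\<^esub> b = \<zero>\<^bsub>CR\<^esub>" "a \<in> carrier CR" "b \<in> carrier CR"
  then show "a = \<zero>\<^bsub>CR\<^esub> \<or> b = \<zero>\<^bsub>CR\<^esub>"
    using nonvanishing_mult[OF integral]
    by (auto simp: carrier_CR CR_ops(1) restrict_eq_zero_iff)
qed

sublocale CR: domain CR by (rule domain_CR)
sublocale K: field K unfolding function_field_def by (rule CR.field_fraction_field)

text \<open>Fractions are written with functions on the ambient space, which are restricted to
  \<open>V\<close> only here, so that later arguments stay within \<open>PF\<close>.\<close>

definition rat :: "('p \<Rightarrow> complex) \<Rightarrow> ('p \<Rightarrow> complex) \<Rightarrow> (('p \<Rightarrow> complex) \<times> ('p \<Rightarrow> complex)) set" where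
  "rat f g = frac CR (restrict f V) (restrict g V)"

lemma denominator: "g \<in> PF \<Longrightarrow> nonvanishing V g \<Longrightarrow> restrict g V \<in> carrier CR - {\<zero>\<^bsub>CR\<^esub>}"
  by (simp add: restrict_closed restrict_eq_zero_iff)

lemma rat_closed: "f \<in> PF \<Longrightarrow> g \<in> PF \<Longrightarrow> nonvanishing V g \<Longrightarrow> rat f g \<in> carrier K"
  unfolding rat_def function_field_def
  by (intro CR.fraction_field_carrierI restrict_closed denominator)

lemma rat_eq_iff:
  assumes "f \<in> PF" "g \<in> PF" "nonvanishing V g" "f' \<in> PF" "g' \<in> PF" "nonvanishing V g'"
  shows "rat f g = rat f' g' \<longleftrightarrow> (\<forall>p\<in>V. f p * g' p = f' p * g p)"
  unfolding rat_def using assms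
  by (subst CR.frac_eq_iff) (auto simp: restrict_closed denominator[simplified] CR_ops(1) restrict_eq_iff)

context
  fixes f g f' g'
  assumes fg: "f \<in> PF" "g \<in> PF" "nonvanishing V g" "f' \<in> PF" "g' \<in> PF" "nonvanishing V g'"
begin

lemma rat_mult: "rat f g \<otimes>\<^bsub>K\<^esub> rat f' g' = rat (\<lambda>p. f p * f' p) (\<lambda>p. g p * g' p)"
  using CR.frac_mult[of "restrict f V" "restrict g V" "restrict f' V" "restrict g' V"] fg
  by (simp add: rat_def function_field_def restrict_closed denominator[simplified] CR_ops(1))

lemma rat_add: "rat f g \<oplus>\<^bsub>K\<^esub> rat f' g' = rat (\<lambda>p. f p * g' p + f' p * g p) (\<lambda>p. g p * g' p)"
  using CR.frac_add[of "restrict f V" "restrict g V" "restrict f' V" "restrict g' V"] fg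
  by (simp add: rat_def function_field_def restrict_closed denominator[simplified] CR_ops(1,2))

end

lemma nonvanishing_one: "integral_set X D \<Longrightarrow> nonvanishing D (\<lambda>_. 1)"
  by (auto simp: nonvanishing_def integral_set_def)

lemmas V1 = nonvanishing_one[OF integral]

lemma rat_zero: "\<zero>\<^bsub>K\<^esub> = rat (\<lambda>_. 0) (\<lambda>_. 1)"
  and rat_one: "\<one>\<^bsub>K\<^esub> = rat (\<lambda>_. 1) (\<lambda>_. 1)"
  by (simp_all add: function_field_def rat_def CR.fraction_field_zero CR.fraction_field_one CR_ops)

lemma rat_eq_zero_iff:
  "f \<in> PF \<Longrightarrow> g \<in> PF \<Longrightarrow> nonvanishing V g \<Longrightarrow> rat f g = \<zero>\<^bsub>K\<^esub> \<longleftrightarrow> \<not> nonvanishing V f"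
  unfolding rat_zero by (subst rat_eq_iff) (auto simp: V1 nonvanishing_def intro: poly_functions.const)

lemma rat_uminus:
  assumes "f \<in> PF" "g \<in> PF" "nonvanishing V g"
  shows "\<ominus>\<^bsub>K\<^esub> rat f g = rat (\<lambda>p. - f p) g"
proof (rule K.minus_equality)
  show "rat (\<lambda>p. - f p) g \<oplus>\<^bsub>K\<^esub> rat f g = \<zero>\<^bsub>K\<^esub>"
    using assms by (simp add: rat_add poly_functions_uminus)
      (subst rat_eq_zero_iff, auto simp: nonvanishing_mult[OF integral] nonvanishing_def intro: poly_functions.intros)
qed (use assms in \<open>auto intro!: rat_closed poly_functions_uminus\<close>)

lemma constants_eq: "constants V X = {rat (\<lambda>_. c) (\<lambda>_. 1) | c. True}"
  by (simp add: constants_def rat_def)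

lemma constants_subset: "constants V X \<subseteq> carrier K"
  by (auto simp: constants_eq intro!: rat_closed poly_functions.const V1)

text \<open>Turns quantification over restricted functions into one over polynomial functions; it
  serves the local ring, its maximal ideal and the function field alike.\<close>

lemma image_comprehension:
  "{F f g | f g. f \<in> r ` A \<and> g \<in> r ` A \<and> P f g} =
   {F (r f) (r g) | f g. f \<in> A \<and> g \<in> A \<and> P (r f) (r g)}"
  by blast

lemma local_ring_eq:
  assumes "D \<subseteq> V"
  shows "local_ring_at V X D = {rat f g | f g. f \<in> PF \<and> g \<in> PF \<and> nonvanishing D g}"
proof -
  have *: "(\<exists>p\<in>D. restrict g V p \<noteq> 0) \<longleftrightarrow> nonvanishing D g" for g
    using assms by (auto simp: nonvanishing_def subset_iff)
  show ?thesis
    unfolding local_ring_at_def carrier_CR rat_def image_comprehension * ..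
qed

lemma maximal_ideal_eq:
  assumes "D \<subseteq> V"
  shows "maximal_ideal_at V X D =
    {rat f g | f g. f \<in> PF \<and> g \<in> PF \<and> \<not> nonvanishing D f \<and> nonvanishing D g}"
proof -
  have *: "(\<exists>p\<in>D. restrict g V p \<noteq> 0) \<longleftrightarrow> nonvanishing D g"
    "(\<forall>p\<in>D. restrict g V p = 0) \<longleftrightarrow> \<not> nonvanishing D g" for g
    using assms by (auto simp: nonvanishing_def subset_iff)
  show ?thesis
    unfolding maximal_ideal_at_def carrier_CR rat_def image_comprehension * ..
qed

lemma local_ring_V: "local_ring_at V X V = carrier K"
proof -
  have "carrier K = {frac CR a b | a b. a \<in> carrier CR \<and> b \<in> carrier CR \<and> b \<noteq> \<zero>\<^bsub>CR\<^esub>}"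
    by (simp add: function_field_def fraction_field_def)
  also have "\<dots> = {rat f g | f g. f \<in> PF \<and> g \<in> PF \<and> nonvanishing V g}"
    unfolding carrier_CR image_comprehension restrict_eq_zero_iff rat_def by simp
  finally show ?thesis
    by (simp add: local_ring_eq)
qed

lemma carrier_K_E:
  assumes "a \<in> carrier K"
  obtains f g where "f \<in> PF" "g \<in> PF" "nonvanishing V g" "a = rat f g"
  using assms unfolding local_ring_V[symmetric] by (auto simp: local_ring_eq)

end

section \<open>Orders along prime divisors\<close>

context integral_variety
begin

abbreviation "\<O> \<equiv> local_ring_at V X"
abbreviation "\<mm> \<equiv> maximal_ideal_at V X"

section \<open>Local rings along irreducible subsets\<close>

context
  fixes D
  assumes D: "integral_set X D" and DV: "D \<subseteq> V"
begin

lemma nonvanishing_V: "nonvanishing D g \<Longrightarrow> nonvanishing V g"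
  by (rule nonvanishing_mono[OF _ DV])

lemma local_ring_subset: "\<O> D \<subseteq> carrier K"
  by (auto simp: local_ring_eq[OF DV] intro: rat_closed nonvanishing_V)

lemma local_ringI: "f \<in> PF \<Longrightarrow> g \<in> PF \<Longrightarrow> nonvanishing D g \<Longrightarrow> rat f g \<in> \<O> D"
  by (auto simp: local_ring_eq[OF DV])

lemma local_ringE:
  assumes "a \<in> \<O> D"
  obtains f g where "f \<in> PF" "g \<in> PF" "nonvanishing D g" "nonvanishing V g" "a = rat f g"
  using assms nonvanishing_V by (auto simp: local_ring_eq[OF DV])

lemma subring_local_ring: "subring (\<O> D) K"
proof (rule K.subringI)
  show "\<O> D \<subseteq> carrier K" by (rule local_ring_subset)
  show "\<one>\<^bsub>K\<^esub> \<in> \<O> D"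
    unfolding rat_one by (intro local_ringI poly_functions.const nonvanishing_one[OF D])
  fix a b assume a: "a \<in> \<O> D" and b: "b \<in> \<O> D"
  obtain f g where fg: "f \<in> PF" "g \<in> PF" "nonvanishing D g" "nonvanishing V g" "a = rat f g"
    using a by (rule local_ringE)
  obtain f' g' where fg': "f' \<in> PF" "g' \<in> PF" "nonvanishing D g'" "nonvanishing V g'" "b = rat f' g'"
    using b by (rule local_ringE)
  show "a \<otimes>\<^bsub>K\<^esub> b \<in> \<O> D" "a \<oplus>\<^bsub>K\<^esub> b \<in> \<O> D"
    using fg fg'
    by (auto simp: rat_mult rat_add nonvanishing_mult[OF D]
      intro!: local_ringI poly_functions.add poly_functions.mult)
next
  fix a assume "a \<in> \<O> D"
  then show "\<ominus>\<^bsub>K\<^esub> a \<in> \<O> D"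
    by (elim local_ringE) (auto simp: rat_uminus intro!: local_ringI poly_functions_uminus)
qed

text \<open>Membership is defined through some representation as a fraction; irreducibility of
  \<open>D\<close> shows that every representation decides it.\<close>

lemma maximal_ideal_iff:
  assumes "f \<in> PF" "g \<in> PF" "nonvanishing D g"
  shows "rat f g \<in> \<mm> D \<longleftrightarrow> \<not> nonvanishing D f"
proof
  assume "rat f g \<in> \<mm> D"
  then obtain f' g' where *: "rat f g = rat f' g'" "f' \<in> PF" "g' \<in> PF" "\<not> nonvanishing D f'"
    "nonvanishing D g'"
    by (auto simp: maximal_ideal_eq[OF DV])
  then have "\<forall>p\<in>V. f p * g' p = f' p * g p"
    using assms nonvanishing_V by (simp add: rat_eq_iff)
  then have "\<not> nonvanishing D (\<lambda>p. f p * g' p)"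
    using *(4) DV by (auto simp: nonvanishing_def subset_iff)
  then show "\<not> nonvanishing D f"
    using * assms by (simp add: nonvanishing_mult[OF D])
qed (use assms in \<open>auto simp: maximal_ideal_eq[OF DV]\<close>)

lemma local_unitE:
  assumes "u \<in> \<O> D - \<mm> D"
  obtains f g where "f \<in> PF" "g \<in> PF" "nonvanishing D f" "nonvanishing D g" "u = rat f g"
  using assms maximal_ideal_iff by (auto simp: local_ring_eq[OF DV])

lemma local_unit_mult:
  assumes "u \<in> \<O> D - \<mm> D" "v \<in> \<O> D - \<mm> D"
  shows "u \<otimes>\<^bsub>K\<^esub> v \<in> \<O> D - \<mm> D"
proof -
  obtain f g where fg: "f \<in> PF" "g \<in> PF" "nonvanishing D f" "nonvanishing D g" "u = rat f g"
    using assms(1) by (rule local_unitE)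
  obtain f' g' where fg': "f' \<in> PF" "g' \<in> PF" "nonvanishing D f'" "nonvanishing D g'" "v = rat f' g'"
    using assms(2) by (rule local_unitE)
  have "u \<otimes>\<^bsub>K\<^esub> v = rat (\<lambda>p. f p * f' p) (\<lambda>p. g p * g' p)"
    using fg fg' nonvanishing_V by (simp add: rat_mult)
  then show ?thesis
    using fg fg' by (auto simp: maximal_ideal_iff nonvanishing_mult[OF D] poly_functions.mult
        intro!: local_ringI)
qed

text \<open>A fraction whose numerator is off the ideal of \<open>D\<close> may be turned upside
  down; conversely a product equal to one forces the numerators off that ideal.\<close>

lemma local_unit_iff:
  assumes "u \<in> \<O> D"
  shows "u \<notin> \<mm> D \<longleftrightarrow> (\<exists>v\<in>\<O> D. u \<otimes>\<^bsub>K\<^esub> v = \<one>\<^bsub>K\<^esub>)"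
proof -
  obtain f g where fg: "f \<in> PF" "g \<in> PF" "nonvanishing D g" "nonvanishing V g" "u = rat f g"
    using assms by (rule local_ringE)
  show ?thesis
  proof
    assume "u \<notin> \<mm> D"
    then have f: "nonvanishing D f"
      using fg maximal_ideal_iff by simp
    then have "u \<otimes>\<^bsub>K\<^esub> rat g f = \<one>\<^bsub>K\<^esub>"
      using fg nonvanishing_V
      by (auto simp: rat_mult rat_one rat_eq_iff nonvanishing_mult[OF integral] V1
          poly_functions.mult poly_functions.const)
    then show "\<exists>v\<in>\<O> D. u \<otimes>\<^bsub>K\<^esub> v = \<one>\<^bsub>K\<^esub>"
      using f fg local_ringI by blast
  next
    assume "\<exists>v\<in>\<O> D. u \<otimes>\<^bsub>K\<^esub> v = \<one>\<^bsub>K\<^esub>"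
    then obtain v where v: "v \<in> \<O> D" "u \<otimes>\<^bsub>K\<^esub> v = \<one>\<^bsub>K\<^esub>" by blast
    obtain f' g' where fg': "f' \<in> PF" "g' \<in> PF" "nonvanishing D g'" "nonvanishing V g'" "v = rat f' g'"
      using v(1) by (rule local_ringE)
    have "rat (\<lambda>p. f p * f' p) (\<lambda>p. g p * g' p) = rat (\<lambda>_. 1) (\<lambda>_. 1)"
      using v(2) fg fg' by (simp add: rat_mult rat_one)
    then have "\<forall>p\<in>V. f p * f' p = g p * g' p"
      using fg fg'
      by (subst (asm) rat_eq_iff)
        (auto simp: nonvanishing_mult[OF integral] V1 poly_functions.mult poly_functions.const)
    moreover have "nonvanishing D (\<lambda>p. g p * g' p)"
      using fg fg' by (simp add: nonvanishing_mult[OF D])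
    ultimately have "nonvanishing D (\<lambda>p. f p * f' p)"
      using DV by (auto simp: nonvanishing_def subset_iff)
    then have "nonvanishing D f"
      using fg fg' by (simp add: nonvanishing_mult[OF D])
    then show "u \<notin> \<mm> D"
      using fg maximal_ideal_iff by simp
  qed
qed

end

section \<open>Prime divisors and orders\<close>

context
  fixes D
  assumes D: "prime_divisor V X D"
begin

lemma prime_divisor_integral: "integral_set X D" and prime_divisor_subset: "D \<subseteq> V"
  using D irreducible_closed_integral_set[of V X D] irreducible_closed_subset[of V X D]
  by (simp_all add: prime_divisor_def)

lemmas DD = prime_divisor_integral prime_divisor_subset

text \<open>\<open>D\<close> is a proper closed subset, so some polynomial function vanishes on
  \<open>D\<close> but not on \<open>V\<close>. The maximal ideal is therefore not zero and cannot
  be generated by zero.\<close>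

lemma uniformizer_nonzero:
  assumes t: "uniformizer V X D t" shows "t \<noteq> \<zero>\<^bsub>K\<^esub>"
proof
  assume "t = \<zero>\<^bsub>K\<^esub>"
  then have m: "\<mm> D \<subseteq> {\<zero>\<^bsub>K\<^esub>}"
    using t local_ring_subset[OF DD] by (auto simp: uniformizer_def)
  have "zariski_closed V X D" "D \<noteq> V"
    using D by (auto simp: prime_divisor_def irreducible_closed_def)
  then obtain S where S: "S \<subseteq> PF" "D = {p \<in> V. \<forall>f\<in>S. f p = 0}" "\<exists>p\<in>V. p \<notin> D"
    by (auto simp: zariski_closed_def)
  then obtain p f where pf: "p \<in> V" "f \<in> S" "f p \<noteq> 0"
    by auto
  then have f: "f \<in> PF" "\<not> nonvanishing D f" "nonvanishing V f"
    using S(1,2) by (auto simp: nonvanishing_def)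
  have "rat f (\<lambda>_. 1) \<in> \<mm> D"
    using f by (simp add: maximal_ideal_iff[OF DD] poly_functions.const nonvanishing_one[OF DD(1)])
  then have "rat f (\<lambda>_. 1) = \<zero>\<^bsub>K\<^esub>"
    using m by blast
  then show False
    using f by (simp add: rat_eq_zero_iff poly_functions.const V1)
qed

text \<open>The exponent may be negative, so \<open>t\<close> has to be a unit of the function
  field.\<close>

lemma uniformizer_power_closed:
  fixes k :: int
  assumes t: "uniformizer V X D t" shows "t [^]\<^bsub>K\<^esub> k \<in> carrier K"
proof -
  have "t \<in> Units K"
    using t uniformizer_nonzero[OF t] local_ring_subset[OF DD] K.field_Units
    by (auto simp: uniformizer_def)
  then have "t [^]\<^bsub>K\<^esub> (n::nat) \<in> Units K" for n
    by (rule K.Units_pow_closed)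
  then have "t [^]\<^bsub>K\<^esub> (n::nat) \<in> carrier K" "inv\<^bsub>K\<^esub> (t [^]\<^bsub>K\<^esub> n) \<in> carrier K" for n
    by (blast intro: K.Units_closed K.Units_inv_closed)+
  then show ?thesis
    unfolding int_pow_def2 by presburger
qed

text \<open>Multiplying by \<open>v\<close> keeps \<open>t\<close> and \<open>k\<close> and replaces
  the unit \<open>u\<close> by its product with \<open>v\<close>. The two definite descriptions thus
  have the same predicate, and agree even if it fails to determine a number.\<close>

lemma order_along_unit_mult:
  assumes v: "v \<in> \<O> D - \<mm> D" and h: "h \<in> carrier K"
  shows "order_along V X D (v \<otimes>\<^bsub>K\<^esub> h) = order_along V X D h"
proof -
  let ?U = "\<O> D - \<mm> D"
  let ?P = "\<lambda>h k. \<exists>t u. uniformizer V X D t \<and> u \<in> ?U \<and> h = u \<otimes>\<^bsub>K\<^esub> (t [^]\<^bsub>K\<^esub> (k::int))"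
  have imp: "?P (v \<otimes>\<^bsub>K\<^esub> h) k" if "?P h k" "v \<in> ?U" for v h k
  proof -
    from that(1) obtain t u where tu: "uniformizer V X D t" "u \<in> ?U" "h = u \<otimes>\<^bsub>K\<^esub> (t [^]\<^bsub>K\<^esub> k)"
      by blast
    have "v \<in> carrier K" "u \<in> carrier K"
      using tu(2) that(2) local_ring_subset[OF DD] by auto
    then have "v \<otimes>\<^bsub>K\<^esub> h = (v \<otimes>\<^bsub>K\<^esub> u) \<otimes>\<^bsub>K\<^esub> (t [^]\<^bsub>K\<^esub> k)"
      using tu(3) uniformizer_power_closed[OF tu(1)] K.m_assoc by simp
    then show ?thesis
      using tu(1) local_unit_mult[OF DD that(2) tu(2)] by blast
  qed
  \<comment> \<open>The inverse \<open>w\<close> of \<open>v\<close> is a unit of the same kind,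
    which gives the converse implication.\<close>
  obtain w where w: "w \<in> \<O> D" "v \<otimes>\<^bsub>K\<^esub> w = \<one>\<^bsub>K\<^esub>"
    using v local_unit_iff[OF DD] by blast
  have c: "v \<in> carrier K" "w \<in> carrier K"
    using v w local_ring_subset[OF DD] by auto
  then have wv: "w \<otimes>\<^bsub>K\<^esub> v = \<one>\<^bsub>K\<^esub>"
    using w(2) K.m_comm by simp
  then have wU: "w \<in> ?U"
    using local_unit_iff[OF DD w(1)] w(1) v by blast
  have "w \<otimes>\<^bsub>K\<^esub> (v \<otimes>\<^bsub>K\<^esub> h) = h"
    using c h wv K.m_assoc[of w v h] by simp
  then have "?P (v \<otimes>\<^bsub>K\<^esub> h) k \<longleftrightarrow> ?P h k" for k
    using imp[OF _ v, of h k] imp[OF _ wU, of "v \<otimes>\<^bsub>K\<^esub> h" k] by metis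
  then show ?thesis
    unfolding order_along_def by simp
qed

end

lemma module_rational_differentials: "module K (rational_differentials V X)"
  unfolding rational_differentials_def by (rule K.module_kaehler[OF constants_subset])

lemma module_rational_forms: "module K (rational_forms n V X)"
  unfolding rational_forms_def
  by (rule module.module_exterior_power[OF module_rational_differentials])

text \<open>Each of two local generators is a multiple of the other by an element of the local ring.
  As \<open>e\<close> is nonzero, scalars cancel, so these factors are inverse to each other and a
  change of generator costs only a unit.\<close>

lemma divisor_of_form_eq_order:
  assumes D: "prime_divisor V X D" and e: "local_generator n V X D e" "e \<noteq> \<zero>\<^bsub>rational_forms n V X\<^esub>"
    and h: "h \<in> carrier K" and \<omega>: "\<omega> = h \<odot>\<^bsub>rational_forms n V X\<^esub> e"
  shows "divisor_of_form n V X \<omega> D = order_along V X D h"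
proof -
  interpret W: module K "rational_forms n V X" by (rule module_rational_forms)
  let ?W = "rational_forms n V X" and ?O = "\<O> D"
  note DD = prime_divisor_integral[OF D] prime_divisor_subset[OF D]
  \<comment> \<open>Over a field a nonzero scalar can be inverted, so it cannot annihilate
    \<open>e\<close>.\<close>
  have cancel: "a = b" if "a \<in> carrier K" "b \<in> carrier K" "a \<odot>\<^bsub>?W\<^esub> e = b \<odot>\<^bsub>?W\<^esub> e" for a b
  proof (rule ccontr)
    assume "a \<noteq> b"
    then have nz: "a \<ominus>\<^bsub>K\<^esub> b \<noteq> \<zero>\<^bsub>K\<^esub>"
      using that by simp
    have ec: "e \<in> carrier ?W" using e(1) by (simp add: local_generator_def)
    have "(a \<ominus>\<^bsub>K\<^esub> b) \<odot>\<^bsub>?W\<^esub> e = \<zero>\<^bsub>?W\<^esub>"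
      using that ec by (simp add: K.minus_eq W.smult_l_distr W.smult_l_minus W.M.r_neg)
    moreover have u: "a \<ominus>\<^bsub>K\<^esub> b \<in> Units K"
      using nz that K.field_Units by simp
    then have "e = (inv\<^bsub>K\<^esub> (a \<ominus>\<^bsub>K\<^esub> b) \<otimes>\<^bsub>K\<^esub> (a \<ominus>\<^bsub>K\<^esub> b)) \<odot>\<^bsub>?W\<^esub> e"
      using ec by simp
    then have "e = inv\<^bsub>K\<^esub> (a \<ominus>\<^bsub>K\<^esub> b) \<odot>\<^bsub>?W\<^esub> ((a \<ominus>\<^bsub>K\<^esub> b) \<odot>\<^bsub>?W\<^esub> e)"
      using W.smult_assoc1[OF K.Units_inv_closed[OF u] K.Units_closed[OF u] ec] by simp
    ultimately show False
      using e(2) u by simp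
  qed
  have one: "\<one>\<^bsub>K\<^esub> \<in> ?O"
    using subringE(3)[OF subring_local_ring[OF DD]] .
  have "order_along V X D h' = order_along V X D h"
    if e': "local_generator n V X D e'" and h': "h' \<in> carrier K" "\<omega> = h' \<odot>\<^bsub>?W\<^esub> e'" for e' h'
  proof -
    have ec: "e \<in> carrier ?W" "e' \<in> carrier ?W"
      using e(1) e' by (auto simp: local_generator_def)
    have self: "c \<in> forms_at n V X D" if "local_generator n V X D c" for c
    proof -
      have "\<one>\<^bsub>K\<^esub> \<odot>\<^bsub>?W\<^esub> c \<in> forms_at n V X D"
        using that one unfolding local_generator_def by blast
      then show ?thesis
        using that by (simp add: local_generator_def)
    qed
    obtain a where a: "a \<in> ?O" "e' = a \<odot>\<^bsub>?W\<^esub> e"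
      using self[OF e'] e(1) unfolding local_generator_def by blast
    obtain b where b: "b \<in> ?O" "e = b \<odot>\<^bsub>?W\<^esub> e'"
      using self[OF e(1)] e' unfolding local_generator_def by blast
    have abc: "a \<in> carrier K" "b \<in> carrier K"
      using a(1) b(1) local_ring_subset[OF DD] by auto
    have "b \<odot>\<^bsub>?W\<^esub> (a \<odot>\<^bsub>?W\<^esub> e) = e"
      unfolding a(2)[symmetric] b(2)[symmetric] ..
    then have "(b \<otimes>\<^bsub>K\<^esub> a) \<odot>\<^bsub>?W\<^esub> e = \<one>\<^bsub>K\<^esub> \<odot>\<^bsub>?W\<^esub> e"
      using abc ec by (simp add: W.smult_assoc1)
    then have "b \<otimes>\<^bsub>K\<^esub> a = \<one>\<^bsub>K\<^esub>"
      using abc by (intro cancel) auto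
    then have "a \<otimes>\<^bsub>K\<^esub> b = \<one>\<^bsub>K\<^esub>"
      using abc K.m_comm by simp
    then have au: "a \<in> ?O - \<mm> D"
      using a(1) b(1) local_unit_iff[OF DD a(1)] by blast
    have "h \<odot>\<^bsub>?W\<^esub> e = (h' \<otimes>\<^bsub>K\<^esub> a) \<odot>\<^bsub>?W\<^esub> e"
      using \<omega> h' a(2) abc ec by (simp add: W.smult_assoc1)
    then have "h = h' \<otimes>\<^bsub>K\<^esub> a"
      using h h' abc by (intro cancel) auto
    then have "h = a \<otimes>\<^bsub>K\<^esub> h'"
      using h' abc K.m_comm by simp
    then show ?thesis
      using order_along_unit_mult[OF D au h'(1)] by simp
  qed
  \<comment> \<open>The coefficient now has exactly one candidate, attained by \<open>e\<close> and
    \<open>h\<close>, so the definite description picks it.\<close>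
  then have "(\<exists>e' h'. local_generator n V X D e' \<and> h' \<in> carrier K \<and> \<omega> = h' \<odot>\<^bsub>?W\<^esub> e' \<and>
    k = order_along V X D h') \<longleftrightarrow> k = order_along V X D h" for k
    using e(1) h \<omega> by blast
  then show ?thesis
    using D by (simp add: divisor_of_form_def)
qed

end

section \<open>Differentials in local coordinates\<close>

context integral_variety
begin

abbreviation "dK \<equiv> kaehler_d K (constants V X)"
abbreviation "\<Omega> \<equiv> rational_differentials V X"

lemmas dK_closed = K.kaehler_d_closed[OF constants_subset, folded rational_differentials_def]
lemmas dK_add = K.kaehler_d_add[OF constants_subset, folded rational_differentials_def]
lemmas dK_mult = K.kaehler_d_mult[OF constants_subset, folded rational_differentials_def]
lemmas dK_const = K.kaehler_d_const[OF constants_subset, folded rational_differentials_def]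
lemmas dK_span = K.kaehler_span[OF constants_subset, folded rational_differentials_def]

abbreviation "poly_rat f \<equiv> rat f (\<lambda>_. 1)"

lemma poly_rat_closed: "f \<in> PF \<Longrightarrow> poly_rat f \<in> carrier K"
  by (intro rat_closed poly_functions.const V1)

lemma poly_rat_add:
  "f \<in> PF \<Longrightarrow> g \<in> PF \<Longrightarrow> poly_rat (\<lambda>p. f p + g p) = poly_rat f \<oplus>\<^bsub>K\<^esub> poly_rat g"
  by (simp add: rat_add poly_functions.const V1)

lemma poly_rat_mult:
  "f \<in> PF \<Longrightarrow> g \<in> PF \<Longrightarrow> poly_rat (\<lambda>p. f p * g p) = poly_rat f \<otimes>\<^bsub>K\<^esub> poly_rat g"
  by (simp add: rat_mult poly_functions.const V1)

lemma poly_rat_cong: "f \<in> PF \<Longrightarrow> g \<in> PF \<Longrightarrow> (\<And>p. p \<in> V \<Longrightarrow> f p = g p) \<Longrightarrow> poly_rat f = poly_rat g"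
  by (simp add: rat_eq_iff poly_functions.const V1)

lemma rat_mult_denominator:
  "f \<in> PF \<Longrightarrow> g \<in> PF \<Longrightarrow> nonvanishing V g \<Longrightarrow> rat f g \<otimes>\<^bsub>K\<^esub> poly_rat g = poly_rat f"
  by (auto simp: rat_mult rat_eq_iff poly_functions.const poly_functions.mult V1)

context
  fixes D xs h
  assumes D: "integral_set X D" and DV: "D \<subseteq> V"
    and xs: "set xs \<subseteq> PF"
    and h: "h \<in> poly_functions (set xs)" "nonvanishing D h"
    and coords: "\<And>x. x \<in> X \<Longrightarrow> \<exists>N\<in>poly_functions (set xs). \<forall>p\<in>V. h p * x p = N p"
begin

abbreviation (input) "S\<^sub>D \<equiv> module_span (K\<lparr>carrier := \<O> D\<rparr>) \<Omega> ((\<lambda>x. dK (poly_rat x)) ` set xs)"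

interpretation \<Omega>: module K \<Omega> by (rule module_rational_differentials)

lemma gens_closed: "(\<lambda>x. dK (poly_rat x)) ` set xs \<subseteq> carrier \<Omega>"
  using xs by (auto intro!: dK_closed poly_rat_closed)

lemma span_smult: "a \<in> \<O> D \<Longrightarrow> x \<in> S\<^sub>D \<Longrightarrow> a \<odot>\<^bsub>\<Omega>\<^esub> x \<in> S\<^sub>D"
  by (rule module_span_smult) simp_all

text \<open>Stated for any set \<open>Y\<close> because it is used twice: with the local coordinates
  \<open>xs\<close>, and then with all coordinate functions \<open>X\<close>. Membership in
  \<open>PF\<close> is carried along for the induction.\<close>

lemma d_poly_in_span:
  assumes "f \<in> poly_functions Y" "\<And>x. x \<in> Y \<Longrightarrow> x \<in> PF \<and> dK (poly_rat x) \<in> S\<^sub>D"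
  shows "f \<in> PF \<and> dK (poly_rat f) \<in> S\<^sub>D"
  using assms(1)
proof (induction rule: poly_functions.induct)
  case (const c)
  have "poly_rat (\<lambda>_. c) \<in> constants V X"
    by (auto simp: constants_eq)
  then show ?case
    by (simp add: dK_const module_span_zero poly_functions.const)
next
  case (coord x)
  then show ?case using assms(2) by simp
next
  case (add f g)
  then show ?case
    by (simp add: poly_rat_add poly_rat_closed dK_add module_span_add poly_functions.add)
next
  case (mult f g)
  then have "poly_rat f \<in> \<O> D" "poly_rat g \<in> \<O> D"
    by (auto intro!: local_ringI[OF D DV] poly_functions.const nonvanishing_one[OF D])
  with mult show ?case
    by (simp add: poly_rat_mult poly_rat_closed dK_mult module_span_add span_smult poly_functions.mult)
qed

text \<open>The Leibniz rule for the product of \<open>a\<close> and \<open>g\<close> gives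
  \<open>g da = d(a g) - a dg\<close>, and \<open>g\<close> is a unit of the local ring. This takes
  the place of a quotient rule.\<close>

lemma d_quotient_in_span:
  assumes a: "a \<in> \<O> D" and g: "g \<in> PF" "nonvanishing D g"
    and d: "dK (poly_rat g) \<in> S\<^sub>D" "dK (a \<otimes>\<^bsub>K\<^esub> poly_rat g) \<in> S\<^sub>D"
  shows "dK a \<in> S\<^sub>D"
proof -
  let ?g = "poly_rat g" and ?i = "rat (\<lambda>_. 1) g"
  have gV: "nonvanishing V g" using g(2) by (rule nonvanishing_V[OF D DV])
  have i: "?i \<in> \<O> D"
    by (intro local_ringI[OF D DV] g poly_functions.const)
  have c: "a \<in> carrier K" "?g \<in> carrier K" "?i \<in> carrier K"
    using a i g local_ring_subset[OF D DV] by (auto intro: poly_rat_closed)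
  have dc: "dK a \<in> carrier \<Omega>" "dK ?g \<in> carrier \<Omega>"
    using c by (auto intro: dK_closed)
  have ig: "?i \<otimes>\<^bsub>K\<^esub> ?g = \<one>\<^bsub>K\<^esub>"
    unfolding rat_one by (intro rat_mult_denominator poly_functions.const g gV)
  have "?g \<odot>\<^bsub>\<Omega>\<^esub> dK a = dK (a \<otimes>\<^bsub>K\<^esub> ?g) \<oplus>\<^bsub>\<Omega>\<^esub> (\<ominus>\<^bsub>K\<^esub> a) \<odot>\<^bsub>\<Omega>\<^esub> dK ?g"
  proof -
    have "?g \<odot>\<^bsub>\<Omega>\<^esub> dK a \<in> carrier \<Omega>" "a \<odot>\<^bsub>\<Omega>\<^esub> dK ?g \<in> carrier \<Omega>"
      using c dc by simp_all
    then show ?thesis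
      using c dc \<Omega>.M.a_comm[of "a \<odot>\<^bsub>\<Omega>\<^esub> dK ?g" "?g \<odot>\<^bsub>\<Omega>\<^esub> dK a"]
      by (simp add: dK_mult \<Omega>.smult_l_minus \<Omega>.M.a_assoc \<Omega>.M.r_neg)
  qed
  moreover have "\<ominus>\<^bsub>K\<^esub> a \<in> \<O> D"
    using subringE(5)[OF subring_local_ring[OF D DV] a] .
  ultimately have "?g \<odot>\<^bsub>\<Omega>\<^esub> dK a \<in> S\<^sub>D"
    using d by (simp add: module_span_add span_smult)
  then have "?i \<odot>\<^bsub>\<Omega>\<^esub> (?g \<odot>\<^bsub>\<Omega>\<^esub> dK a) \<in> S\<^sub>D"
    by (rule span_smult[OF i])
  then show ?thesis
    using \<Omega>.smult_assoc1[OF c(3,2) dc(1)] ig dc(1) by simp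
qed

lemma d_local_ring_in_span:
  assumes "a \<in> \<O> D"
  shows "dK a \<in> S\<^sub>D"
proof -
  have base: "f \<in> PF \<and> dK (poly_rat f) \<in> S\<^sub>D" if "f \<in> poly_functions (set xs)" for f
    using that
  proof (rule d_poly_in_span)
    show "x \<in> PF \<and> dK (poly_rat x) \<in> S\<^sub>D" if "x \<in> set xs" for x
      using that xs module_span_superset by fast
  qed
  have poly: "f \<in> PF \<and> dK (poly_rat f) \<in> S\<^sub>D" if "f \<in> PF" for f
    using that
  proof (rule d_poly_in_span)
    \<comment> \<open>On \<open>V\<close> the coordinate \<open>x\<close> is \<open>N / h\<close>,
      and \<open>h\<close> is a unit of the local ring at \<open>D\<close>.\<close>
    fix x assume x: "x \<in> X"
    then obtain N where N: "N \<in> poly_functions (set xs)" "\<And>p. p \<in> V \<Longrightarrow> h p * x p = N p"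
      using coords by blast
    have xP: "x \<in> PF" using x by (rule poly_functions.coord)
    have hP: "h \<in> PF" and NP: "N \<in> PF"
      using base h(1) N(1) by auto
    have eq: "poly_rat x \<otimes>\<^bsub>K\<^esub> poly_rat h = poly_rat N"
      unfolding poly_rat_mult[OF xP hP, symmetric] using N(2)
      by (intro poly_rat_cong poly_functions.mult xP hP NP) (simp add: mult.commute)
    have "dK (poly_rat x) \<in> S\<^sub>D"
    proof (rule d_quotient_in_span[OF _ hP h(2)])
      show "poly_rat x \<in> \<O> D"
        by (intro local_ringI[OF D DV] xP poly_functions.const nonvanishing_one[OF D])
      show "dK (poly_rat h) \<in> S\<^sub>D"
        using base[OF h(1)] by (rule conjunct2)
      show "dK (poly_rat x \<otimes>\<^bsub>K\<^esub> poly_rat h) \<in> S\<^sub>D"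
        unfolding eq using base[OF N(1)] by (rule conjunct2)
    qed
    then show "x \<in> PF \<and> dK (poly_rat x) \<in> S\<^sub>D"
      using xP by simp
  qed
  obtain f g where fg: "f \<in> PF" "g \<in> PF" "nonvanishing D g" "nonvanishing V g" "a = rat f g"
    using assms by (rule local_ringE[OF D DV])
  have "dK (a \<otimes>\<^bsub>K\<^esub> poly_rat g) \<in> S\<^sub>D"
    unfolding fg(5) rat_mult_denominator[OF fg(1,2,4)] using poly[OF fg(1)] by (rule conjunct2)
  then show ?thesis
    by (rule d_quotient_in_span[OF assms fg(2,3) conjunct2[OF poly[OF fg(2)]]])
qed

end

definition coordinate_form :: "('p \<Rightarrow> complex) list \<Rightarrow> _" where
  "coordinate_form xs = wedge_d (length xs) V X (map poly_rat xs)"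

lemma coordinate_form_closed:
  assumes "set xs \<subseteq> PF"
  shows "coordinate_form xs \<in> carrier (rational_forms (length xs) V X)"
  unfolding coordinate_form_def wedge_d_def rational_forms_def
  using assms
  by (intro module.wedge_closed[OF module_rational_differentials])
    (auto simp: tuples_def intro!: dK_closed poly_rat_closed)

context
  fixes D xs h
  assumes D: "integral_set X D" and DV: "D \<subseteq> V"
    and xs: "set xs \<subseteq> PF"
    and h: "h \<in> poly_functions (set xs)" "nonvanishing D h"
    and coords: "\<And>x. x \<in> X \<Longrightarrow> \<exists>N\<in>poly_functions (set xs). \<forall>p\<in>V. h p * x p = N p"
begin

text \<open>All differentials of the local ring lie in the span of the differentials of
  \<open>xs\<close>, so \<open>wedge_span\<close> over the local ring puts every spanning form on
  the line of \<open>coordinate_form xs\<close>.\<close>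

lemma forms_at_coordinate_form:
  "forms_at (length xs) V X D =
   {a \<odot>\<^bsub>rational_forms (length xs) V X\<^esub> coordinate_form xs | a. a \<in> \<O> D}"
  (is "?L = ?R")
proof
  let ?n = "length xs" and ?O = "\<O> D"
  let ?W = "rational_forms ?n V X" and ?b = "map (\<lambda>x. dK (poly_rat x)) xs"
  interpret \<Omega>: module K \<Omega> by (rule module_rational_differentials)
  interpret W: module K ?W by (rule module_rational_forms)
  have e: "coordinate_form xs = wedge K ?n \<Omega> ?b"
    by (simp add: coordinate_form_def wedge_d_def comp_def)
  have ec: "coordinate_form xs \<in> carrier ?W"
    by (rule coordinate_form_closed[OF xs])
  have bT: "?b \<in> tuples ?n (carrier \<Omega>)"
    using gens_closed[OF D DV xs h coords] by (simp add: tuples_def)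
  note sub = subring_local_ring[OF D DV]
  note subE = subringE[OF sub]
  show "?L \<subseteq> ?R"
    unfolding forms_at_def
  proof (rule module_span_least)
    show "submodule ?R (K\<lparr>carrier := ?O\<rparr>) ?W"
    proof (rule W.submodule_subringI[OF sub])
      show "?R \<subseteq> carrier ?W"
        using ec subE(1) by auto
      have "\<zero>\<^bsub>?W\<^esub> = \<zero>\<^bsub>K\<^esub> \<odot>\<^bsub>?W\<^esub> coordinate_form xs"
        using ec by simp
      then show "\<zero>\<^bsub>?W\<^esub> \<in> ?R"
        using subE(2) by blast
      show "x \<oplus>\<^bsub>?W\<^esub> y \<in> ?R" if xy: "x \<in> ?R" "y \<in> ?R" for x y
      proof -
        from xy obtain a b where ab: "a \<in> ?O" "b \<in> ?O" "x = a \<odot>\<^bsub>?W\<^esub> coordinate_form xs"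
          "y = b \<odot>\<^bsub>?W\<^esub> coordinate_form xs" by blast
        then have "x \<oplus>\<^bsub>?W\<^esub> y = (a \<oplus>\<^bsub>K\<^esub> b) \<odot>\<^bsub>?W\<^esub> coordinate_form xs"
          using W.smult_l_distr[OF subsetD[OF subE(1)] subsetD[OF subE(1)] ec] by simp
        then show ?thesis
          using subE(7)[OF ab(1,2)] by blast
      qed
      show "b \<odot>\<^bsub>?W\<^esub> x \<in> ?R" if bx: "b \<in> ?O" "x \<in> ?R" for b x
      proof -
        from bx(2) obtain a where a: "a \<in> ?O" "x = a \<odot>\<^bsub>?W\<^esub> coordinate_form xs" by blast
        then have "b \<odot>\<^bsub>?W\<^esub> x = (b \<otimes>\<^bsub>K\<^esub> a) \<odot>\<^bsub>?W\<^esub> coordinate_form xs"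
          using W.smult_assoc1[OF subsetD[OF subE(1)] subsetD[OF subE(1)] ec] bx(1) by simp
        then show ?thesis
          using subE(6)[OF bx(1) a(1)] by blast
      qed
    qed
    show "wedge_d ?n V X ` tuples ?n ?O \<subseteq> ?R"
    proof safe
      fix fs assume fs: "fs \<in> tuples ?n ?O"
      then have "map dK fs \<in> tuples ?n (module_span (K\<lparr>carrier := ?O\<rparr>) \<Omega> (set ?b))"
        using d_local_ring_in_span[OF D DV xs h coords] by (auto simp: tuples_def)
      from \<Omega>.wedge_span[OF bT sub this]
      show "\<exists>a. wedge_d ?n V X fs = a \<odot>\<^bsub>?W\<^esub> coordinate_form xs \<and> a \<in> ?O"
        unfolding e by (auto simp: wedge_d_def rational_forms_def)
    qed
  qed
  \<comment> \<open>The functions \<open>xs\<close> lie in the local ring themselves, so their wedge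
    is among the spanning forms.\<close>
  show "?R \<subseteq> ?L"
  proof safe
    fix a assume a: "a \<in> ?O"
    have "map poly_rat xs \<in> tuples ?n ?O"
      using xs by (auto simp: tuples_def
          intro!: local_ringI[OF D DV] poly_functions.const nonvanishing_one[OF D])
    then have "coordinate_form xs \<in> ?L"
      unfolding forms_at_def coordinate_form_def using module_span_superset by fast
    then show "a \<odot>\<^bsub>?W\<^esub> coordinate_form xs \<in> ?L"
      using a unfolding forms_at_def by (intro module_span_smult) simp_all
  qed
qed

lemma local_generator_coordinate_form:
  "local_generator (length xs) V X D (coordinate_form xs)"
  unfolding local_generator_def using forms_at_coordinate_form coordinate_form_closed[OF xs] by simp

end

text \<open>Like \<open>forms_at_coordinate_form\<close> with \<open>D = V\<close>, but for the
  whole exterior power: its generators are wedges of arbitrary differentials, hence the passage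
  through \<open>dK_span\<close>.\<close>

lemma rational_forms_multiple:
  assumes xs: "set xs \<subseteq> PF" and h: "h \<in> poly_functions (set xs)" "nonvanishing V h"
    and coords: "\<And>x. x \<in> X \<Longrightarrow> \<exists>N\<in>poly_functions (set xs). \<forall>p\<in>V. h p * x p = N p"
    and \<omega>: "\<omega> \<in> carrier (rational_forms (length xs) V X)"
  shows "\<exists>a\<in>carrier K. \<omega> = a \<odot>\<^bsub>rational_forms (length xs) V X\<^esub> coordinate_form xs"
proof -
  let ?n = "length xs"
  let ?W = "rational_forms ?n V X" and ?b = "map (\<lambda>x. dK (poly_rat x)) xs"
  interpret \<Omega>: module K \<Omega> by (rule module_rational_differentials)
  interpret W: module K ?W by (rule module_rational_forms)
  have e: "coordinate_form xs = wedge K ?n \<Omega> ?b"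
    by (simp add: coordinate_form_def wedge_d_def comp_def)
  have ec: "coordinate_form xs \<in> carrier ?W"
    by (rule coordinate_form_closed[OF xs])
  have b: "?b \<in> tuples ?n (carrier \<Omega>)"
    using xs by (auto simp: tuples_def intro!: dK_closed poly_rat_closed)
  let ?S = "module_span K \<Omega> (set ?b)"
  \<comment> \<open>\<open>wedge_span\<close> speaks of a record with replaced carrier; for the full
    carrier this is \<open>K\<close> itself.\<close>
  have Kc: "K\<lparr>carrier := carrier K\<rparr> = K" by simp
  have "carrier \<Omega> \<subseteq> ?S"
  proof (rule dK_span)
    show "submodule ?S K \<Omega>"
      by (rule \<Omega>.submodule_module_span) (use b in \<open>simp add: tuples_def\<close>)
    show "dK a \<in> ?S" if "a \<in> carrier K" for a
      using d_local_ring_in_span[OF integral subset_refl xs h coords, of a] that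
      by (simp add: local_ring_V)
  qed
  then have wedge: "\<exists>a\<in>carrier K. wedge K ?n \<Omega> ys = a \<odot>\<^bsub>?W\<^esub> coordinate_form xs"
    if "ys \<in> tuples ?n (carrier \<Omega>)" for ys
    using \<Omega>.wedge_span[OF b K.carrier_is_subring, of ys] that
    unfolding e rational_forms_def Kc by (auto simp: tuples_def)
  let ?R = "{a \<odot>\<^bsub>?W\<^esub> coordinate_form xs | a. a \<in> carrier K}"
  have "submodule ?R K ?W"
  proof (rule W.submoduleI)
    show "\<zero>\<^bsub>?W\<^esub> \<in> ?R"
      using ec by (auto intro!: exI[of _ "\<zero>\<^bsub>K\<^esub>"])
    show "\<ominus>\<^bsub>?W\<^esub> x \<in> ?R" if x: "x \<in> ?R" for x
    proof -
      from x obtain a where a: "a \<in> carrier K" "x = a \<odot>\<^bsub>?W\<^esub> coordinate_form xs" by blast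
      then have "\<ominus>\<^bsub>?W\<^esub> x = (\<ominus>\<^bsub>K\<^esub> a) \<odot>\<^bsub>?W\<^esub> coordinate_form xs"
        using W.smult_l_minus ec by simp
      then show ?thesis using a(1) by blast
    qed
    show "x \<oplus>\<^bsub>?W\<^esub> y \<in> ?R" if xy: "x \<in> ?R" "y \<in> ?R" for x y
    proof -
      from xy obtain a b where ab: "a \<in> carrier K" "b \<in> carrier K"
        "x = a \<odot>\<^bsub>?W\<^esub> coordinate_form xs" "y = b \<odot>\<^bsub>?W\<^esub> coordinate_form xs" by blast
      then have "x \<oplus>\<^bsub>?W\<^esub> y = (a \<oplus>\<^bsub>K\<^esub> b) \<odot>\<^bsub>?W\<^esub> coordinate_form xs"
        using W.smult_l_distr ec by simp
      then show ?thesis using K.a_closed[OF ab(1,2)] by blast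
    qed
    show "b \<odot>\<^bsub>?W\<^esub> x \<in> ?R" if bx: "b \<in> carrier K" "x \<in> ?R" for b x
    proof -
      from bx(2) obtain a where a: "a \<in> carrier K" "x = a \<odot>\<^bsub>?W\<^esub> coordinate_form xs" by blast
      then have "b \<odot>\<^bsub>?W\<^esub> x = (b \<otimes>\<^bsub>K\<^esub> a) \<odot>\<^bsub>?W\<^esub> coordinate_form xs"
        using W.smult_assoc1 ec bx(1) by simp
      then show ?thesis using K.m_closed[OF bx(1) a(1)] by blast
    qed
  qed (use ec in auto)
  then have "carrier ?W \<subseteq> ?R"
    unfolding rational_forms_def
    by (rule \<Omega>.exterior_power_span) (use wedge in \<open>auto simp: rational_forms_def\<close>)
  then show ?thesis
    using \<omega> by blast
qed

end

section \<open>Functionals modulo generic equality\<close>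

text \<open>The cofactors along row \<open>k\<close> do not see that row, so Laplace expansion along
  it is linear.\<close>

lemma det_row_combination:
  fixes A B C :: "'a :: comm_ring_1 mat"
  assumes carr: "A \<in> carrier_mat n n" "B \<in> carrier_mat n n" "C \<in> carrier_mat n n" and k: "k < n"
    and row: "\<And>j. j < n \<Longrightarrow> C $$ (k, j) = c * A $$ (k, j) + d * B $$ (k, j)"
    and other: "\<And>i j. i < n \<Longrightarrow> i \<noteq> k \<Longrightarrow> j < n \<Longrightarrow> A $$ (i, j) = C $$ (i, j) \<and> B $$ (i, j) = C $$ (i, j)"
  shows "det C = c * det A + d * det B"
proof -
  have "mat_delete A k j = mat_delete C k j" "mat_delete B k j = mat_delete C k j" if "j < n" for j
    using that carr k other by (auto simp: mat_delete_def intro!: cong_mat)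
  then have cof: "cofactor A k j = cofactor C k j" "cofactor B k j = cofactor C k j" if "j < n" for j
    using that by (simp_all add: cofactor_def)
  have "det C = (\<Sum>j<n. (c * A $$ (k, j) + d * B $$ (k, j)) * cofactor C k j)"
    unfolding laplace_expansion_row[OF carr(3) k] using row by (intro sum.cong) auto
  also have "\<dots> = c * (\<Sum>j<n. A $$ (k, j) * cofactor A k j) + d * (\<Sum>j<n. B $$ (k, j) * cofactor B k j)"
    using cof by (simp add: sum_distrib_left sum.distrib[symmetric] algebra_simps)
  finally show ?thesis
    using laplace_expansion_row[OF carr(1) k] laplace_expansion_row[OF carr(2) k] by simp
qed

text \<open>The target of the functionals below is the module of functions modulo equality along the
  filter; working with representatives avoids forming this quotient.\<close>

locale generic_evaluation = cring R for R (structure) +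
  fixes ev :: "'a \<Rightarrow> 'p \<Rightarrow> complex" and F :: "'p filter"
  assumes ev_add: "\<lbrakk>a \<in> carrier R; b \<in> carrier R\<rbrakk> \<Longrightarrow> \<forall>\<^sub>F p in F. ev (a \<oplus> b) p = ev a p + ev b p"
    and ev_mult: "\<lbrakk>a \<in> carrier R; b \<in> carrier R\<rbrakk> \<Longrightarrow> \<forall>\<^sub>F p in F. ev (a \<otimes> b) p = ev a p * ev b p"
    and ev_zero: "\<forall>\<^sub>F p in F. ev \<zero> p = 0"
    and ev_one: "\<forall>\<^sub>F p in F. ev \<one> p = 1"
begin

section \<open>Linear extension of functions given on generators\<close>

definition linear_ext :: "('c \<Rightarrow> 'p \<Rightarrow> complex) \<Rightarrow> ('c \<Rightarrow> 'a) \<Rightarrow> 'p \<Rightarrow> complex" where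
  "linear_ext v f p = (\<Sum>x | f x \<noteq> \<zero>. ev (f x) p * v x p)"

text \<open>\<open>f\<close>, \<open>g\<close> and their sum have different supports, so the sums
  are compared over a common finite index set. The equality is only generic because
  \<open>ev \<zero>\<close> is only generically zero.\<close>

lemma linear_ext_superset:
  assumes "finite T" "{x. f x \<noteq> \<zero>} \<subseteq> T"
  shows "\<forall>\<^sub>F p in F. linear_ext v f p = (\<Sum>x\<in>T. ev (f x) p * v x p)"
  using ev_zero
proof eventually_elim
  case (elim p)
  have "ev (f x) p * v x p = 0" if "f x = \<zero>" for x
    using elim that by simp
  then show ?case
    unfolding linear_ext_def using assms by (intro sum.mono_neutral_left) auto
qed

context
  fixes S :: "'c set"
begin

abbreviation (input) "FM \<equiv> free_module R S"

lemma linear_ext_add: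
  assumes f: "f \<in> carrier FM" and g: "g \<in> carrier FM"
  shows "\<forall>\<^sub>F p in F. linear_ext v (f \<oplus>\<^bsub>FM\<^esub> g) p = linear_ext v f p + linear_ext v g p"
proof -
  let ?T = "{x. f x \<noteq> \<zero>} \<union> {x. g x \<noteq> \<zero>}"
  have fin: "finite ?T" and c: "\<And>x. f x \<in> carrier R" "\<And>x. g x \<in> carrier R"
    using f g by (auto simp: free_module_def)
  have sub: "{x. (f \<oplus>\<^bsub>FM\<^esub> g) x \<noteq> \<zero>} \<subseteq> ?T"
    by (auto simp: free_module_def)
  \<comment> \<open>Generic identities can be combined in finite number only; here the finiteness of
    the supports enters.\<close>
  have "\<forall>\<^sub>F p in F. \<forall>x\<in>?T. ev (f x \<oplus> g x) p = ev (f x) p + ev (g x) p"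
    using fin by (intro eventually_ball_finite ballI ev_add c)
  with linear_ext_superset[OF fin sub, of v] linear_ext_superset[OF fin Un_upper1, of v]
    linear_ext_superset[OF fin Un_upper2, of v]
  show ?thesis
  proof eventually_elim
    case (elim p)
    have "linear_ext v (f \<oplus>\<^bsub>FM\<^esub> g) p = (\<Sum>x\<in>?T. (ev (f x) p + ev (g x) p) * v x p)"
      unfolding elim(1) using elim(4) by (intro sum.cong) (auto simp: free_module_def)
    then show ?case
      using elim(2,3) by (simp add: distrib_right sum.distrib)
  qed
qed

lemma linear_ext_smult:
  assumes a: "a \<in> carrier R" and f: "f \<in> carrier FM"
  shows "\<forall>\<^sub>F p in F. linear_ext v (a \<odot>\<^bsub>FM\<^esub> f) p = ev a p * linear_ext v f p"
proof -
  let ?T = "{x. f x \<noteq> \<zero>}"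
  have fin: "finite ?T" and c: "\<And>x. f x \<in> carrier R"
    using f by (auto simp: free_module_def)
  have sub: "{x. (a \<odot>\<^bsub>FM\<^esub> f) x \<noteq> \<zero>} \<subseteq> ?T"
    using a by (auto simp: free_module_def)
  have "\<forall>\<^sub>F p in F. \<forall>x\<in>?T. ev (a \<otimes> f x) p = ev a p * ev (f x) p"
    using fin by (intro eventually_ball_finite ballI ev_mult a c)
  with linear_ext_superset[OF fin sub, of v]
  show ?thesis
  proof eventually_elim
    case (elim p)
    have "linear_ext v (a \<odot>\<^bsub>FM\<^esub> f) p = (\<Sum>x\<in>?T. (ev a p * ev (f x) p) * v x p)"
      unfolding elim(1) using elim(2) by (intro sum.cong) (auto simp: free_module_def)
    then show ?case
      by (simp add: linear_ext_def sum_distrib_left mult.assoc)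
  qed
qed

lemma linear_ext_gen: "\<forall>\<^sub>F p in F. linear_ext v (free_gen R x) p = v x p"
proof -
  have "{y. free_gen R x y \<noteq> \<zero>} \<subseteq> {x}"
    by (auto simp: free_gen_def)
  from linear_ext_superset[OF finite.insertI[OF finite.emptyI] this, of v] ev_one show ?thesis
    by eventually_elim (auto simp: free_gen_def)
qed

lemma linear_ext_minus:
  assumes f: "f \<in> carrier FM" and g: "g \<in> carrier FM"
  shows "\<forall>\<^sub>F p in F. linear_ext v (f \<ominus>\<^bsub>FM\<^esub> g) p = linear_ext v f p - linear_ext v g p"
proof -
  interpret FM: module R FM by (rule module_free_module)
  have "(f \<ominus>\<^bsub>FM\<^esub> g) \<oplus>\<^bsub>FM\<^esub> g = f"
    using f g by (simp add: FM.minus_eq FM.M.a_assoc FM.M.l_neg)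
  then have "\<forall>\<^sub>F p in F. linear_ext v f p = linear_ext v (f \<ominus>\<^bsub>FM\<^esub> g) p + linear_ext v g p"
    using linear_ext_add[OF FM.M.minus_closed[OF f g] g, of v] by simp
  then show ?thesis
    by eventually_elim simp
qed

context
  fixes Rel v
  assumes Rel: "Rel \<subseteq> carrier FM" and rel: "\<And>r. r \<in> Rel \<Longrightarrow> \<forall>\<^sub>F p in F. linear_ext v r p = 0"
begin

interpretation FM: module R FM by (rule module_free_module)

abbreviation (input) "PM \<equiv> presented_module R S Rel"

text \<open>The elements on which the extension vanishes generically form a submodule containing the
  relations.\<close>

lemma linear_ext_span:
  assumes "f \<in> module_span R FM Rel"
  shows "\<forall>\<^sub>F p in F. linear_ext v f p = 0"
proof -
  let ?N = "{f \<in> carrier FM. \<forall>\<^sub>F p in F. linear_ext v f p = 0}"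
  have smult: "a \<odot>\<^bsub>FM\<^esub> f \<in> ?N" if "a \<in> carrier R" "f \<in> ?N" for a f
  proof -
    have f: "f \<in> carrier FM" and "\<forall>\<^sub>F p in F. linear_ext v f p = 0"
      using that by auto
    from linear_ext_smult[OF that(1) f, of v] this(2)
    have "\<forall>\<^sub>F p in F. linear_ext v (a \<odot>\<^bsub>FM\<^esub> f) p = 0"
      by eventually_elim simp
    then show ?thesis using that by simp
  qed
  have "submodule ?N R FM"
  proof (rule FM.submoduleI)
    show "\<zero>\<^bsub>FM\<^esub> \<in> ?N"
      by (auto simp: linear_ext_def free_module_def)
    fix f assume f: "f \<in> ?N"
    then have "\<ominus>\<^bsub>FM\<^esub> f = (\<ominus> \<one>) \<odot>\<^bsub>FM\<^esub> f"
      using FM.smult_l_minus[of \<one> f] by simp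
    then show "\<ominus>\<^bsub>FM\<^esub> f \<in> ?N"
      using smult[OF _ f, of "\<ominus> \<one>"] by simp
    fix g assume g: "g \<in> ?N"
    have fg: "f \<in> carrier FM" "g \<in> carrier FM"
      and "\<forall>\<^sub>F p in F. linear_ext v f p = 0" "\<forall>\<^sub>F p in F. linear_ext v g p = 0"
      using f g by auto
    from linear_ext_add[OF fg, of v] this(3,4)
    have "\<forall>\<^sub>F p in F. linear_ext v (f \<oplus>\<^bsub>FM\<^esub> g) p = 0"
      by eventually_elim simp
    then show "f \<oplus>\<^bsub>FM\<^esub> g \<in> ?N" using f g by simp
  qed (use smult in auto)
  moreover have "Rel \<subseteq> ?N"
    using Rel rel by auto
  ultimately show ?thesis
    using assms module_span_least[of ?N R FM Rel] by blast
qed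

text \<open>The representative is an arbitrary choice; by \<open>linear_ext_span\<close> another one
  changes the function only up to generic equality.\<close>

definition induced :: "('c \<Rightarrow> 'a) set \<Rightarrow> 'p \<Rightarrow> complex" where
  "induced C = linear_ext v (SOME f. f \<in> carrier FM \<and> presented_class S Rel f = C)"

lemma induced_class:
  assumes f: "f \<in> carrier FM"
  shows "\<forall>\<^sub>F p in F. induced (presented_class S Rel f) p = linear_ext v f p"
proof -
  define g where "g = (SOME g. g \<in> carrier FM \<and> presented_class S Rel g = presented_class S Rel f)"
  have "g \<in> carrier FM \<and> presented_class S Rel g = presented_class S Rel f"
    unfolding g_def by (rule someI[of _ f]) (simp add: f)
  then have g: "g \<in> carrier FM" "presented_class S Rel g = presented_class S Rel f"
    by auto
  have "g \<ominus>\<^bsub>FM\<^esub> f \<in> module_span R FM Rel"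
    by (intro iffD1[OF presented_class_eq_iff[OF Rel g(1) f]] g(2))
  from linear_ext_span[OF this] linear_ext_minus[OF g(1) f, of v]
  have "\<forall>\<^sub>F p in F. linear_ext v g p = linear_ext v f p"
    by eventually_elim simp
  then show ?thesis
    by (simp add: induced_def g_def)
qed

lemma induced_add:
  assumes "x \<in> carrier PM" "y \<in> carrier PM"
  shows "\<forall>\<^sub>F p in F. induced (x \<oplus>\<^bsub>PM\<^esub> y) p = induced x p + induced y p"
proof -
  obtain f g where fg: "f \<in> carrier FM" "g \<in> carrier FM"
    and xy: "x = presented_class S Rel f" "y = presented_class S Rel g"
    using assms by (auto simp: carrier_presented_module[OF Rel])
  have eq: "x \<oplus>\<^bsub>PM\<^esub> y = presented_class S Rel (f \<oplus>\<^bsub>FM\<^esub> g)"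
    using fg by (simp add: xy presented_class_add[OF Rel])
  show ?thesis
    unfolding eq unfolding xy
    using induced_class[OF fg(1)] induced_class[OF fg(2)] linear_ext_add[OF fg, of v]
      induced_class[OF FM.M.a_closed[OF fg]]
    by eventually_elim simp
qed

lemma induced_smult:
  assumes "a \<in> carrier R" "x \<in> carrier PM"
  shows "\<forall>\<^sub>F p in F. induced (a \<odot>\<^bsub>PM\<^esub> x) p = ev a p * induced x p"
proof -
  obtain f where f: "f \<in> carrier FM" and x: "x = presented_class S Rel f"
    using assms by (auto simp: carrier_presented_module[OF Rel])
  have eq: "a \<odot>\<^bsub>PM\<^esub> x = presented_class S Rel (a \<odot>\<^bsub>FM\<^esub> f)"
    using f assms(1) by (simp add: x presented_class_smult[OF Rel])
  show ?thesis
    unfolding eq unfolding x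
    using induced_class[OF f] linear_ext_smult[OF assms(1) f, of v]
      induced_class[OF FM.smult_closed[OF assms(1) f]]
    by eventually_elim simp
qed

lemma induced_gen:
  assumes "x \<in> S"
  shows "\<forall>\<^sub>F p in F. induced (presented_gen R S Rel x) p = v x p"
  unfolding presented_gen_eq[OF Rel]
  using induced_class[OF free_gen_closed[OF assms]] linear_ext_gen[of v x]
  by eventually_elim simp

end

end

text \<open>The set on which an identity holds may depend on the elements involved; no common one
  for all elements is asked for.\<close>

definition generic_linear :: "('a, 'c, 'n) module_scheme \<Rightarrow> ('c \<Rightarrow> 'p \<Rightarrow> complex) \<Rightarrow> bool" where
  "generic_linear M l \<longleftrightarrow>
    (\<forall>x\<in>carrier M. \<forall>y\<in>carrier M. \<forall>\<^sub>F p in F. l (x \<oplus>\<^bsub>M\<^esub> y) p = l x p + l y p) \<and>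
    (\<forall>a\<in>carrier R. \<forall>x\<in>carrier M. \<forall>\<^sub>F p in F. l (a \<odot>\<^bsub>M\<^esub> x) p = ev a p * l x p)"

text \<open>The universal property of Kaehler differentials, for a map \<open>\<delta>\<close> that
  obeys the rules of a derivation only generically.\<close>

lemma kaehler_functional:
  assumes k: "k \<subseteq> carrier R"
    and add: "\<And>a b. a \<in> carrier R \<Longrightarrow> b \<in> carrier R \<Longrightarrow> \<forall>\<^sub>F p in F. \<delta> (a \<oplus> b) p = \<delta> a p + \<delta> b p"
    and mult: "\<And>a b. a \<in> carrier R \<Longrightarrow> b \<in> carrier R \<Longrightarrow>
      \<forall>\<^sub>F p in F. \<delta> (a \<otimes> b) p = ev a p * \<delta> b p + ev b p * \<delta> a p"
    and const: "\<And>c. c \<in> k \<Longrightarrow> \<forall>\<^sub>F p in F. \<delta> c p = 0"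
  shows "\<exists>l. generic_linear (kaehler R k) l \<and>
    (\<forall>a\<in>carrier R. \<forall>\<^sub>F p in F. l (kaehler_d R k a) p = \<delta> a p)"
proof -
  let ?S = "carrier R" and ?Rel = "kaehler_relations R k"
  let ?F = "free_module R ?S"
  interpret FM: module R ?F by (rule module_free_module)
  note Rel = kaehler_relations_closed[OF k]
  have gen: "\<And>a. a \<in> carrier R \<Longrightarrow> free_gen R a \<in> carrier ?F"
    by (rule free_gen_closed)
  have rel: "\<forall>\<^sub>F p in F. linear_ext \<delta> r p = 0" if r: "r \<in> ?Rel" for r
  proof -
    consider (add) a b where "a \<in> carrier R" "b \<in> carrier R"
        "r = free_gen R (a \<oplus> b) \<ominus>\<^bsub>?F\<^esub> (free_gen R a \<oplus>\<^bsub>?F\<^esub> free_gen R b)"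
      | (mult) a b where "a \<in> carrier R" "b \<in> carrier R"
        "r = free_gen R (a \<otimes> b) \<ominus>\<^bsub>?F\<^esub> (a \<odot>\<^bsub>?F\<^esub> free_gen R b \<oplus>\<^bsub>?F\<^esub> b \<odot>\<^bsub>?F\<^esub> free_gen R a)"
      | (const) c where "c \<in> k" "r = free_gen R c"
      using r by (auto simp: kaehler_relations_def Let_def)
    then show ?thesis
    proof cases
      case add
      note ab = add(1,2)
      have c: "free_gen R a \<in> carrier ?F" "free_gen R b \<in> carrier ?F" "free_gen R (a \<oplus> b) \<in> carrier ?F"
        using ab by (auto intro: gen)
      show ?thesis
        unfolding add(3)
        using linear_ext_minus[OF c(3) FM.M.a_closed[OF c(1,2)], of \<delta>] linear_ext_add[OF c(1,2), of \<delta>]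
          linear_ext_gen[of \<delta> a] linear_ext_gen[of \<delta> b] linear_ext_gen[of \<delta> "a \<oplus> b"] assms(2)[OF ab]
        by eventually_elim simp
    next
      case mult
      note ab = mult(1,2)
      have c: "free_gen R a \<in> carrier ?F" "free_gen R b \<in> carrier ?F" "free_gen R (a \<otimes> b) \<in> carrier ?F"
        "a \<odot>\<^bsub>?F\<^esub> free_gen R b \<in> carrier ?F" "b \<odot>\<^bsub>?F\<^esub> free_gen R a \<in> carrier ?F"
        using ab by (auto intro: gen)
      show ?thesis
        unfolding mult(3)
        using linear_ext_minus[OF c(3) FM.M.a_closed[OF c(4,5)], of \<delta>] linear_ext_add[OF c(4,5), of \<delta>]
          linear_ext_smult[OF ab(1) c(2), of \<delta>] linear_ext_smult[OF ab(2) c(1), of \<delta>]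
          linear_ext_gen[of \<delta> a] linear_ext_gen[of \<delta> b] linear_ext_gen[of \<delta> "a \<otimes> b"] assms(3)[OF ab]
        by eventually_elim simp
    next
      case (const c)
      show ?thesis
        unfolding const(2) using linear_ext_gen[of \<delta> c] assms(4)[OF const(1)]
        by eventually_elim simp
    qed
  qed
  show ?thesis
    using induced_add[OF Rel rel] induced_smult[OF Rel rel] induced_gen[OF Rel rel]
    by (intro exI[of _ "induced ?S ?Rel \<delta>"])
      (simp add: generic_linear_def kaehler_def kaehler_d_def)
qed

text \<open>The determinant is multilinear in its rows and vanishes for equal rows, so it respects
  the three kinds of relations. There are finitely many functionals \<open>l j\<close>, so their
  generic identities can be used simultaneously.\<close>

lemma exterior_functional:
  fixes M :: "('a, 'c, 'n) module_scheme"
  assumes M: "module R M" and l: "\<And>j. j < n \<Longrightarrow> generic_linear M (l j)"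
  shows "\<exists>L. generic_linear (exterior_power R n M) L \<and>
    (\<forall>xs\<in>tuples n (carrier M).
       \<forall>\<^sub>F p in F. L (wedge R n M xs) p = det (mat n n (\<lambda>(i, j). l j (xs ! i) p)))"
proof -
  interpret M: module R M by (rule M)
  let ?S = "tuples n (carrier M)" and ?Rel = "exterior_relations R n M"
  let ?F = "free_module R ?S"
  define v where "v xs p = det (mat n n (\<lambda>(i, j). l j (xs ! i) p))" for xs p
  interpret FM: module R ?F by (rule module_free_module)
  note Rel = M.exterior_relations_closed[of n]
  have l_add: "\<forall>\<^sub>F p in F. \<forall>j\<in>{..<n}. l j (x \<oplus>\<^bsub>M\<^esub> y) p = l j x p + l j y p"
    if "x \<in> carrier M" "y \<in> carrier M" for x y
    using l that by (intro eventually_ball_finite) (auto simp: generic_linear_def)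
  have l_smult: "\<forall>\<^sub>F p in F. \<forall>j\<in>{..<n}. l j (a \<odot>\<^bsub>M\<^esub> x) p = ev a p * l j x p"
    if "a \<in> carrier R" "x \<in> carrier M" for a x
    using l that by (intro eventually_ball_finite) (auto simp: generic_linear_def)
  have rel: "\<forall>\<^sub>F p in F. linear_ext v r p = 0" if r: "r \<in> ?Rel" for r
  proof -
    consider (add) xs i x y where "xs \<in> ?S" "i < n" "x \<in> carrier M" "y \<in> carrier M"
        "r = free_gen R (xs[i := x \<oplus>\<^bsub>M\<^esub> y]) \<ominus>\<^bsub>?F\<^esub>
          (free_gen R (xs[i := x]) \<oplus>\<^bsub>?F\<^esub> free_gen R (xs[i := y]))"
      | (smult) xs i a x where "xs \<in> ?S" "i < n" "a \<in> carrier R" "x \<in> carrier M"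
        "r = free_gen R (xs[i := a \<odot>\<^bsub>M\<^esub> x]) \<ominus>\<^bsub>?F\<^esub> (a \<odot>\<^bsub>?F\<^esub> free_gen R (xs[i := x]))"
      | (alt) xs i j where "xs \<in> ?S" "i < j" "j < n" "xs ! i = xs ! j" "r = free_gen R xs"
      using r unfolding exterior_relations_def Let_def
      by (elim UnE CollectE exE conjE)
        ((rule that(1); assumption) | (rule that(2); assumption) | (rule that(3); assumption))+
    then show ?thesis
    proof cases
      case add
      note h = add(1-4)
      have len: "length xs = n" using h by (simp add: tuples_def)
      have c: "free_gen R (xs[i := x]) \<in> carrier ?F" "free_gen R (xs[i := y]) \<in> carrier ?F"
        "free_gen R (xs[i := x \<oplus>\<^bsub>M\<^esub> y]) \<in> carrier ?F"
        using h by (auto intro!: free_gen_closed tuples_update)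
      show ?thesis
        unfolding add(5)
        using linear_ext_minus[OF c(3) FM.M.a_closed[OF c(1,2)], of v] linear_ext_add[OF c(1,2), of v]
          linear_ext_gen[of v "xs[i := x]"] linear_ext_gen[of v "xs[i := y]"]
          linear_ext_gen[of v "xs[i := x \<oplus>\<^bsub>M\<^esub> y]"] l_add[OF h(3,4)]
      proof eventually_elim
        case (elim p)
        have "v (xs[i := x \<oplus>\<^bsub>M\<^esub> y]) p = 1 * v (xs[i := x]) p + 1 * v (xs[i := y]) p"
          unfolding v_def using elim(6) h(2) len
          by (intro det_row_combination[where k = i]) auto
        then show ?case using elim by simp
      qed
    next
      case smult
      note h = smult(1-4)
      have len: "length xs = n" using h by (simp add: tuples_def)
      have c: "free_gen R (xs[i := x]) \<in> carrier ?F" "free_gen R (xs[i := a \<odot>\<^bsub>M\<^esub> x]) \<in> carrier ?F"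
        using h by (auto intro!: free_gen_closed tuples_update)
      show ?thesis
        unfolding smult(5)
        using linear_ext_minus[OF c(2) FM.smult_closed[OF h(3) c(1)], of v]
          linear_ext_smult[OF h(3) c(1), of v]
          linear_ext_gen[of v "xs[i := x]"] linear_ext_gen[of v "xs[i := a \<odot>\<^bsub>M\<^esub> x]"] l_smult[OF h(3,4)]
      proof eventually_elim
        case (elim p)
        \<comment> \<open>A multiple of one row, treated as a combination of two rows with second
          coefficient 0.\<close>
        have "v (xs[i := a \<odot>\<^bsub>M\<^esub> x]) p = ev a p * v (xs[i := x]) p + 0 * v (xs[i := x]) p"
          unfolding v_def using elim(5) h(2) len
          by (intro det_row_combination[where k = i]) auto
        then show ?case using elim by simp
      qed
    next
      case alt
      have "v xs p = 0" for p
        unfolding v_def using alt by (intro det_identical_rows[of _ n i j]) (auto intro!: eq_vecI)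
      then show ?thesis
        unfolding alt(5) using linear_ext_gen[of v xs] by simp
    qed
  qed
  show ?thesis
    using induced_add[OF Rel rel] induced_smult[OF Rel rel] induced_gen[OF Rel rel]
    by (intro exI[of _ "induced ?S ?Rel v"])
      (simp add: generic_linear_def exterior_power_def wedge_def v_def)
qed

end

section \<open>Derivatives along curves\<close>

text \<open>Points carry no topology here, so differentiability is tested on the coordinate
  functions. The curve has to stay in \<open>V\<close> only near 0, because curves with poles will
  be used.\<close>

definition differentiable_curve ::
  "'p set \<Rightarrow> ('p \<Rightarrow> complex) set \<Rightarrow> (complex \<Rightarrow> 'p) \<Rightarrow> bool" where
  "differentiable_curve V X c \<longleftrightarrow> (\<forall>\<^sub>F t in nhds 0. c t \<in> V) \<and>
    (\<forall>x\<in>X. \<exists>d. ((\<lambda>t. x (c t)) has_field_derivative d) (at 0))"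

lemma has_field_derivative_eventually_eq:
  fixes f g :: "complex \<Rightarrow> complex"
  assumes "\<forall>\<^sub>F t in nhds x. f t = g t" "(g has_field_derivative d) (at x)"
  shows "(f has_field_derivative d) (at x)"
  using DERIV_cong_ev[OF refl assms(1) refl, of d] assms(2) by simp

lemma differentiable_curve_poly:
  assumes "differentiable_curve V X c" "f \<in> poly_functions X"
  shows "\<exists>d. ((\<lambda>t. f (c t)) has_field_derivative d) (at 0)"
  using assms(2)
proof (induction rule: poly_functions.induct)
  case (const a)
  show ?case using DERIV_const by blast
next
  case (coord x)
  then show ?case using assms(1) by (simp add: differentiable_curve_def)
next
  case (add f g)
  then show ?case using DERIV_add by blast
next
  case (mult f g)
  then show ?case using DERIV_mult by blast
qed

lemma differentiable_curve_nonzero: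
  assumes c: "differentiable_curve V X c" and g: "g \<in> poly_functions X" "g (c 0) \<noteq> 0"
  shows "\<forall>\<^sub>F t in nhds 0. g (c t) \<noteq> 0"
proof -
  have "isCont (\<lambda>t. g (c t)) 0"
    using differentiable_curve_poly[OF c g(1)] DERIV_isCont by blast
  then have "((\<lambda>t. g (c t)) \<longlongrightarrow> g (c 0)) (nhds 0)"
    by (simp add: isCont_def tendsto_nhds_iff)
  then show ?thesis
    using g(2) by (rule tendsto_imp_eventually_ne)
qed

section \<open>Generic values of rational functions\<close>

context integral_variety
begin

text \<open>The filter generated by the nonempty basic open sets of \<open>V\<close>.\<close>

definition generic :: "'p filter" where
  "generic = (INF g\<in>{g \<in> PF. nonvanishing V g}. principal {p \<in> V. g p \<noteq> 0})"

text \<open>Irreducibility enters here: the intersection of two nonempty basic open sets is again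
  one.\<close>

lemma eventually_generic:
  "eventually P generic \<longleftrightarrow> (\<exists>g\<in>PF. nonvanishing V g \<and> (\<forall>p\<in>V. g p \<noteq> 0 \<longrightarrow> P p))"
proof -
  let ?B = "{g \<in> PF. nonvanishing V g}"
  have "eventually P generic \<longleftrightarrow> (\<exists>b\<in>?B. eventually P (principal {p \<in> V. b p \<noteq> 0}))"
    unfolding generic_def
  proof (rule eventually_INF_base)
    show "?B \<noteq> {}"
      using V1 poly_functions.const by blast
    fix f g assume "f \<in> ?B" "g \<in> ?B"
    then show "\<exists>x\<in>?B. principal {p \<in> V. x p \<noteq> 0} \<le>
      inf (principal {p \<in> V. f p \<noteq> 0}) (principal {p \<in> V. g p \<noteq> 0})"
      by (intro bexI[of _ "\<lambda>p. f p * g p"])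
        (auto simp: nonvanishing_mult[OF integral] intro: poly_functions.mult)
  qed
  then show ?thesis
    by (auto simp: eventually_principal)
qed

lemma generic_neq_bot: "generic \<noteq> bot"
  unfolding trivial_limit_def eventually_generic by (auto simp: nonvanishing_def)

definition defined_at :: "_ \<Rightarrow> 'p \<Rightarrow> bool" where
  "defined_at a p \<longleftrightarrow> p \<in> V \<and> (\<exists>f\<in>PF. \<exists>g\<in>PF. g p \<noteq> 0 \<and> a = rat f g)"

definition val :: "_ \<Rightarrow> 'p \<Rightarrow> complex" where
  "val a p = (THE z. \<exists>f\<in>PF. \<exists>g\<in>PF. g p \<noteq> 0 \<and> a = rat f g \<and> z = f p / g p)"

text \<open>Two fractions for the same element, with denominators nonzero at \<open>p\<close>, have
  the same value there by cross multiplication on \<open>V\<close>.\<close>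

lemma val_rat:
  assumes "f \<in> PF" "g \<in> PF" "p \<in> V" "g p \<noteq> 0"
  shows "val (rat f g) p = f p / g p"
  unfolding val_def
proof (rule the_equality)
  fix z assume "\<exists>f'\<in>PF. \<exists>g'\<in>PF. g' p \<noteq> 0 \<and> rat f g = rat f' g' \<and> z = f' p / g' p"
  then obtain f' g' where *: "f' \<in> PF" "g' \<in> PF" "g' p \<noteq> 0" "rat f g = rat f' g'" "z = f' p / g' p"
    by blast
  moreover have "nonvanishing V g" "nonvanishing V g'"
    using assms * by (auto simp: nonvanishing_def)
  ultimately have "f p * g' p = f' p * g p"
    using assms by (simp add: rat_eq_iff)
  then show "z = f p / g p"
    using * assms(4) by (simp add: frac_eq_eq)
qed (use assms in blast)

lemma defined_atE:
  assumes "defined_at a p"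
  obtains f g where "f \<in> PF" "g \<in> PF" "g p \<noteq> 0" "nonvanishing V g" "p \<in> V" "a = rat f g"
  using assms by (auto simp: defined_at_def nonvanishing_def)

lemma defined_at_rat: "f \<in> PF \<Longrightarrow> g \<in> PF \<Longrightarrow> p \<in> V \<Longrightarrow> g p \<noteq> 0 \<Longrightarrow> defined_at (rat f g) p"
  by (auto simp: defined_at_def)

lemma eventually_defined_at:
  assumes "a \<in> carrier K"
  shows "\<forall>\<^sub>F p in generic. defined_at a p"
proof -
  obtain f g where "f \<in> PF" "g \<in> PF" "nonvanishing V g" "a = rat f g"
    using assms by (rule carrier_K_E)
  then show ?thesis
    unfolding eventually_generic by (intro bexI[of _ g]) (auto intro: defined_at_rat)
qed

lemma val_add:
  assumes "defined_at a p" "defined_at b p"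
  shows "val (a \<oplus>\<^bsub>K\<^esub> b) p = val a p + val b p"
proof -
  obtain f g where fg: "f \<in> PF" "g \<in> PF" "g p \<noteq> 0" "nonvanishing V g" "p \<in> V" "a = rat f g"
    using assms(1) by (rule defined_atE)
  obtain f' g' where fg': "f' \<in> PF" "g' \<in> PF" "g' p \<noteq> 0" "nonvanishing V g'" "b = rat f' g'"
    using assms(2) by (rule defined_atE)
  have "val (rat (\<lambda>p. f p * g' p + f' p * g p) (\<lambda>p. g p * g' p)) p =
    (f p * g' p + f' p * g p) / (g p * g' p)"
    using fg fg' by (intro val_rat poly_functions.add poly_functions.mult) auto
  then show ?thesis
    using fg fg' by (simp add: rat_add val_rat field_simps)
qed

lemma val_mult:
  assumes "defined_at a p" "defined_at b p"
  shows "val (a \<otimes>\<^bsub>K\<^esub> b) p = val a p * val b p"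
proof -
  obtain f g where fg: "f \<in> PF" "g \<in> PF" "g p \<noteq> 0" "nonvanishing V g" "p \<in> V" "a = rat f g"
    using assms(1) by (rule defined_atE)
  obtain f' g' where fg': "f' \<in> PF" "g' \<in> PF" "g' p \<noteq> 0" "nonvanishing V g'" "b = rat f' g'"
    using assms(2) by (rule defined_atE)
  have "val (rat (\<lambda>p. f p * f' p) (\<lambda>p. g p * g' p)) p = (f p * f' p) / (g p * g' p)"
    using fg fg' by (intro val_rat poly_functions.mult) auto
  then show ?thesis
    using fg fg' by (simp add: rat_mult val_rat)
qed

lemma val_poly_rat: "f \<in> PF \<Longrightarrow> p \<in> V \<Longrightarrow> val (poly_rat f) p = f p"
  by (simp add: val_rat poly_functions.const)

lemma eventually_in_V: "\<forall>\<^sub>F p in generic. p \<in> V"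
  unfolding eventually_generic using V1 poly_functions.const by blast

sublocale GE: generic_evaluation K val generic
proof
  fix a b assume ab: "a \<in> carrier K" "b \<in> carrier K"
  show "\<forall>\<^sub>F p in generic. val (a \<oplus>\<^bsub>K\<^esub> b) p = val a p + val b p"
    using eventually_defined_at[OF ab(1)] eventually_defined_at[OF ab(2)]
    by eventually_elim (rule val_add)
  show "\<forall>\<^sub>F p in generic. val (a \<otimes>\<^bsub>K\<^esub> b) p = val a p * val b p"
    using eventually_defined_at[OF ab(1)] eventually_defined_at[OF ab(2)]
    by eventually_elim (rule val_mult)
next
  show "\<forall>\<^sub>F p in generic. val \<zero>\<^bsub>K\<^esub> p = 0"
    using eventually_in_V unfolding rat_zero
    by eventually_elim (simp add: val_poly_rat poly_functions.const)
  show "\<forall>\<^sub>F p in generic. val \<one>\<^bsub>K\<^esub> p = 1"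
    using eventually_in_V unfolding rat_one
    by eventually_elim (simp add: val_poly_rat poly_functions.const)
qed

section \<open>Derivations from curves\<close>

definition derivative_along :: "(complex \<Rightarrow> 'p) \<Rightarrow> _ \<Rightarrow> complex" where
  "derivative_along c a = (THE d. ((\<lambda>t. val a (c t)) has_field_derivative d) (at 0))"

lemma derivative_along_eqI:
  "((\<lambda>t. val a (c t)) has_field_derivative d) (at 0) \<Longrightarrow> derivative_along c a = d"
  unfolding derivative_along_def by (rule the_equality) (auto intro: DERIV_unique)

context
  fixes c
  assumes c: "differentiable_curve V X c"
begin

lemma eventually_defined_at_curve:
  assumes "defined_at a (c 0)"
  shows "\<forall>\<^sub>F t in nhds 0. defined_at a (c t)"
proof -
  obtain f g where fg: "f \<in> PF" "g \<in> PF" "g (c 0) \<noteq> 0" "a = rat f g"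
    using assms by (rule defined_atE)
  have "\<forall>\<^sub>F t in nhds 0. c t \<in> V"
    using c by (simp add: differentiable_curve_def)
  with differentiable_curve_nonzero[OF c fg(2,3)] show ?thesis
    by eventually_elim (auto simp: fg(4) intro: defined_at_rat fg(1,2))
qed

text \<open>The denominator stays nonzero along the curve near 0, so there one fixed fraction
  represents \<open>a\<close> and the usual quotient rule applies.\<close>

lemma has_derivative_along:
  assumes "defined_at a (c 0)"
  shows "((\<lambda>t. val a (c t)) has_field_derivative derivative_along c a) (at 0)"
proof -
  obtain f g where fg: "f \<in> PF" "g \<in> PF" "g (c 0) \<noteq> 0" "a = rat f g"
    using assms by (rule defined_atE)
  obtain d d' where "((\<lambda>t. f (c t)) has_field_derivative d) (at 0)"
    "((\<lambda>t. g (c t)) has_field_derivative d') (at 0)"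
    using differentiable_curve_poly[OF c] fg by blast
  then have "((\<lambda>t. f (c t) / g (c t)) has_field_derivative
    ((d * g (c 0) - f (c 0) * d') / (g (c 0) * g (c 0)))) (at 0)"
    using fg(3) by (rule DERIV_divide)
  moreover have "\<forall>\<^sub>F t in nhds 0. c t \<in> V"
    using c by (simp add: differentiable_curve_def)
  with differentiable_curve_nonzero[OF c fg(2,3)]
  have "\<forall>\<^sub>F t in nhds 0. val a (c t) = f (c t) / g (c t)"
    by eventually_elim (simp add: fg val_rat)
  ultimately have "((\<lambda>t. val a (c t)) has_field_derivative
    ((d * g (c 0) - f (c 0) * d') / (g (c 0) * g (c 0)))) (at 0)"
    by (rule has_field_derivative_eventually_eq[rotated])
  then show ?thesis
    using derivative_along_eqI by simp
qed

lemma derivative_along_add: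
  assumes "defined_at a (c 0)" "defined_at b (c 0)"
  shows "derivative_along c (a \<oplus>\<^bsub>K\<^esub> b) = derivative_along c a + derivative_along c b"
proof (rule derivative_along_eqI)
  have "\<forall>\<^sub>F t in nhds 0. val (a \<oplus>\<^bsub>K\<^esub> b) (c t) = val a (c t) + val b (c t)"
    using eventually_defined_at_curve[OF assms(1)] eventually_defined_at_curve[OF assms(2)]
    by eventually_elim (rule val_add)
  then show "((\<lambda>t. val (a \<oplus>\<^bsub>K\<^esub> b) (c t)) has_field_derivative
      derivative_along c a + derivative_along c b) (at 0)"
    using DERIV_add[OF has_derivative_along[OF assms(1)] has_derivative_along[OF assms(2)]]
    by (rule has_field_derivative_eventually_eq)
qed

lemma derivative_along_mult:
  assumes "defined_at a (c 0)" "defined_at b (c 0)"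
  shows "derivative_along c (a \<otimes>\<^bsub>K\<^esub> b) =
    val a (c 0) * derivative_along c b + val b (c 0) * derivative_along c a"
proof (rule derivative_along_eqI)
  have "\<forall>\<^sub>F t in nhds 0. val (a \<otimes>\<^bsub>K\<^esub> b) (c t) = val a (c t) * val b (c t)"
    using eventually_defined_at_curve[OF assms(1)] eventually_defined_at_curve[OF assms(2)]
    by eventually_elim (rule val_mult)
  moreover have "((\<lambda>t. val a (c t) * val b (c t)) has_field_derivative
      val a (c 0) * derivative_along c b + val b (c 0) * derivative_along c a) (at 0)"
    using DERIV_mult[OF has_derivative_along[OF assms(1)] has_derivative_along[OF assms(2)]]
    by (simp add: algebra_simps)
  ultimately show "((\<lambda>t. val (a \<otimes>\<^bsub>K\<^esub> b) (c t)) has_field_derivative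
      val a (c 0) * derivative_along c b + val b (c 0) * derivative_along c a) (at 0)"
    by (rule has_field_derivative_eventually_eq)
qed

lemma derivative_along_poly:
  assumes "f \<in> PF" "((\<lambda>t. f (c t)) has_field_derivative d) (at 0)"
  shows "derivative_along c (poly_rat f) = d"
proof (rule derivative_along_eqI)
  have "\<forall>\<^sub>F t in nhds 0. c t \<in> V"
    using c by (simp add: differentiable_curve_def)
  then have "\<forall>\<^sub>F t in nhds 0. val (poly_rat f) (c t) = f (c t)"
    by eventually_elim (simp add: val_poly_rat assms(1))
  then show "((\<lambda>t. val (poly_rat f) (c t)) has_field_derivative d) (at 0)"
    using assms(2) by (rule has_field_derivative_eventually_eq)
qed

end

text \<open>The determinant of the derivatives along the curves is an alternating functional on
  rational forms whose value at the form is generically 1.\<close>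

lemma coordinate_form_nonzero:
  assumes xs: "set xs \<subseteq> PF"
    and curves: "\<forall>\<^sub>F p in generic. \<forall>j<length xs. differentiable_curve V X (\<gamma> j p) \<and> \<gamma> j p 0 = p \<and>
      ((\<lambda>t. (xs ! j) (\<gamma> j p t)) has_field_derivative 1) (at 0) \<and>
      (\<forall>i<j. ((\<lambda>t. (xs ! i) (\<gamma> j p t)) has_field_derivative 0) (at 0))"
  shows "coordinate_form xs \<noteq> \<zero>\<^bsub>rational_forms (length xs) V X\<^esub>"
proof
  let ?n = "length xs"
  let ?W = "rational_forms ?n V X"
  assume zero: "coordinate_form xs = \<zero>\<^bsub>?W\<^esub>"
  interpret W: module K ?W by (rule module_rational_forms)
  define \<delta> where "\<delta> j a p = derivative_along (\<gamma> j p) a" for j a p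
  let ?P = "\<lambda>j l. GE.generic_linear \<Omega> l \<and>
    (\<forall>a\<in>carrier K. \<forall>\<^sub>F p in generic. l (dK a) p = \<delta> j a p)"
  have ex: "\<exists>l. GE.generic_linear \<Omega> l \<and> (\<forall>a\<in>carrier K. \<forall>\<^sub>F p in generic. l (dK a) p = \<delta> j a p)"
    if j: "j < ?n" for j
    unfolding rational_differentials_def
  proof (rule GE.kaehler_functional[OF constants_subset])
    \<comment> \<open>The rules for \<open>\<delta> j\<close> at \<open>p\<close> are available when
      the arguments are defined at the start of the curve, which is \<open>p\<close>; this holds
      generically.\<close>
    have curve: "\<forall>\<^sub>F p in generic. differentiable_curve V X (\<gamma> j p) \<and> \<gamma> j p 0 = p"
      using curves j by (auto elim: eventually_mono)
    fix a b assume ab: "a \<in> carrier K" "b \<in> carrier K"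
    show "\<forall>\<^sub>F p in generic. \<delta> j (a \<oplus>\<^bsub>K\<^esub> b) p = \<delta> j a p + \<delta> j b p"
      using curve eventually_defined_at[OF ab(1)] eventually_defined_at[OF ab(2)]
    proof eventually_elim
      case (elim p)
      then show ?case
        using derivative_along_add[of "\<gamma> j p" a b] by (simp add: \<delta>_def)
    qed
    show "\<forall>\<^sub>F p in generic. \<delta> j (a \<otimes>\<^bsub>K\<^esub> b) p = val a p * \<delta> j b p + val b p * \<delta> j a p"
      using curve eventually_defined_at[OF ab(1)] eventually_defined_at[OF ab(2)]
    proof eventually_elim
      case (elim p)
      then show ?case
        using derivative_along_mult[of "\<gamma> j p" a b] by (simp add: \<delta>_def)
    qed
  next
    have curve: "\<forall>\<^sub>F p in generic. differentiable_curve V X (\<gamma> j p)"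
      using curves j by (auto elim: eventually_mono)
    fix c assume "c \<in> constants V X"
    then obtain z where c: "c = poly_rat (\<lambda>_. z)"
      by (auto simp: constants_eq)
    show "\<forall>\<^sub>F p in generic. \<delta> j c p = 0"
      using curve unfolding c \<delta>_def
      by eventually_elim (rule derivative_along_poly, auto intro: poly_functions.const)
  qed
  define l where "l j = (SOME l. ?P j l)" for j
  have "?P j (l j)" if "j < ?n" for j
    unfolding l_def using ex[OF that] by (rule someI_ex)
  then have l: "\<And>j. j < ?n \<Longrightarrow> GE.generic_linear \<Omega> (l j)"
    "\<And>j a. j < ?n \<Longrightarrow> a \<in> carrier K \<Longrightarrow> \<forall>\<^sub>F p in generic. l j (dK a) p = \<delta> j a p"
    by simp_all
  obtain L where L: "GE.generic_linear ?W L"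
    "\<And>ys. ys \<in> tuples ?n (carrier \<Omega>) \<Longrightarrow>
      \<forall>\<^sub>F p in generic. L (wedge K ?n \<Omega> ys) p = det (mat ?n ?n (\<lambda>(i, j). l j (ys ! i) p))"
    using GE.exterior_functional[of \<Omega> ?n l, OF module_rational_differentials l(1)]
    unfolding rational_forms_def by blast
  let ?b = "map (\<lambda>x. dK (poly_rat x)) xs"
  have b: "?b \<in> tuples ?n (carrier \<Omega>)"
    using xs by (auto simp: tuples_def intro!: dK_closed poly_rat_closed)
  have e: "coordinate_form xs = wedge K ?n \<Omega> ?b"
    by (simp add: coordinate_form_def wedge_d_def comp_def)
  \<comment> \<open>\<open>L\<close> is linear only generically, so its value at zero is not
    literally zero; homogeneity with the scalar zero gives this generically.\<close>
  have "\<forall>\<^sub>F p in generic. L (\<zero>\<^bsub>K\<^esub> \<odot>\<^bsub>?W\<^esub> \<zero>\<^bsub>?W\<^esub>) p = val \<zero>\<^bsub>K\<^esub> p * L \<zero>\<^bsub>?W\<^esub> p"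
    using L(1) unfolding GE.generic_linear_def by blast
  then have L0: "\<forall>\<^sub>F p in generic. L \<zero>\<^bsub>?W\<^esub> p = 0"
    using GE.ev_zero by eventually_elim simp
  have "\<forall>\<^sub>F p in generic. \<forall>i\<in>{..<?n}. \<forall>j\<in>{..<?n}. l j (?b ! i) p = \<delta> j (poly_rat (xs ! i)) p"
  proof (intro eventually_ball_finite ballI finite_lessThan)
    fix i j assume "i \<in> {..<?n}" "j \<in> {..<?n}"
    moreover then have "xs ! i \<in> PF"
      using xs by auto
    ultimately show "\<forall>\<^sub>F p in generic. l j (?b ! i) p = \<delta> j (poly_rat (xs ! i)) p"
      using l(2)[of j "poly_rat (xs ! i)"] poly_rat_closed by simp
  qed
  with L(2)[OF b] L0 curves have "\<forall>\<^sub>F p in generic. False"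
  proof eventually_elim
    case (elim p)
    let ?A = "mat ?n ?n (\<lambda>(i, j). l j (?b ! i) p)"
    have \<delta>: "\<delta> j (poly_rat (xs ! i)) p = d"
      if "i < ?n" "j < ?n" "((\<lambda>t. (xs ! i) (\<gamma> j p t)) has_field_derivative d) (at 0)" for i j d
      unfolding \<delta>_def using elim(3) that xs by (intro derivative_along_poly) auto
    \<comment> \<open>Rows belong to forms and columns to curves: entry \<open>(i, j)\<close> is the
      derivative of coordinate \<open>i\<close> along curve \<open>j\<close>, which vanishes above
      the diagonal.\<close>
    have "det ?A = prod_list (diag_mat ?A)"
    proof (rule det_lower_triangular)
      fix i j assume ij: "i < j" "j < ?n"
      then show "?A $$ (i, j) = 0"
        using elim(3,4) \<delta>[of i j 0] by simp
    qed simp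
    also have "diag_mat ?A = replicate ?n 1"
      using elim(3,4) \<delta>[of _ _ 1] by (intro nth_equalityI) (auto simp: diag_mat_def)
    finally have "det ?A = 1" by simp
    then show ?case
      using elim(1,2) zero e by simp
  qed
  then show False
    using generic_neq_bot by simp
qed

text \<open>Coordinates are demanded near every point, curves only for the one system
  \<open>ys\<close>. Every rational form is a multiple of each local coordinate form, so a single
  nonzero form shows that none of the local ones is zero.\<close>

theorem canonical_divisors_cartier:
  assumes coords: "\<And>p. p \<in> V \<Longrightarrow> \<exists>xs. length xs = n \<and> set xs \<subseteq> PF \<and>
      (\<exists>h\<in>poly_functions (set xs). h p \<noteq> 0 \<and>
        (\<forall>x\<in>X. \<exists>N\<in>poly_functions (set xs). \<forall>q\<in>V. h q * x q = N q))"
    and xs: "length ys = n" "set ys \<subseteq> PF"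
    and curves: "\<forall>\<^sub>F p in generic. \<forall>j<n. differentiable_curve V X (\<gamma> j p) \<and> \<gamma> j p 0 = p \<and>
      ((\<lambda>t. (ys ! j) (\<gamma> j p t)) has_field_derivative 1) (at 0) \<and>
      (\<forall>i<j. ((\<lambda>t. (ys ! i) (\<gamma> j p t)) has_field_derivative 0) (at 0))"
  shows "canonical_divisors n V X \<noteq> {} \<and> (\<forall>W\<in>canonical_divisors n V X. cartier_divisor V X W)"
proof
  let ?W = "rational_forms n V X"
  interpret W: module K ?W by (rule module_rational_forms)
  have e0: "coordinate_form ys \<in> carrier ?W" "coordinate_form ys \<noteq> \<zero>\<^bsub>?W\<^esub>"
    using coordinate_form_closed[OF xs(2)] coordinate_form_nonzero[OF xs(2)] curves xs(1) by auto
  then show "canonical_divisors n V X \<noteq> {}"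
    by (auto simp: canonical_divisors_def)
  show "\<forall>W\<in>canonical_divisors n V X. cartier_divisor V X W"
  proof
    fix W assume "W \<in> canonical_divisors n V X"
    then obtain \<omega> where \<omega>: "\<omega> \<in> carrier ?W" "\<omega> \<noteq> \<zero>\<^bsub>?W\<^esub>" "W = divisor_of_form n V X \<omega>"
      by (auto simp: canonical_divisors_def)
    show "cartier_divisor V X W"
      unfolding cartier_divisor_def
    proof
      fix p assume p: "p \<in> V"
      from coords[OF p] obtain xs h where n: "length xs = n" and xs: "set xs \<subseteq> PF"
        and h: "h \<in> poly_functions (set xs)" "h p \<noteq> 0"
        and rat: "\<And>x. x \<in> X \<Longrightarrow> \<exists>N\<in>poly_functions (set xs). \<forall>q\<in>V. h q * x q = N q"
        by blast
      let ?e = "coordinate_form xs"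
      have ec: "?e \<in> carrier ?W"
        using coordinate_form_closed[OF xs] n by simp
      have hV: "nonvanishing V h"
        using h(2) p by (auto simp: nonvanishing_def)
      have mult: "\<exists>a\<in>carrier K. \<eta> = a \<odot>\<^bsub>?W\<^esub> ?e" if "\<eta> \<in> carrier ?W" for \<eta>
        using rational_forms_multiple[OF xs h(1) hV rat, of \<eta>] that n by simp
      have e: "?e \<noteq> \<zero>\<^bsub>?W\<^esub>"
        using mult[OF e0(1)] e0(2) by auto
      obtain a where a: "a \<in> carrier K" "\<omega> = a \<odot>\<^bsub>?W\<^esub> ?e"
        using mult[OF \<omega>(1)] by blast
      have a0: "a \<noteq> \<zero>\<^bsub>K\<^esub>"
        using a \<omega>(2) ec by auto
      \<comment> \<open>Along divisors meeting this set the form is \<open>a\<close> times a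
        generator, so \<open>a\<close> is a local equation of the divisor.\<close>
      let ?U = "{q \<in> V. h q \<noteq> 0}"
      have hP: "h \<in> PF"
        using h(1) xs poly_functions_trans by blast
      have "V - ?U = {q \<in> V. \<forall>f\<in>{h}. f q = 0}" by auto
      then have "zariski_open V X ?U"
        unfolding zariski_open_def zariski_closed_def using hP by blast
      moreover have "W D = order_along V X D a" if D: "prime_divisor V X D" "D \<inter> ?U \<noteq> {}" for D
      proof -
        \<comment> \<open>As \<open>D\<close> meets \<open>?U\<close>, \<open>h\<close> is
          invertible at the generic point of \<open>D\<close>.\<close>
        have "nonvanishing D h"
          using D(2) by (auto simp: nonvanishing_def)
        then have "local_generator n V X D ?e"
          using local_generator_coordinate_form[OF prime_divisor_integral[OF D(1)]
              prime_divisor_subset[OF D(1)] xs h(1) _ rat] n by simp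
        then show ?thesis
          unfolding \<omega>(3) using e a by (intro divisor_of_form_eq_order[OF D(1)])
      qed
      ultimately show "\<exists>U h. zariski_open V X U \<and> p \<in> U \<and> h \<in> carrier K \<and> h \<noteq> \<zero>\<^bsub>K\<^esub> \<and>
        (\<forall>D. prime_divisor V X D \<and> D \<inter> U \<noteq> {} \<longrightarrow> W D = order_along V X D h)"
        using p h(2) a a0 by (intro exI[of _ ?U] exI[of _ a]) auto
    qed
  qed
qed

end

section \<open>The generalised affine Stiefel variety\<close>

lemma poly_functions_power: "f \<in> poly_functions X \<Longrightarrow> (\<lambda>p. f p ^ k) \<in> poly_functions X"
  by (induction k) (auto intro: poly_functions.const poly_functions.mult)

lemma one_smult_mat: "(1 :: 'a :: monoid_mult) \<cdot>\<^sub>m A = A"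
  by (intro eq_matI) auto

lemma poly_functions_det:
  assumes "\<And>p. M p \<in> carrier_mat n n"
    and "\<And>i j. i < n \<Longrightarrow> j < n \<Longrightarrow> (\<lambda>p. M p $$ (i, j)) \<in> poly_functions X"
  shows "(\<lambda>p. det (M p)) \<in> poly_functions X"
proof -
  have "(\<lambda>p. \<Sum>\<pi> \<in> {\<pi>. \<pi> permutes {0..<n}}. signof \<pi> * (\<Prod>i = 0..<n. M p $$ (i, \<pi> i)))
    \<in> poly_functions X"
  proof (intro poly_functions_sum poly_functions.mult poly_functions.const poly_functions_prod)
    fix \<pi> i assume "\<pi> \<in> {\<pi>. \<pi> permutes {0..<n}}" "i \<in> {0..<n}"
    then show "(\<lambda>p. M p $$ (i, \<pi> i)) \<in> poly_functions X"
      using permutes_in_image[of \<pi> "{0..<n}" i] by (intro assms(2)) auto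
  qed
  then show ?thesis
    by (simp add: det_def'[OF assms(1)])
qed

text \<open>The entries of the adjugate are signed minors at the transposed position; deleting a row
  and a column only shifts indices.\<close>

lemma poly_functions_adj_mat:
  assumes M: "\<And>p. M p \<in> carrier_mat n n"
    and entries: "\<And>i j. i < n \<Longrightarrow> j < n \<Longrightarrow> (\<lambda>p. M p $$ (i, j)) \<in> poly_functions X"
    and ij: "i < n" "j < n"
  shows "(\<lambda>p. adj_mat (M p) $$ (i, j)) \<in> poly_functions X"
proof -
  have "(\<lambda>p. det (mat_delete (M p) j i)) \<in> poly_functions X"
  proof (rule poly_functions_det)
    show "mat_delete (M p) j i \<in> carrier_mat (n - 1) (n - 1)" for p
      by (rule mat_delete_carrier[OF M])
    fix k l assume kl: "k < n - 1" "l < n - 1"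
    have "(\<lambda>p. mat_delete (M p) j i $$ (k, l)) =
      (\<lambda>p. M p $$ (if k < j then k else Suc k, if l < i then l else Suc l))"
      using kl M by (auto simp: mat_delete_def carrier_matD[OF M])
    also have "\<dots> \<in> poly_functions X"
      using kl by (intro entries) auto
    finally show "(\<lambda>p. mat_delete (M p) j i $$ (k, l)) \<in> poly_functions X" .
  qed
  then have "(\<lambda>p. (-1) ^ (j + i) * det (mat_delete (M p) j i)) \<in> poly_functions X"
    by (intro poly_functions.mult poly_functions.const)
  moreover have "adj_mat (M p) $$ (i, j) = (-1) ^ (j + i) * det (mat_delete (M p) j i)" for p
    using ij by (simp add: adj_mat_def carrier_matD[OF M] cofactor_def)
  ultimately show ?thesis by simp
qed

lemma adj_mat_sum:
  fixes M :: "'a :: comm_ring_1 mat"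
  assumes M: "M \<in> carrier_mat n n" and ij: "i < n" "j < n"
  shows "(\<Sum>k<n. M $$ (i, k) * adj_mat M $$ (k, j)) = (if i = j then det M else 0)"
    and "(\<Sum>k<n. adj_mat M $$ (i, k) * M $$ (k, j)) = (if i = j then det M else 0)"
proof -
  note A = adj_mat[OF M]
  have "(M * adj_mat M) $$ (i, j) = (\<Sum>k<n. M $$ (i, k) * adj_mat M $$ (k, j))"
    using M A(1) ij by (simp add: scalar_prod_def lessThan_atLeast0)
  then show "(\<Sum>k<n. M $$ (i, k) * adj_mat M $$ (k, j)) = (if i = j then det M else 0)"
    unfolding A(2) using ij by (cases "i = j") auto
  have "(adj_mat M * M) $$ (i, j) = (\<Sum>k<n. adj_mat M $$ (i, k) * M $$ (k, j))"
    using M A(1) ij by (simp add: scalar_prod_def lessThan_atLeast0)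
  then show "(\<Sum>k<n. adj_mat M $$ (i, k) * M $$ (k, j)) = (if i = j then det M else 0)"
    unfolding A(3) using ij by (cases "i = j") auto
qed

text \<open>The purpose is to reach actual polynomials: their nonzero elements have nonzero
  products, and a nonzero polynomial has a nonzero value somewhere.\<close>

lemma poly_functions_complex:
  "f \<in> poly_functions {\<lambda>t. t} \<Longrightarrow> \<exists>P. \<forall>t. f t = poly P t"
proof (induction rule: poly_functions.induct)
  case (const c)
  have "\<forall>t. c = poly [:c:] t" by simp
  then show ?case by blast
next
  case (coord x)
  then have "\<forall>t. x t = poly [:0, 1:] t" by simp
  then show ?case by blast
next
  case (add f g)
  then obtain P Q where "\<forall>t. f t = poly P t" "\<forall>t. g t = poly Q t" by blast
  then have "\<forall>t. f t + g t = poly (P + Q) t" by simp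
  then show ?case by blast
next
  case (mult f g)
  then obtain P Q where "\<forall>t. f t = poly P t" "\<forall>t. g t = poly Q t" by blast
  then have "\<forall>t. f t * g t = poly (P * Q) t" by simp
  then show ?case by blast
qed

text \<open>A weak form of the Cauchy-Binet formula. Expanding \<open>det (A * B)\<close> linearly
  in its rows gives a sum over maps \<open>f\<close> of multiples of determinants of rows of
  \<open>B\<close>; in a nonzero term no two of these rows agree, so \<open>f\<close> is injective
  on the row indices.\<close>

lemma ex_nonzero_mat_minor:
  fixes A B :: "'a :: comm_ring_1 mat"
  assumes A: "A \<in> carrier_mat r s" and B: "B \<in> carrier_mat s r" and nz: "det (A * B) \<noteq> 0"
  shows "\<exists>f. f ` {..<r} \<subseteq> {..<s} \<and> inj_on f {..<r} \<and> det (mat r r (\<lambda>(i, j). B $$ (f i, j))) \<noteq> 0"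
proof -
  let ?F = "{f. (\<forall>i\<in>{0..<r}. f i \<in> {0..<s}) \<and> (\<forall>i. i \<notin> {0..<r} \<longrightarrow> f i = i)}"
  have row: "row B k \<in> carrier_vec r" for k
    using row_carrier[of B k] by (simp add: carrier_matD[OF B])
  have "det (A * B) = (\<Sum>f\<in>?F. det (mat\<^sub>r r r (\<lambda>i. A $$ (i, f i) \<cdot>\<^sub>v row B (f i))))"
    unfolding mat_mul_finsum_alt[OF A B] using row
    by (intro det_linear_rows_sum[where a = "\<lambda>i k. A $$ (i, k) \<cdot>\<^sub>v row B k"]) auto
  also have "\<dots> = (\<Sum>f\<in>?F. (\<Prod>i\<in>{0..<r}. A $$ (i, f i)) * det (mat\<^sub>r r r (\<lambda>i. row B (f i))))"
    using row by (intro sum.cong refl det_rows_mul) auto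
  finally have "(\<Sum>f\<in>?F. (\<Prod>i\<in>{0..<r}. A $$ (i, f i)) * det (mat\<^sub>r r r (\<lambda>i. row B (f i)))) \<noteq> 0"
    using nz by simp
  then obtain f where f: "f \<in> ?F"
    "(\<Prod>i\<in>{0..<r}. A $$ (i, f i)) * det (mat\<^sub>r r r (\<lambda>i. row B (f i))) \<noteq> 0"
    by (rule sum.not_neutral_contains_not_neutral)
  from f(2) have nz': "det (mat\<^sub>r r r (\<lambda>i. row B (f i))) \<noteq> 0"
    by auto
  have img: "f ` {..<r} \<subseteq> {..<s}"
    using f(1) by auto
  have eq: "mat\<^sub>r r r (\<lambda>i. row B (f i)) = mat r r (\<lambda>(i, j). B $$ (f i, j))"
    using img B by (intro eq_matI) auto
  have "inj_on f {..<r}"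
  proof (rule inj_onI, rule ccontr)
    fix i j assume ij: "i \<in> {..<r}" "j \<in> {..<r}" "f i = f j" "i \<noteq> j"
    have "det (mat\<^sub>r r r (\<lambda>i. row B (f i))) = 0"
      using ij B by (intro det_identical_rows[of _ r i j]) auto
    then show False using nz' by simp
  qed
  then show ?thesis
    using img nz' eq by auto
qed

section \<open>Irreducibility of the Stiefel variety\<close>

context
  fixes r s :: nat
begin

definition acoord :: "nat \<Rightarrow> nat \<Rightarrow> complex mat \<times> complex mat \<Rightarrow> complex" where
  "acoord i j = (\<lambda>p. fst p $$ (i, j))"

definition bcoord :: "nat \<Rightarrow> nat \<Rightarrow> complex mat \<times> complex mat \<Rightarrow> complex" where
  "bcoord j i = (\<lambda>p. snd p $$ (j, i))"

lemma coordsE: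
  assumes "x \<in> GSV_coords r s"
  obtains (a) i j where "i < r" "j < s" "x = acoord i j"
    | (b) i j where "i < r" "j < s" "x = bcoord j i"
  using assms unfolding GSV_coords_def acoord_def bcoord_def by blast

lemma acoord_mem: "i < r \<Longrightarrow> j < s \<Longrightarrow> acoord i j \<in> GSV_coords r s"
  and bcoord_mem: "i < r \<Longrightarrow> j < s \<Longrightarrow> bcoord j i \<in> GSV_coords r s"
  unfolding GSV_coords_def acoord_def bcoord_def by blast+

lemma GSV_iff:
  "(A, B) \<in> GSV r s \<longleftrightarrow> A \<in> carrier_mat r s \<and> B \<in> carrier_mat s r \<and>
    (\<forall>i<r. \<forall>j<r. (\<Sum>k<s. A $$ (i, k) * B $$ (k, j)) = (if i = j then 1 else 0))"
proof -
  have "A * B = 1\<^sub>m r \<longleftrightarrow>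
    (\<forall>i<r. \<forall>j<r. (\<Sum>k<s. A $$ (i, k) * B $$ (k, j)) = (if i = j then 1 else 0))"
    if A: "A \<in> carrier_mat r s" and B: "B \<in> carrier_mat s r"
  proof -
    have *: "(A * B) $$ (i, j) = (\<Sum>k<s. A $$ (i, k) * B $$ (k, j))" if "i < r" "j < r" for i j
      using A B that by (simp add: scalar_prod_def lessThan_atLeast0)
    show ?thesis
    proof
      assume "A * B = 1\<^sub>m r"
      then show "\<forall>i<r. \<forall>j<r. (\<Sum>k<s. A $$ (i, k) * B $$ (k, j)) = (if i = j then 1 else 0)"
        using * by (metis index_one_mat(1))
    next
      assume "\<forall>i<r. \<forall>j<r. (\<Sum>k<s. A $$ (i, k) * B $$ (k, j)) = (if i = j then 1 else 0)"
      then show "A * B = 1\<^sub>m r"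
        using A B * by (intro eq_matI) auto
    qed
  qed
  then show ?thesis by (auto simp: GSV_def)
qed

definition base_point :: "complex mat \<times> complex mat" where
  "base_point = (mat r s (\<lambda>(i, j). if i = j then 1 else 0), mat s r (\<lambda>(i, j). if i = j then 1 else 0))"

lemma base_point_mem:
  assumes rs: "r \<le> s"
  shows "base_point \<in> GSV r s"
proof -
  have "(\<Sum>k<s. (if i = k then 1 else 0) * (if k = j then 1 else 0)) = (if i = j then 1 else 0 :: complex)"
    if "i < r" for i j
  proof -
    have "(\<Sum>k<s. (if i = k then 1 else 0) * (if k = j then 1 else 0)) =
      (\<Sum>k<s. if i = k then (if i = j then 1 else 0) else 0 :: complex)"
      by (intro sum.cong) auto
    then show ?thesis
      using that rs by simp
  qed
  then show ?thesis
    by (simp add: base_point_def GSV_iff)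
qed

text \<open>Two points \<open>(A, B)\<close> and \<open>(A', B')\<close> are joined by the rational curve
  \<open>(A\<^sub>t, C\<^sub>t (A\<^sub>t C\<^sub>t)\<^sup>-\<^sup>1)\<close>, where \<open>A\<^sub>t\<close> and \<open>C\<^sub>t\<close> interpolate linearly.\<close>

lemma rational_curve:
  assumes p: "p \<in> GSV r s" and q: "q \<in> GSV r s"
  obtains \<gamma> m where "m \<in> poly_functions {\<lambda>t. t}" "m 0 = 1" "m 1 = 1" "\<gamma> 0 = p" "\<gamma> 1 = q"
    "\<And>t. m t \<noteq> 0 \<Longrightarrow> \<gamma> t \<in> GSV r s"
    "\<And>x. x \<in> GSV_coords r s \<Longrightarrow> \<exists>N\<in>poly_functions {\<lambda>t. t}. \<forall>t. m t \<noteq> 0 \<longrightarrow> x (\<gamma> t) * m t = N t"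
proof -
  obtain A B where p': "p = (A, B)" by (cases p)
  obtain A' B' where q': "q = (A', B')" by (cases q)
  have A: "A \<in> carrier_mat r s" "A' \<in> carrier_mat r s" and B: "B \<in> carrier_mat s r" "B' \<in> carrier_mat s r"
    and AB: "A * B = 1\<^sub>m r" "A' * B' = 1\<^sub>m r"
    using p q by (auto simp: p' q' GSV_def)
  define At where "At t = mat r s (\<lambda>i. (1 - t) * A $$ i + t * A' $$ i)" for t
  define Ct where "Ct t = mat s r (\<lambda>i. (1 - t) * B $$ i + t * B' $$ i)" for t
  define M where "M t = At t * Ct t" for t
  define m where "m t = det (M t)" for t
  \<comment> \<open>Where \<open>m t\<close> is nonzero, \<open>1 / m t\<close> times the adjugate
    is the inverse of \<open>M t\<close>. In this form every entry becomes a polynomial in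
    \<open>t\<close> after multiplication by \<open>m t\<close>.\<close>
  define \<gamma> where "\<gamma> t = (At t, (1 / m t) \<cdot>\<^sub>m (Ct t * adj_mat (M t)))" for t
  have carr: "At t \<in> carrier_mat r s" "Ct t \<in> carrier_mat s r" "M t \<in> carrier_mat r r" for t
    by (auto simp: At_def Ct_def M_def)
  have lin: "(\<lambda>t. (1 - t) * a + t * b) \<in> poly_functions {\<lambda>t. t}" for a b
    by (intro poly_functions.add poly_functions.mult poly_functions_diff poly_functions.const
        poly_functions.coord) auto
  have At: "(\<lambda>t. At t $$ (i, j)) \<in> poly_functions {\<lambda>t. t}" if "i < r" "j < s" for i j
    using that lin by (simp add: At_def)
  have Ct: "(\<lambda>t. Ct t $$ (i, j)) \<in> poly_functions {\<lambda>t. t}" if "i < s" "j < r" for i j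
    using that lin by (simp add: Ct_def)
  have Mt: "(\<lambda>t. M t $$ (i, j)) \<in> poly_functions {\<lambda>t. t}" if "i < r" "j < r" for i j
  proof -
    have "M t $$ (i, j) = (\<Sum>k<s. At t $$ (i, k) * Ct t $$ (k, j))" for t
      using carr[of t] that by (simp add: M_def scalar_prod_def lessThan_atLeast0)
    then show ?thesis
      using that by (auto intro!: poly_functions_sum poly_functions.mult At Ct)
  qed
  \<comment> \<open>At both ends \<open>M t\<close> is the identity matrix, so the correcting factor
    disappears and the curve joins \<open>p\<close> to \<open>q\<close>.\<close>
  have end0: "At 0 = A" "Ct 0 = B" and end1: "At 1 = A'" "Ct 1 = B'"
    using A B by (auto simp: At_def Ct_def intro!: eq_matI)
  have adj1: "adj_mat (1\<^sub>m r :: complex mat) = 1\<^sub>m r"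
    using adj_mat[of "1\<^sub>m r :: complex mat" r] by (simp add: one_smult_mat)
  have m: "m 0 = 1" "m 1 = 1"
    by (simp_all add: m_def M_def end0 end1 AB)
  have ends: "\<gamma> 0 = p" "\<gamma> 1 = q"
    using B by (simp_all add: \<gamma>_def m p' q' M_def end0 end1 AB adj1 one_smult_mat)
  have mem: "\<gamma> t \<in> GSV r s" if "m t \<noteq> 0" for t
  proof -
    note C = carr[of t] adj_mat[OF carr(3)[of t]]
    have "At t * ((1 / m t) \<cdot>\<^sub>m (Ct t * adj_mat (M t))) = (1 / m t) \<cdot>\<^sub>m (At t * (Ct t * adj_mat (M t)))"
      using C by (intro mult_smult_distrib[of _ r s _ r]) auto
    also have "At t * (Ct t * adj_mat (M t)) = M t * adj_mat (M t)"
      unfolding M_def using C by (intro assoc_mult_mat[symmetric, of _ r s _ r _ r]) (auto simp: M_def)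
    also have "(1 / m t) \<cdot>\<^sub>m (M t * adj_mat (M t)) = 1\<^sub>m r"
      unfolding C(5) using that by (intro eq_matI) (auto simp: m_def)
    finally show ?thesis
      using C by (auto simp: \<gamma>_def GSV_def)
  qed
  have rat: "\<exists>N\<in>poly_functions {\<lambda>t. t}. \<forall>t. m t \<noteq> 0 \<longrightarrow> x (\<gamma> t) * m t = N t" if "x \<in> GSV_coords r s" for x
    using that
  proof (cases rule: coordsE)
    case (a i j)
    then show ?thesis
      using At[of i j] poly_functions_det[OF carr(3) Mt]
      by (intro bexI[of _ "\<lambda>t. At t $$ (i, j) * m t"])
        (auto simp: acoord_def \<gamma>_def m_def intro: poly_functions.mult)
  next
    case (b i j)
    have eq: "x (\<gamma> t) * m t = (\<Sum>k<r. Ct t $$ (j, k) * adj_mat (M t) $$ (k, i))"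
      if "m t \<noteq> 0" for t
    proof -
      have "x (\<gamma> t) * m t = (Ct t * adj_mat (M t)) $$ (j, i)"
        using b that carr(2)[of t] adj_mat(1)[OF carr(3)[of t]] by (simp add: bcoord_def \<gamma>_def)
      also have "\<dots> = (\<Sum>k<r. Ct t $$ (j, k) * adj_mat (M t) $$ (k, i))"
        using b carr(2)[of t] adj_mat(1)[OF carr(3)[of t]]
        by (simp add: scalar_prod_def lessThan_atLeast0)
      finally show ?thesis .
    qed
    have "(\<lambda>t. \<Sum>k<r. Ct t $$ (j, k) * adj_mat (M t) $$ (k, i)) \<in> poly_functions {\<lambda>t. t}"
      using b by (intro poly_functions_sum poly_functions.mult Ct poly_functions_adj_mat[OF carr(3) Mt]) auto
    then show ?thesis
      by (rule bexI[rotated]) (simp add: eq)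
  qed
  show thesis
  proof (rule that[OF _ m ends mem rat])
    show "m \<in> poly_functions {\<lambda>t. t}"
      unfolding m_def by (rule poly_functions_det[OF carr(3) Mt])
  qed
qed

text \<open>The coordinates have the common denominator \<open>m\<close>; sums and products of them
  need powers of it, whose exponents add up.\<close>

lemma poly_function_along_rational_curve:
  assumes "f \<in> poly_functions (GSV_coords r s)" "m \<in> poly_functions {\<lambda>t. t}"
    and "\<And>x. x \<in> GSV_coords r s \<Longrightarrow> \<exists>N\<in>poly_functions {\<lambda>t. t}. \<forall>t. m t \<noteq> 0 \<longrightarrow> x (\<gamma> t) * m t = N t"
  shows "\<exists>N\<in>poly_functions {\<lambda>t. t}. \<exists>k. \<forall>t. m t \<noteq> 0 \<longrightarrow> f (\<gamma> t) * m t ^ k = N t"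
  using assms(1)
proof (induction rule: poly_functions.induct)
  case (const c)
  show ?case
    by (intro bexI[of _ "\<lambda>_. c"] exI[of _ 0]) (auto intro: poly_functions.const)
next
  case (coord x)
  then obtain N where "N \<in> poly_functions {\<lambda>t. t}" "\<forall>t. m t \<noteq> 0 \<longrightarrow> x (\<gamma> t) * m t ^ 1 = N t"
    using assms(3) by auto
  then show ?case by blast
next
  case (add f g)
  then obtain N k N' k' where N: "N \<in> poly_functions {\<lambda>t. t}" "N' \<in> poly_functions {\<lambda>t. t}"
    "\<And>t. m t \<noteq> 0 \<Longrightarrow> f (\<gamma> t) * m t ^ k = N t" "\<And>t. m t \<noteq> 0 \<Longrightarrow> g (\<gamma> t) * m t ^ k' = N' t"
    by blast
  show ?case
  proof (intro bexI exI allI impI)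
    show "(\<lambda>t. N t * m t ^ k' + N' t * m t ^ k) \<in> poly_functions {\<lambda>t. t}"
      by (intro poly_functions.add poly_functions.mult poly_functions_power N assms(2))
    show "(f (\<gamma> t) + g (\<gamma> t)) * m t ^ (k + k') = N t * m t ^ k' + N' t * m t ^ k" if "m t \<noteq> 0" for t
      unfolding N(3)[OF that, symmetric] N(4)[OF that, symmetric] by (simp add: power_add algebra_simps)
  qed
next
  case (mult f g)
  then obtain N k N' k' where N: "N \<in> poly_functions {\<lambda>t. t}" "N' \<in> poly_functions {\<lambda>t. t}"
    "\<And>t. m t \<noteq> 0 \<Longrightarrow> f (\<gamma> t) * m t ^ k = N t" "\<And>t. m t \<noteq> 0 \<Longrightarrow> g (\<gamma> t) * m t ^ k' = N' t"
    by blast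
  show ?case
  proof (intro bexI exI allI impI)
    show "(\<lambda>t. N t * N' t) \<in> poly_functions {\<lambda>t. t}"
      by (intro poly_functions.mult N)
    show "(f (\<gamma> t) * g (\<gamma> t)) * m t ^ (k + k') = N t * N' t" if "m t \<noteq> 0" for t
      unfolding N(3)[OF that, symmetric] N(4)[OF that, symmetric] by (simp add: power_add algebra_simps)
  qed
qed

text \<open>Along a curve from a point where \<open>f\<close> is nonzero to one where
  \<open>g\<close> is nonzero, both become fractions of polynomials in one variable, and neither
  fraction is zero. Hence both are nonzero at some common parameter.\<close>

lemma integral_GSV:
  assumes rs: "r \<le> s"
  shows "integral_set (GSV_coords r s) (GSV r s)"
  unfolding integral_set_def
proof (intro conjI ballI impI)
  show "GSV r s \<noteq> {}" using base_point_mem[OF rs] by blast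
  fix f g assume fg: "f \<in> poly_functions (GSV_coords r s)" "g \<in> poly_functions (GSV_coords r s)"
    and nz: "nonvanishing (GSV r s) f" "nonvanishing (GSV r s) g"
  obtain p q where pq: "p \<in> GSV r s" "q \<in> GSV r s" "f p \<noteq> 0" "g q \<noteq> 0"
    using nz by (auto simp: nonvanishing_def)
  obtain \<gamma> m where m: "m \<in> poly_functions {\<lambda>t. t}" "m 0 = 1" "m 1 = 1" "\<gamma> 0 = p" "\<gamma> 1 = q"
    and mem: "\<And>t. m t \<noteq> 0 \<Longrightarrow> \<gamma> t \<in> GSV r s"
    and rat: "\<And>x. x \<in> GSV_coords r s \<Longrightarrow> \<exists>N\<in>poly_functions {\<lambda>t. t}. \<forall>t. m t \<noteq> 0 \<longrightarrow> x (\<gamma> t) * m t = N t"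
    using rational_curve[OF pq(1,2)] by metis
  obtain N k where N: "N \<in> poly_functions {\<lambda>t. t}" "\<And>t. m t \<noteq> 0 \<Longrightarrow> f (\<gamma> t) * m t ^ k = N t"
    using poly_function_along_rational_curve[where \<gamma> = \<gamma>, OF fg(1) m(1) rat] by blast
  obtain N' k' where N': "N' \<in> poly_functions {\<lambda>t. t}" "\<And>t. m t \<noteq> 0 \<Longrightarrow> g (\<gamma> t) * m t ^ k' = N' t"
    using poly_function_along_rational_curve[where \<gamma> = \<gamma>, OF fg(2) m(1) rat] by blast
  obtain P P' Q where poly: "\<And>t. N t = poly P t" "\<And>t. N' t = poly P' t" "\<And>t. m t = poly Q t"
    using poly_functions_complex[OF N(1)] poly_functions_complex[OF N'(1)]
      poly_functions_complex[OF m(1)] by blast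
  have "poly P 0 \<noteq> 0" "poly P' 1 \<noteq> 0" "poly Q 0 \<noteq> 0"
    using N(2)[of 0] N'(2)[of 1] m pq poly by auto
  \<comment> \<open>Including the denominator \<open>Q\<close> keeps the parameter away from the
    poles of the curve.\<close>
  then have "P * P' * Q \<noteq> 0" by auto
  then obtain t where "poly (P * P' * Q) t \<noteq> 0"
    using poly_all_0_iff_0 by blast
  then have "m t \<noteq> 0" "N t \<noteq> 0" "N' t \<noteq> 0"
    using poly by auto
  then have "f (\<gamma> t) * g (\<gamma> t) \<noteq> 0" "\<gamma> t \<in> GSV r s"
    using N(2)[of t] N'(2)[of t] mem by auto
  then show "nonvanishing (GSV r s) (\<lambda>p. f p * g p)"
    by (auto simp: nonvanishing_def)
qed

end

section \<open>Charts and the curves that move their coordinates\<close>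

context
  fixes r s :: nat
begin

text \<open>The coordinates belonging to a choice \<open>f\<close> of \<open>r\<close> rows of \<open>B\<close>: all entries of \<open>B\<close>
  (tagged \<open>Inl\<close>), and the entries of \<open>A\<close> in the columns outside the range of \<open>f\<close> (tagged
  \<open>Inr\<close>). Where the rows \<open>f\<close> of \<open>B\<close> form an invertible matrix, \<open>A B = 1\<close> determines the
  remaining columns of \<open>A\<close>.\<close>

definition chart :: "(nat \<Rightarrow> nat) \<Rightarrow> (nat \<times> nat + nat \<times> nat) list" where
  "chart f = map Inl (List.product [0..<s] [0..<r]) @
     map Inr (List.product [0..<r] (filter (\<lambda>k. k \<notin> f ` {..<r}) [0..<s]))"

definition coord_fun :: "nat \<times> nat + nat \<times> nat \<Rightarrow> complex mat \<times> complex mat \<Rightarrow> complex" where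
  "coord_fun u = (case u of Inl (j, i) \<Rightarrow> bcoord j i | Inr (i, j) \<Rightarrow> acoord i j)"

definition rows_mat :: "(nat \<Rightarrow> nat) \<Rightarrow> complex mat \<times> complex mat \<Rightarrow> complex mat" where
  "rows_mat f p = mat r r (\<lambda>(i, j). snd p $$ (f i, j))"

lemma rows_mat_carrier: "rows_mat f p \<in> carrier_mat r r"
  by (simp add: rows_mat_def)

lemma distinct_chart: "distinct (chart f)"
  by (auto simp: chart_def distinct_map distinct_product intro: inj_onI)

lemma set_chart: "set (chart f) = Inl ` ({..<s} \<times> {..<r}) \<union> Inr ` ({..<r} \<times> ({..<s} - f ` {..<r}))"
  by (auto simp: chart_def)

lemma length_chart:
  assumes "f ` {..<r} \<subseteq> {..<s}" "inj_on f {..<r}"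
  shows "length (chart f) = r * s + r * (s - r)"
proof -
  have "length (filter (\<lambda>k. k \<notin> f ` {..<r}) [0..<s]) = card (set (filter (\<lambda>k. k \<notin> f ` {..<r}) [0..<s]))"
    by (rule distinct_card[symmetric]) simp
  also have "set (filter (\<lambda>k. k \<notin> f ` {..<r}) [0..<s]) = {..<s} - f ` {..<r}"
    by auto
  also have "card \<dots> = s - r"
    using assms by (simp add: card_Diff_subset card_image)
  finally show ?thesis
    by (simp add: chart_def length_product)
qed

lemma chart_coords: "set (map coord_fun (chart f)) \<subseteq> GSV_coords r s"
  using bcoord_mem[of _ r _ s] acoord_mem[of _ r _ s] by (auto simp: set_chart coord_fun_def)

lemma rows_mat_poly:
  assumes f: "f ` {..<r} \<subseteq> {..<s}" and ij: "i < r" "j < r"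
  shows "(\<lambda>p. rows_mat f p $$ (i, j)) \<in> poly_functions (set (map coord_fun (chart f)))"
proof -
  have "coord_fun (Inl (f i, j)) \<in> set (map coord_fun (chart f))"
    unfolding set_map set_chart using f ij by (intro imageI) auto
  moreover have "(\<lambda>p. rows_mat f p $$ (i, j)) = coord_fun (Inl (f i, j))"
    using ij by (simp add: rows_mat_def coord_fun_def bcoord_def)
  ultimately show ?thesis
    by (simp add: poly_functions.coord)
qed

lemma det_rows_mat_poly:
  "f ` {..<r} \<subseteq> {..<s} \<Longrightarrow>
   (\<lambda>p. det (rows_mat f p)) \<in> poly_functions (set (map coord_fun (chart f)))"
  by (intro poly_functions_det[OF rows_mat_carrier] rows_mat_poly)

text \<open>Row \<open>i\<close> of \<open>A B = 1\<close> is a linear system for the entries of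
  \<open>A\<close> in the columns chosen by \<open>f\<close>, with matrix
  \<open>rows_mat f p\<close> once the other columns are moved to the right-hand side. The adjugate
  solves it at the cost of one determinant.\<close>

lemma chart_rational:
  assumes f: "f ` {..<r} \<subseteq> {..<s}" "inj_on f {..<r}" and x: "x \<in> GSV_coords r s"
  shows "\<exists>N\<in>poly_functions (set (map coord_fun (chart f))). \<forall>p\<in>GSV r s. det (rows_mat f p) * x p = N p"
proof -
  let ?Y = "set (map coord_fun (chart f))"
  have coord: "coord_fun u \<in> poly_functions ?Y" if "u \<in> set (chart f)" for u
    using that by (intro poly_functions.coord) simp
  have bY: "bcoord j i \<in> poly_functions ?Y" if "j < s" "i < r" for j i
    using coord[of "Inl (j, i)"] that by (auto simp: set_chart coord_fun_def)
  have aY: "acoord i k \<in> poly_functions ?Y" if "i < r" "k \<in> {..<s} - f ` {..<r}" for i k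
    using coord[of "Inr (i, k)"] that by (auto simp: set_chart coord_fun_def)
  note det = det_rows_mat_poly[OF f(1)]
  show ?thesis
    using x
  proof (cases rule: coordsE)
    case (b i j)
    then have "(\<lambda>p. det (rows_mat f p) * x p) \<in> poly_functions ?Y"
      using bY[of j i] det
      by (auto intro: poly_functions.mult)
    then show ?thesis
      by (rule bexI[rotated]) simp
  next
    case (a i j)
    show ?thesis
    proof (cases "j \<in> f ` {..<r}")
      case False
      then have "(\<lambda>p. det (rows_mat f p) * x p) \<in> poly_functions ?Y"
        using aY[of i j] det a
        by (auto intro: poly_functions.mult)
      then show ?thesis
        by (rule bexI[rotated]) simp
    next
      case True
      then obtain c where c: "c < r" "j = f c" by auto
      let ?J = "{..<s} - f ` {..<r}"
      \<comment> \<open>The right-hand side of the system times column \<open>c\<close> of the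
        adjugate.\<close>
      define N where "N p = (\<Sum>d<r. ((if i = d then 1 else 0) - (\<Sum>k\<in>?J. acoord i k p * bcoord k d p)) *
        adj_mat (rows_mat f p) $$ (d, c))" for p
      have NY: "N \<in> poly_functions ?Y"
        unfolding N_def[abs_def] using c(1) a(1)
        by (intro poly_functions_sum poly_functions.mult poly_functions_diff poly_functions.const
            poly_functions_adj_mat[OF rows_mat_carrier rows_mat_poly[OF f(1)]]
            aY bY) auto
      have "det (rows_mat f p) * x p = N p" if p: "p \<in> GSV r s" for p
      proof -
        obtain A B where AB: "p = (A, B)" by (cases p)
        let ?M = "rows_mat f p" and ?adj = "adj_mat (rows_mat f p)"
        have rest: "(if i = d then 1 else 0) - (\<Sum>k\<in>?J. acoord i k p * bcoord k d p) =
            (\<Sum>e<r. A $$ (i, f e) * ?M $$ (e, d))" if d: "d < r" for d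
        proof -
          have "(if i = d then 1 else 0) = (\<Sum>k<s. A $$ (i, k) * B $$ (k, d))"
            using p a(1) d by (simp add: AB GSV_iff)
          also have "\<dots> = (\<Sum>k\<in>?J. A $$ (i, k) * B $$ (k, d)) + (\<Sum>k\<in>f ` {..<r}. A $$ (i, k) * B $$ (k, d))"
            by (rule sum.subset_diff[OF f(1)]) simp
          also have "(\<Sum>k\<in>f ` {..<r}. A $$ (i, k) * B $$ (k, d)) = (\<Sum>e<r. A $$ (i, f e) * B $$ (f e, d))"
            by (simp add: sum.reindex[OF f(2)])
          also have "\<dots> = (\<Sum>e<r. A $$ (i, f e) * ?M $$ (e, d))"
            using d by (intro sum.cong) (auto simp: rows_mat_def AB)
          finally show ?thesis
            by (simp add: acoord_def bcoord_def AB)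
        qed
        have "N p = (\<Sum>d<r. (\<Sum>e<r. A $$ (i, f e) * ?M $$ (e, d)) * ?adj $$ (d, c))"
          unfolding N_def using rest by (intro sum.cong) auto
        also have "\<dots> = (\<Sum>d<r. \<Sum>e<r. A $$ (i, f e) * (?M $$ (e, d) * ?adj $$ (d, c)))"
          by (simp add: sum_distrib_right mult.assoc)
        also have "\<dots> = (\<Sum>e<r. A $$ (i, f e) * (\<Sum>d<r. ?M $$ (e, d) * ?adj $$ (d, c)))"
          by (subst sum.swap) (simp add: sum_distrib_left)
        also have "\<dots> = (\<Sum>e<r. A $$ (i, f e) * (if e = c then det ?M else 0))"
          using c(1) by (intro sum.cong) (auto simp: adj_mat_sum[OF rows_mat_carrier])
        also have "\<dots> = det ?M * x p"
          using c by (simp add: a(3) acoord_def AB if_distrib cong: if_cong)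
        finally show ?thesis ..
      qed
      with NY show ?thesis
        by (intro bexI[of _ N]) auto
    qed
  qed
qed

lemma ex_chart:
  assumes "p \<in> GSV r s"
  shows "\<exists>f. f ` {..<r} \<subseteq> {..<s} \<and> inj_on f {..<r} \<and> det (rows_mat f p) \<noteq> 0"
proof -
  have "fst p \<in> carrier_mat r s" "snd p \<in> carrier_mat s r" "det (fst p * snd p) \<noteq> 0"
    using assms by (auto simp: GSV_def)
  then show ?thesis
    using ex_nonzero_mat_minor unfolding rows_mat_def by blast
qed

text \<open>Curves in \<open>GSV r s\<close> along which the coordinates of the standard chart move one at a time.
  Moving an entry of \<open>B\<close> forces all of \<open>A\<close> to change, by the Sherman-Morrison formula; hence
  the triangular rather than diagonal pattern of derivatives below.\<close>

definition b_curve :: "nat \<times> nat \<Rightarrow> complex mat \<times> complex mat \<Rightarrow> complex \<Rightarrow> complex mat \<times> complex mat" where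
  "b_curve u p t =
    (mat r s (\<lambda>(k, l). fst p $$ (k, l) -
       t / (1 + t * fst p $$ (snd u, fst u)) * (fst p $$ (k, fst u) * fst p $$ (snd u, l))),
     mat s r (\<lambda>v. snd p $$ v + (if v = u then t else 0)))"

text \<open>Let \<open>B1\<close> consist of the first \<open>r\<close> rows of \<open>B\<close> and
  \<open>B2\<close> of the others. For \<open>r \<le> k < s\<close> this is the row of
  \<open>(-B2 B1^-1 | 1)\<close> belonging to \<open>k\<close>. It lies in the left kernel of
  \<open>B\<close>, so it may be added to rows of \<open>A\<close> without affecting
  \<open>A B = 1\<close>.\<close>

definition kernel_row :: "nat \<Rightarrow> complex mat \<times> complex mat \<Rightarrow> nat \<Rightarrow> complex" where
  "kernel_row k p l = (if l < r then - (\<Sum>d<r. snd p $$ (k, d) * adj_mat (rows_mat id p) $$ (d, l)) /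
     det (rows_mat id p) else if l = k then 1 else 0)"

definition a_curve :: "nat \<times> nat \<Rightarrow> complex mat \<times> complex mat \<Rightarrow> complex \<Rightarrow> complex mat \<times> complex mat" where
  "a_curve u p t =
    (mat r s (\<lambda>(k, l). fst p $$ (k, l) + (if k = fst u then t * kernel_row (snd u) p l else 0)), snd p)"

text \<open>The first \<open>r\<close> entries contribute minus row \<open>k\<close> of
  \<open>B\<close>, since the inverse of the top block cancels against it; the entry 1 in column
  \<open>k\<close> contributes that row itself.\<close>

lemma kernel_row_mult:
  assumes p: "det (rows_mat id p) \<noteq> 0" and k: "r \<le> k" "k < s" and m: "m < r"
  shows "(\<Sum>l<s. kernel_row k p l * snd p $$ (l, m)) = 0"
proof -
  let ?M = "rows_mat id p"
  have "(\<Sum>l<s. kernel_row k p l * snd p $$ (l, m)) =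
    (\<Sum>l\<in>{..<s} - {..<r}. kernel_row k p l * snd p $$ (l, m)) + (\<Sum>l<r. kernel_row k p l * snd p $$ (l, m))"
    using k by (intro sum.subset_diff) auto
  also have "(\<Sum>l\<in>{..<s} - {..<r}. kernel_row k p l * snd p $$ (l, m)) =
    (\<Sum>l\<in>{..<s} - {..<r}. if l = k then snd p $$ (k, m) else 0)"
    by (intro sum.cong) (auto simp: kernel_row_def)
  also have "\<dots> = snd p $$ (k, m)"
    using k by simp
  also have "(\<Sum>l<r. kernel_row k p l * snd p $$ (l, m)) =
    (\<Sum>l<r. \<Sum>d<r. - (snd p $$ (k, d) * (adj_mat ?M $$ (d, l) * ?M $$ (l, m))) / det ?M)"
    using m by (intro sum.cong)
      (auto simp: kernel_row_def rows_mat_def sum_distrib_right sum_negf[symmetric] sum_divide_distrib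
        mult.assoc)
  also have "\<dots> = (\<Sum>d<r. - (snd p $$ (k, d) * (\<Sum>l<r. adj_mat ?M $$ (d, l) * ?M $$ (l, m))) / det ?M)"
    by (subst sum.swap) (simp add: sum_distrib_left sum_negf[symmetric] sum_divide_distrib)
  also have "\<dots> = (\<Sum>d<r. if d = m then - snd p $$ (k, m) else 0)"
    using m p by (intro sum.cong) (auto simp: adj_mat_sum(2)[OF rows_mat_carrier])
  also have "\<dots> = - snd p $$ (k, m)"
    using m by simp
  finally show ?thesis by simp
qed

lemma a_curve_mem:
  assumes p: "p \<in> GSV r s" "det (rows_mat id p) \<noteq> 0" and u: "fst u < r" "r \<le> snd u" "snd u < s"
  shows "a_curve u p t \<in> GSV r s"
proof -
  obtain A B where AB: "p = (A, B)" by (cases p)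
  have "(\<Sum>l<s. (A $$ (k, l) + (if k = fst u then t * kernel_row (snd u) p l else 0)) * B $$ (l, m)) =
    (if k = m then 1 else 0)" if km: "k < r" "m < r" for k m
  proof -
    have "(\<Sum>l<s. (A $$ (k, l) + (if k = fst u then t * kernel_row (snd u) p l else 0)) * B $$ (l, m)) =
      (\<Sum>l<s. A $$ (k, l) * B $$ (l, m)) +
      (if k = fst u then t * (\<Sum>l<s. kernel_row (snd u) p l * snd p $$ (l, m)) else 0)"
      by (simp add: AB distrib_right sum.distrib sum_distrib_left mult.assoc)
    also have "\<dots> = (\<Sum>l<s. A $$ (k, l) * B $$ (l, m))"
      using kernel_row_mult[OF p(2) u(2,3) km(2)] by simp
    finally show ?thesis
      using p(1) km by (simp add: AB GSV_iff)
  qed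
  then show ?thesis
    using p(1) unfolding AB by (simp add: a_curve_def GSV_iff)
qed

text \<open>With \<open>u = (j, i)\<close>, adding \<open>t\<close> to that entry of
  \<open>B\<close> turns \<open>A B\<close> into the identity plus \<open>t\<close> times column
  \<open>j\<close> of \<open>A\<close> placed in column \<open>i\<close>. The new first matrix is
  \<open>A\<close> multiplied from the left by the inverse of this matrix.\<close>

lemma b_curve_mem:
  assumes p: "p \<in> GSV r s" and u: "fst u < s" "snd u < r" and t: "1 + t * fst p $$ (snd u, fst u) \<noteq> 0"
  shows "b_curve u p t \<in> GSV r s"
proof -
  obtain A B where AB: "p = (A, B)" by (cases p)
  obtain j i where ji: "u = (j, i)" by (cases u)
  define c where "c = t / (1 + t * A $$ (i, j))"
  \<comment> \<open>The equation for the Sherman-Morrison coefficient; it cancels everything that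
    the change of \<open>B\<close> adds in column \<open>i\<close>.\<close>
  have c: "c * (1 + t * A $$ (i, j)) = t"
    using t by (simp add: c_def AB ji)
  have sum: "(\<Sum>l<s. A $$ (k, l) * B $$ (l, m)) = (if k = m then 1 else 0)" if "k < r" "m < r" for k m
    using p that by (simp add: AB GSV_iff)
  have "(\<Sum>l<s. (A $$ (k, l) - c * (A $$ (k, j) * A $$ (i, l))) *
      (B $$ (l, m) + (if (l, m) = u then t else 0))) = (if k = m then 1 else 0)"
    if km: "k < r" "m < r" for k m
  proof -
    have "(\<Sum>l<s. (A $$ (k, l) - c * (A $$ (k, j) * A $$ (i, l))) *
      (B $$ (l, m) + (if (l, m) = u then t else 0))) =
      (\<Sum>l<s. A $$ (k, l) * B $$ (l, m) - c * A $$ (k, j) * (A $$ (i, l) * B $$ (l, m)) +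
        (if l = j then (if m = i then t * (A $$ (k, j) - c * (A $$ (k, j) * A $$ (i, j))) else 0) else 0))"
      by (intro sum.cong) (auto simp: ji algebra_simps)
    also have "\<dots> = (if k = m then 1 else 0) - c * A $$ (k, j) * (if i = m then 1 else 0) +
      (if m = i then t * (A $$ (k, j) - c * (A $$ (k, j) * A $$ (i, j))) else 0)"
      using u km by (simp add: sum.distrib sum_subtractf sum_distrib_left[symmetric] sum ji)
    also have "\<dots> = (if k = m then 1 else 0) +
      (if m = i then A $$ (k, j) * (t - c * (1 + t * A $$ (i, j))) else 0)"
      by (auto simp: algebra_simps)
    finally show ?thesis
      by (simp add: c)
  qed
  then show ?thesis
    using p by (simp add: b_curve_def AB GSV_iff ji c_def)
qed

definition chart_curve ::
  "nat \<times> nat + nat \<times> nat \<Rightarrow> complex mat \<times> complex mat \<Rightarrow> complex \<Rightarrow> complex mat \<times> complex mat" where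
  "chart_curve = case_sum b_curve a_curve"

context
  fixes p u
  assumes p: "p \<in> GSV r s" "det (rows_mat id p) \<noteq> 0" and u: "u \<in> set (chart id)"
begin

lemma chart_curve_start: "chart_curve u p 0 = p"
proof -
  obtain A B where AB: "p = (A, B)" by (cases p)
  have "A \<in> carrier_mat r s" "B \<in> carrier_mat s r"
    using p(1) by (auto simp: AB GSV_def)
  then show ?thesis
    by (cases u) (auto simp: chart_curve_def a_curve_def b_curve_def AB intro!: eq_matI)
qed

lemma chart_curve_differentiable: "differentiable_curve (GSV r s) (GSV_coords r s) (chart_curve u p)"
  unfolding differentiable_curve_def
proof (intro conjI ballI)
  show "\<forall>\<^sub>F t in nhds 0. chart_curve u p t \<in> GSV r s"
  proof (cases u)
    case (Inl v)
    \<comment> \<open>The denominator in \<open>b_curve\<close> is 1 at the start, so the curve has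
      no pole near 0.\<close>
    have "((\<lambda>t. 1 + t * fst p $$ (snd v, fst v)) \<longlongrightarrow> 1 + 0 * fst p $$ (snd v, fst v)) (nhds 0)"
      by (intro tendsto_intros filterlim_ident)
    then have "\<forall>\<^sub>F t in nhds 0. 1 + t * fst p $$ (snd v, fst v) \<noteq> 0"
      by (rule tendsto_imp_eventually_ne) simp
    then show ?thesis
    proof eventually_elim
      case (elim t)
      then show ?case
        using b_curve_mem[OF p(1), of v t] u Inl by (auto simp: chart_curve_def set_chart)
    qed
  next
    case (Inr v)
    then show ?thesis
      using a_curve_mem[OF p, of v] u by (auto simp: chart_curve_def set_chart)
  qed
  fix x assume "x \<in> GSV_coords r s"
  then show "\<exists>d. ((\<lambda>t. x (chart_curve u p t)) has_field_derivative d) (at 0)"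
  proof (cases rule: coordsE)
    case (a i j)
    show ?thesis
    proof (cases u)
      case (Inl w)
      then show ?thesis
        using a by (auto simp: chart_curve_def b_curve_def acoord_def intro!: exI derivative_eq_intros)
    next
      case (Inr w)
      then show ?thesis
        using a by (cases "i = fst w")
          (auto simp: chart_curve_def a_curve_def acoord_def intro!: exI derivative_eq_intros)
    qed
  next
    case (b i j)
    show ?thesis
    proof (cases u)
      case (Inl w)
      then show ?thesis
        using b by (cases "(j, i) = w")
          (auto simp: chart_curve_def b_curve_def bcoord_def intro!: exI derivative_eq_intros)
    next
      case (Inr w)
      then show ?thesis
        using b by (auto simp: chart_curve_def a_curve_def bcoord_def intro!: exI derivative_eq_intros)
    qed
  qed
qed

text \<open>The hypothesis \<open>uv\<close> excludes exactly the case that an entry of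
  \<open>B\<close> is moved and an entry of \<open>A\<close> is observed, where the derivative need
  not vanish.\<close>

lemma chart_curve_derivative:
  assumes v: "v \<in> set (chart id)" and uv: "v = u \<or> (isl u \<longrightarrow> isl v)"
  shows "((\<lambda>t. coord_fun v (chart_curve u p t)) has_field_derivative (if v = u then 1 else 0)) (at 0)"
proof (cases v)
  case (Inl w)
  then obtain j i where w: "v = Inl (j, i)" "j < s" "i < r"
    using v by (auto simp: set_chart)
  show ?thesis
    using w by (cases u)
      (auto simp: chart_curve_def a_curve_def b_curve_def coord_fun_def bcoord_def
        intro!: derivative_eq_intros)
next
  case (Inr w)
  then obtain i k where w: "v = Inr (i, k)" "i < r" "r \<le> k" "k < s"
    using v by (auto simp: set_chart)
  then obtain i' k' where u': "u = Inr (i', k')"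
    using uv by (cases u) auto
  have "kernel_row k' p k = (if k = k' then 1 else 0)"
    using w by (simp add: kernel_row_def)
  then have "coord_fun v (chart_curve u p t) = fst p $$ (i, k) + (if v = u then t else 0)" for t
    using w by (auto simp: u' chart_curve_def a_curve_def coord_fun_def acoord_def)
  then show ?thesis
    by (auto intro!: derivative_eq_intros)
qed

end

text \<open>Entries of \<open>B\<close> stand before those of \<open>A\<close> in a chart. The
  coordinates preceding a moved entry of \<open>B\<close> are thus entries of \<open>B\<close>, so
  the case excluded in \<open>chart_curve_derivative\<close> does not occur for
  \<open>i < j\<close>.\<close>

lemma chart_isl_mono:
  assumes "i < j" "j < length (chart f)" "isl (chart f ! j)"
  shows "isl (chart f ! i)"
  using assms by (auto simp: chart_def nth_append split: if_splits)

end

theorem proposition1: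
  fixes r s :: nat
  assumes "1 \<le> r" and "r \<le> s"
  shows "canonical_divisors (r * s + r * (s - r)) (GSV r s) (GSV_coords r s) \<noteq> {} \<and>
    (\<forall>K \<in> canonical_divisors (r * s + r * (s - r)) (GSV r s) (GSV_coords r s).
       cartier_divisor (GSV r s) (GSV_coords r s) K)"
proof -
  let ?V = "GSV r s" and ?X = "GSV_coords r s" and ?n = "r * s + r * (s - r)"
  interpret integral_variety ?V ?X
    by unfold_locales (rule integral_GSV[OF assms(2)])
  \<comment> \<open>The standard chart serves to exhibit one nonzero form; the charts covering the
    variety are chosen point by point below.\<close>
  let ?L = "chart r s id" and ?h = "\<lambda>p. det (rows_mat r id p)"
  have id: "id ` {..<r} \<subseteq> {..<s}" "inj_on id {..<r}"
    using assms(2) by auto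
  have XP: "set (map coord_fun (chart r s f)) \<subseteq> PF" for f
    using chart_coords[of r s f] by (auto intro: poly_functions.coord)
  have len: "length ?L = ?n"
    by (rule length_chart[OF id])
  show ?thesis
  proof (rule canonical_divisors_cartier[where ys = "map coord_fun ?L"
        and \<gamma> = "\<lambda>j. chart_curve r s (?L ! j)"])
    fix p assume p: "p \<in> ?V"
    from ex_chart[OF p] obtain f where f: "f ` {..<r} \<subseteq> {..<s}" "inj_on f {..<r}"
      "det (rows_mat r f p) \<noteq> 0"
      by blast
    show "\<exists>xs. length xs = ?n \<and> set xs \<subseteq> PF \<and> (\<exists>h\<in>poly_functions (set xs). h p \<noteq> 0 \<and>
        (\<forall>x\<in>?X. \<exists>N\<in>poly_functions (set xs). \<forall>q\<in>?V. h q * x q = N q))"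
      using length_chart[OF f(1,2)] XP[of f] f(3) det_rows_mat_poly[OF f(1)] chart_rational[OF f(1,2)]
      by (intro exI[of _ "map coord_fun (chart r s f)"] conjI bexI[of _ "\<lambda>p. det (rows_mat r f p)"]) auto
  next
    have "?h \<in> PF"
      by (rule poly_functions_trans[OF det_rows_mat_poly[OF id(1)] XP])
    \<comment> \<open>One point with nonzero determinant is enough for the standard chart to be
      valid generically.\<close>
    moreover have "rows_mat r id (base_point r s) = 1\<^sub>m r"
      using assms(2) by (intro eq_matI) (auto simp: rows_mat_def base_point_def)
    then have "nonvanishing ?V ?h"
      using base_point_mem[OF assms(2)] by (auto simp: nonvanishing_def intro!: bexI[of _ "base_point r s"])
    ultimately have "\<forall>\<^sub>F p in generic. p \<in> ?V \<and> ?h p \<noteq> 0"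
      unfolding eventually_generic by blast
    then show "\<forall>\<^sub>F p in generic. \<forall>j<?n. differentiable_curve ?V ?X (chart_curve r s (?L ! j) p) \<and>
      chart_curve r s (?L ! j) p 0 = p \<and>
      ((\<lambda>t. (map coord_fun ?L ! j) (chart_curve r s (?L ! j) p t)) has_field_derivative 1) (at 0) \<and>
      (\<forall>i<j. ((\<lambda>t. (map coord_fun ?L ! i) (chart_curve r s (?L ! j) p t)) has_field_derivative 0) (at 0))"
    proof eventually_elim
      case (elim p)
      then have p: "p \<in> ?V" "det (rows_mat r id p) \<noteq> 0" by auto
      have u: "?L ! j \<in> set ?L" if "j < ?n" for j
        using that len by simp
      have diag: "((\<lambda>t. (map coord_fun ?L ! j) (chart_curve r s (?L ! j) p t)) has_field_derivative 1) (at 0)"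
        if "j < ?n" for j
        using chart_curve_derivative[OF p u[OF that] u[OF that]] that len by simp
      have off: "((\<lambda>t. (map coord_fun ?L ! i) (chart_curve r s (?L ! j) p t)) has_field_derivative 0) (at 0)"
        if "i < j" "j < ?n" for i j
      proof -
        have "?L ! i \<noteq> ?L ! j"
          using that len distinct_chart[of r s id] by (simp add: nth_eq_iff_index_eq)
        then show ?thesis
          using chart_curve_derivative[OF p u[OF that(2)] u[of i]] chart_isl_mono[of i j r s id]
            that len by auto
      qed
      show ?case
        using chart_curve_differentiable[OF p u] chart_curve_start[OF p u] diag off
        by blast
    qed
  qed (use len XP in auto)
qed

end
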